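(* Let $n\ge1$ be an integer, $p\in[1,\infty)$ and $l\in\mathbb{N}$. Then, for any $v\in W^{l+1,p}(\mathbb{R}^n)$, $$\lim_{\sigma\to1^{-}}(1-\sigma)\,|v|_{l+\sigma,p,\mathbb{R}^n}^p=p^{-1}K_{p,n}\,|\nabla v|_{l,p,\mathbb{R}^n}^p,$$ where $$K_{p,n}=\int_{S_{n-1}}|\omega\cdot\nu|^p\,d\omega,$$ $\nu$ being any unit vector in $\mathbb{R}^n$.
   Context: $\mathbb{N}$ contains $0$. $|\cdot|$ is the Euclidean norm on $\mathbb{R}^n$; $S_{n-1}=\{x\in\mathbb{R}^n : |x|=1\}$ is the unit sphere, with surface measure $d\omega$. For a multi-index $\alpha\in\mathbb{N}^n$, $|\alpha|=\alpha_1+\cdots+\alpha_n$ and $\partial^\alpha$ is the corresponding distributional derivative. For $r\in\mathbb{N}$, $W^{r,p}(\mathbb{R}^n)$ is the usual Sobolev space of $v\in L^p(\mathbb{R}^n)$ with $\partial^\alpha v\in L^p(\mathbb{R}^n)$ for all $|\alpha|\le r$. For $l\in\mathbb{N}$ and $\sigma\in(0,1)$, the intrinsic (Gagliardo) semi-norm of order $l+\sigma$ is defined by $$|v|_{l+\sigma,p,\mathbb{R}^n}^p=\sum_{|\alpha|=l}\int_{\mathbb{R}^n\times\mathbb{R}^n}\frac{|\partial^\alpha v(x)-\partial^\alpha v(y)|^p}{|x-y|^{n+p\sigma}}\,dx\,dy.$$ For $l\in\mathbb{N}$ and $v\in W^{l+1,p}(\mathbb{R}^n)$, $$|\nabla v|_{0,p,\mathbb{R}^n}=\Bigl(\int_{\mathbb{R}^n}|\nabla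 v(x)|^p\,dx\Bigr)^{1/p},\qquad |\nabla v|_{l,p,\mathbb{R}^n}=\Bigl(\sum_{|\alpha|=l}|\nabla(\partial^\alpha v)|_{0,p,\mathbb{R}^n}^p\Bigr)^{1/p}.$$ *)

theory Defs
  imports "HOL-Analysis.Analysis"
begin

text \<open>Multi-indices on $\mathbb{R}^n$ are functions \<open>'n \<Rightarrow> nat\<close>, where \<open>n = CARD('n)\<close>.\<close>

type_synonym 'n multi_index = "'n \<Rightarrow> nat"

definition mi_order :: "'n::finite multi_index \<Rightarrow> nat"
  where "mi_order \<alpha> = (\<Sum>i\<in>UNIV. \<alpha> i)"

definition mi_unit :: "'n::finite \<Rightarrow> 'n multi_index"
  where "mi_unit i = (\<lambda>j. if j = i then 1 else 0)"

definition partial_deriv :: "'n::finite \<Rightarrow> (real^'n \<Rightarrow> real) \<Rightarrow> real^'n \<Rightarrow> real"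
  where "partial_deriv i f x = frechet_derivative f (at x) (axis i 1)"

definition iter_partial :: "'n::finite list \<Rightarrow> (real^'n \<Rightarrow> real) \<Rightarrow> real^'n \<Rightarrow> real"
  where "iter_partial is f = foldr partial_deriv is f"

text \<open>
  Infinitely differentiable: iterated partial derivatives of every order exist and are
  (Frechet) differentiable everywhere, hence also continuous.
\<close>

definition smooth :: "(real^'n::finite \<Rightarrow> real) \<Rightarrow> bool"
  where "smooth f \<longleftrightarrow> (\<forall>is x. iter_partial is f differentiable (at x))"

definition test_function :: "(real^'n::finite \<Rightarrow> real) \<Rightarrow> bool"
  where "test_function \<phi> \<longleftrightarrow> smooth \<phi> \<and> compact (closure {x. \<phi> x \<noteq> 0})"

text \<open>
  The classical derivative $\partial^\alpha$: differentiate \<open>\<alpha> i\<close> times in each direction \<open>i\<close>.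
  The index type carries no order, so some order of differentiation is picked; for
  smooth functions all orders agree, by symmetry of second derivatives.
\<close>

definition classical_deriv :: "'n::finite multi_index \<Rightarrow> (real^'n \<Rightarrow> real) \<Rightarrow> real^'n \<Rightarrow> real"
  where "classical_deriv \<alpha> f = iter_partial (SOME is. \<forall>i. count_list is i = \<alpha> i) f"

definition locally_integrable :: "(real^'n::finite \<Rightarrow> real) \<Rightarrow> bool"
  where "locally_integrable u \<longleftrightarrow> (\<forall>K. compact K \<longrightarrow> u absolutely_integrable_on K)"

text \<open>The distributional derivative $\partial^\alpha v$ is (represented by) the function \<open>w\<close>.\<close>

definition has_weak_deriv ::
    "'n::finite multi_index \<Rightarrow> (real^'n \<Rightarrow> real) \<Rightarrow> (real^'n \<Rightarrow> real) \<Rightarrow> bool"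
  where "has_weak_deriv \<alpha> v w \<longleftrightarrow>
    locally_integrable v \<and> locally_integrable w \<and>
    (\<forall>\<phi>. test_function \<phi> \<longrightarrow>
      (LINT x|lebesgue. v x * classical_deriv \<alpha> \<phi> x)
        = (- 1) ^ mi_order \<alpha> * (LINT x|lebesgue. w x * \<phi> x))"

text \<open>
  A representative of $\partial^\alpha v$, which is unique up to null sets; it is meaningful only
  if $\partial^\alpha v$ is a locally integrable function.
\<close>

definition weak_deriv :: "'n::finite multi_index \<Rightarrow> (real^'n \<Rightarrow> real) \<Rightarrow> real^'n \<Rightarrow> real"
  where "weak_deriv \<alpha> v = (SOME w. has_weak_deriv \<alpha> v w)"

definition weak_gradient :: "(real^'n::finite \<Rightarrow> real) \<Rightarrow> real^'n \<Rightarrow> real^'n"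
  where "weak_gradient u x = (\<chi> i. weak_deriv (mi_unit i) u x)"

definition Lp :: "real \<Rightarrow> (real^'n::finite \<Rightarrow> real) set"
  where "Lp p = {u. u \<in> borel_measurable lebesgue \<and> integrable lebesgue (\<lambda>x. \<bar>u x\<bar> powr p)}"

definition sobolev :: "nat \<Rightarrow> real \<Rightarrow> (real^'n::finite \<Rightarrow> real) set"
  where "sobolev r p =
    {v \<in> Lp p. \<forall>\<alpha>. mi_order \<alpha> \<le> r \<longrightarrow> (\<exists>w\<in>Lp p. has_weak_deriv \<alpha> v w)}"

text \<open>
  The \<open>p\<close>-th power $|v|_{l+\sigma,p}^p$ of the intrinsic semi-norm, valued in \<open>ennreal\<close>
  since it is infinite for some functions.
\<close>

definition gagliardo_pow :: "nat \<Rightarrow> real \<Rightarrow> real \<Rightarrow> (real^'n::finite \<Rightarrow> real) \<Rightarrow> ennreal"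
  where "gagliardo_pow l \<sigma> p v =
    (\<Sum>\<alpha> | mi_order \<alpha> = l.
      \<integral>\<^sup>+ (x, y). ennreal (\<bar>weak_deriv \<alpha> v x - weak_deriv \<alpha> v y\<bar> powr p
                        / norm (x - y) powr (real CARD('n) + p * \<sigma>)) \<partial>lebesgue)"

definition grad_norm :: "real \<Rightarrow> (real^'n::finite \<Rightarrow> real) \<Rightarrow> real"
  where "grad_norm p u = (LINT x|lebesgue. norm (weak_gradient u x) powr p) powr (1 / p)"

definition grad_seminorm :: "nat \<Rightarrow> real \<Rightarrow> (real^'n::finite \<Rightarrow> real) \<Rightarrow> real"
  where "grad_seminorm l p v =
    (\<Sum>\<alpha> | mi_order \<alpha> = l. grad_norm p (weak_deriv \<alpha> v) powr p) powr (1 / p)"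

text \<open>
  Surface measure on the unit sphere of $\mathbb{R}^n$: the measure of \<open>A\<close> is \<open>n\<close> times the
  volume of the cone $\{r\omega : 0 < r < 1, \omega \in A\}$.
  For \<open>n = 1\<close> this is the counting measure on $\{-1, 1\}$.
\<close>

definition sphere_measure :: "(real^'n::finite) measure"
  where "sphere_measure =
    scale_measure (of_nat CARD('n))
      (distr (restrict_space lborel (ball 0 1 - {0})) (restrict_space borel (sphere 0 1))
        (\<lambda>x. x /\<^sub>R norm x))"

definition K_const :: "real \<Rightarrow> real^'n::finite \<Rightarrow> real"
  where "K_const p \<nu> = (LINT \<omega>|sphere_measure. \<bar>\<omega> \<bullet> \<nu>\<bar> powr p)"

end

theory Submission
  imports Defs
begin

text \<open>
  Let \<open>u\<close> be a weak derivative of order \<open>l\<close> of \<open>v\<close> and \<open>g\<close> its weak gradient; both are in \<open>L\<^sup>p\<close>. The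
  substitution \<open>y = x + h\<close> turns the double integral of \<open>u\<close> into the integral of
  \<open>F h \<bar>h\<bar> powr - (n + p \<sigma>)\<close> with \<open>F h = \<integral> \<bar>u (x + h) - u x\<bar>\<^sup>p dx\<close>. As \<open>\<sigma>\<close> tends to \<open>1\<close>, the factor
  \<open>1 - \<sigma>\<close> suppresses all \<open>h\<close> outside any neighbourhood of \<open>0\<close>. Near \<open>0\<close>, in turn, \<open>F h\<close> is close to
  \<open>\<Phi> h = \<integral> \<bar>h \<bullet> g x\<bar>\<^sup>p dx\<close>, which is homogeneous of degree \<open>p\<close> in \<open>h\<close>. Integrating \<open>\<Phi> h \<bar>h\<bar> powr - (n + p \<sigma>)\<close>
  radially over a ball of radius \<open>R\<close> gives \<open>R powr s / s\<close> with \<open>s = p (1 - \<sigma>)\<close>, hence \<open>1 / p\<close> in the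
  limit, and integrating over the directions of \<open>h\<close> gives \<open>K \<integral> \<bar>g\<bar>\<^sup>p\<close>.

  The comparison of \<open>F\<close> with \<open>\<Phi>\<close> rests on the identity
  \<open>u (x + h) - u x = \<integral>\<^sub>0\<^sup>1 h \<bullet> g (x + t h) dt\<close> for almost all \<open>x\<close> (\<open>weak_line_identity\<close>), which
  follows directly from the definition of the weak gradient, Fubini's theorem and the fundamental lemma
  of the calculus of variations (\<open>fundamental_lemma\<close>). Jensen's inequality then gives \<open>F \<le> \<Phi>\<close>
  everywhere (\<open>increment_le_slope\<close>). Conversely, since translations act continuously on \<open>L\<^sup>p\<close>
  (\<open>translation_continuous_Lp\<close>), the difference \<open>u (x + h) - u x - h \<bullet> g x\<close> has \<open>L\<^sup>p\<close> norm \<open>o(\<bar>h\<bar>)\<close>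
  uniformly in the direction of \<open>h\<close>, and by convexity \<open>\<Phi>\<close> is at most a factor close to \<open>1\<close> times \<open>F\<close>, up
  to a small multiple of \<open>\<bar>h\<bar>\<^sup>p\<close> (\<open>slope_le_increment\<close>).

  The surface measure is defined by volumes of cones, so integrals over the sphere are integrals over the
  ball of functions that are constant on rays, and radial integration is a layer decomposition of a
  power of \<open>\<bar>x\<bar>\<close> (\<open>nn_integral_homogeneous_powr\<close>). That \<open>K\<close> does not depend on the unit vector is the
  rotation invariance of Lebesgue measure (\<open>nn_integral_orthogonal_transformation\<close>).

  Finally, the gradient of \<open>u\<close> consists of weak derivatives of \<open>v\<close> of order \<open>l + 1\<close>
  (\<open>has_weak_deriv_compose\<close>); this uses the symmetry of mixed partial derivatives of test functions.
  Weak derivatives are unique up to null sets (\<open>has_weak_deriv_unique\<close>), so the chosen representatives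
  have the required integrability, and summing over the multi-indices of order \<open>l\<close> proves the theorem.
\<close>

section \<open>Smooth functions and bump functions\<close>

lemma iter_partial_Nil [simp]: "iter_partial [] f = f"
  by (simp add: iter_partial_def)

lemma iter_partial_Cons [simp]: "iter_partial (i # is) f = partial_deriv i (iter_partial is f)"
  by (simp add: iter_partial_def)

lemma iter_partial_append: "iter_partial (is @ js) f = iter_partial is (iter_partial js f)"
  by (simp add: iter_partial_def)

lemma smooth_imp_differentiable: "smooth f \<Longrightarrow> f differentiable (at x)"
  unfolding smooth_def by (metis iter_partial_Nil)

lemma smooth_iter_partial: "smooth f \<Longrightarrow> smooth (iter_partial is f)"
  unfolding smooth_def by (metis iter_partial_append)

lemma smooth_partial_deriv: "smooth f \<Longrightarrow> smooth (partial_deriv i f)"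
  using smooth_iter_partial[of f "[i]"] by simp

text \<open>
  Smoothness asks for all iterated partial derivatives at once. It suffices to find a class of
  differentiable functions that contains the function and is closed under partial derivatives.
\<close>

lemma smooth_coinduct:
  assumes "f \<in> S"
    and "\<And>f x. f \<in> S \<Longrightarrow> f differentiable (at x)"
    and "\<And>f i. f \<in> S \<Longrightarrow> partial_deriv i f \<in> S"
  shows "smooth f"
proof -
  have "iter_partial is f \<in> S" for "is"
    by (induction "is") (use assms in auto)
  with assms(2) show ?thesis
    unfolding smooth_def by blast
qed

lemma partial_deriv_eqI:
  "(f has_derivative D) (at x) \<Longrightarrow> partial_deriv i f x = D (axis i 1)"
  unfolding partial_deriv_def by (metis frechet_derivative_at)

lemma has_derivative_partial_derivs:
  assumes "f differentiable (at x)"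
  shows "(f has_derivative (\<lambda>h. \<Sum>i\<in>UNIV. h $ i * partial_deriv i f x)) (at x)"
proof -
  have D: "(f has_derivative frechet_derivative f (at x)) (at x)"
    using assms frechet_derivative_works by blast
  then interpret linear "frechet_derivative f (at x)"
    by (rule has_derivative_linear)
  have "frechet_derivative f (at x) h = (\<Sum>i\<in>UNIV. h $ i * partial_deriv i f x)" for h
  proof -
    have "frechet_derivative f (at x) h = frechet_derivative f (at x) (\<Sum>i\<in>UNIV. h $ i *\<^sub>R axis i 1)"
      by (simp add: basis_expansion [of h, unfolded scalar_mult_eq_scaleR])
    then show ?thesis
      by (simp add: sum scale partial_deriv_def)
  qed
  then have "frechet_derivative f (at x) = (\<lambda>h. \<Sum>i\<in>UNIV. h $ i * partial_deriv i f x)"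
    by blast
  with D show ?thesis by simp
qed

lemma partial_deriv_shift:
  "partial_deriv i (\<lambda>x. f (x + c)) = (\<lambda>x. partial_deriv i f (x + c))"
proof -
  have "((\<lambda>x. f (x + c)) has_derivative D) (at x) \<longleftrightarrow> (f has_derivative D) (at (x + c))" for D x
  proof
    assume "((\<lambda>x. f (x + c)) has_derivative D) (at x)"
    then have "((\<lambda>x. f (x + c)) \<circ> (\<lambda>y. y - c) has_derivative D \<circ> (\<lambda>h. h)) (at (x + c))"
      by (intro diff_chain_at) (auto intro!: derivative_eq_intros)
    then show "(f has_derivative D) (at (x + c))"
      by (simp add: o_def)
  next
    assume "(f has_derivative D) (at (x + c))"
    then have "(f \<circ> (\<lambda>x. x + c) has_derivative D \<circ> (\<lambda>h. h)) (at x)"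
      by (intro diff_chain_at) (auto intro!: derivative_eq_intros)
    then show "((\<lambda>x. f (x + c)) has_derivative D) (at x)"
      by (simp add: o_def)
  qed
  then show ?thesis
    by (simp add: partial_deriv_def frechet_derivative_def fun_eq_iff)
qed

lemma smooth_shift:
  assumes "smooth f"
  shows "smooth (\<lambda>x. f (x + c))"
proof (rule smooth_coinduct[of _ "{(\<lambda>x. f (x + c)) | f. smooth f}"])
  fix g x assume "g \<in> {\<lambda>x. f (x + c) |f. smooth f}"
  then obtain f where g: "g = (\<lambda>x. f (x + c))" and "smooth f" by blast
  then obtain D where "(f has_derivative D) (at (x + c))"
    using smooth_imp_differentiable differentiable_def by blast
  then have "(f \<circ> (\<lambda>x. x + c) has_derivative D \<circ> (\<lambda>h. h)) (at x)"
      by (intro diff_chain_at) (auto intro!: derivative_eq_intros)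
  then show "g differentiable at x"
    unfolding g differentiable_def o_def by blast
next
  fix g i assume "g \<in> {\<lambda>x. f (x + c) |f. smooth f}"
  then show "partial_deriv i g \<in> {\<lambda>x. f (x + c) |f. smooth f}"
    by (auto simp: partial_deriv_shift intro: smooth_partial_deriv)
qed (use assms in blast)

lemma test_function_shift:
  assumes "test_function \<phi>"
  shows "test_function (\<lambda>x. \<phi> (x + c))"
proof -
  have "{x. \<phi> (x + c) \<noteq> 0} = (\<lambda>x. x - c) ` {x. \<phi> x \<noteq> 0}"
    by (auto simp: image_iff) (metis add_diff_cancel)
  then have "closure {x. \<phi> (x + c) \<noteq> 0} = (\<lambda>x. x - c) ` closure {x. \<phi> x \<noteq> 0}"
    using closure_translation[of "- c" "{x. \<phi> x \<noteq> 0}"] by simp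
  moreover have "compact ((\<lambda>x. x - c) ` closure {x. \<phi> x \<noteq> 0})"
    using assms unfolding test_function_def by (blast intro: compact_translation_subtract)
  ultimately show ?thesis
    using assms by (simp add: test_function_def smooth_shift)
qed

text \<open>
  Outside the closed support the function vanishes on a neighbourhood, so differentiation
  does not enlarge the support.
\<close>

lemma test_function_partial_deriv:
  assumes "test_function \<phi>"
  shows "test_function (partial_deriv i \<phi>)"
proof -
  let ?C = "closure {x. \<phi> x \<noteq> 0}"
  have "partial_deriv i \<phi> x = 0" if "x \<notin> ?C" for x
  proof -
    have "(\<phi> has_derivative (\<lambda>h. 0)) (at x)"
    proof (rule has_derivative_transform_within_open)
      show "((\<lambda>_. 0) has_derivative (\<lambda>h. 0)) (at x)" by simp
      show "open (- ?C)" by (rule open_Compl) simp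
      show "\<And>y. y \<in> - ?C \<Longrightarrow> 0 = \<phi> y"
        using closure_subset[of "{x. \<phi> x \<noteq> 0}"] by force
    qed (use that in simp)
    then show ?thesis by (simp add: partial_deriv_eqI)
  qed
  then have "closure {x. partial_deriv i \<phi> x \<noteq> 0} \<subseteq> ?C"
    by (intro closure_minimal) auto
  then have "compact (closure {x. partial_deriv i \<phi> x \<noteq> 0})"
    using assms unfolding test_function_def by (metis closed_closure compact_Int_closed inf.absorb_iff2)
  then show ?thesis
    using assms by (simp add: test_function_def smooth_partial_deriv)
qed

lemma test_function_continuous: "test_function \<phi> \<Longrightarrow> continuous_on UNIV \<phi>"
  by (meson test_function_def continuous_at_imp_continuous_on differentiable_imp_continuous_within smooth_imp_differentiable)

lemma test_function_measurable: "test_function \<phi> \<Longrightarrow> \<phi> \<in> borel_measurable borel"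
  by (simp add: borel_measurable_continuous_onI test_function_continuous)

lemma test_function_bounds:
  assumes "test_function \<phi>"
  obtains C R where "C \<ge> 0" "R > 0" "\<And>x. \<bar>\<phi> x\<bar> \<le> C" "\<And>x. norm x > R \<Longrightarrow> \<phi> x = 0"
proof -
  let ?K = "closure {x. \<phi> x \<noteq> 0}"
  have K: "compact ?K" using assms by (simp add: test_function_def)
  then obtain R where R: "R > 0" "\<And>x. x \<in> ?K \<Longrightarrow> norm x \<le> R"
    by (meson bounded_pos compact_imp_bounded)
  have "compact (\<phi> ` ?K)"
    using K test_function_continuous[OF assms] by (meson compact_continuous_image continuous_on_subset subset_UNIV)
  then obtain C where C: "C > 0" "\<And>x. x \<in> ?K \<Longrightarrow> \<bar>\<phi> x\<bar> \<le> C"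
    by (metis bounded_pos compact_imp_bounded imageI real_norm_def)
  have 0: "\<phi> x = 0" if "x \<notin> ?K" for x
    using that closure_subset[of "{x. \<phi> x \<noteq> 0}"] by blast
  show ?thesis
  proof
    show "\<bar>\<phi> x\<bar> \<le> C" for x using C 0[of x] by (cases "x \<in> ?K") auto
    show "\<phi> x = 0" if "norm x > R" for x using R(2)[of x] 0[of x] that by fastforce
  qed (use C R in auto)
qed

text \<open>
  The classical flat function \<open>exp (- c / t)\<close>, divided by \<open>t ^ j\<close> and extended by \<open>0\<close> to \<open>t \<le> 0\<close>.
  The powers of \<open>t\<close> are included because they appear when one differentiates.
\<close>

definition flat :: "real \<Rightarrow> nat \<Rightarrow> real \<Rightarrow> real"
  where "flat c j t = (if t > 0 then exp (- c * inverse t) * inverse t ^ j else 0)"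

lemma power_div_fact_le_exp:
  assumes "x \<ge> 0" shows "x ^ m / fact m \<le> exp (x::real)"
proof -
  have "(\<Sum>k\<in>{m}. x ^ k /\<^sub>R fact k) \<le> (\<Sum>k. x ^ k /\<^sub>R fact k)"
    using assms by (intro sum_le_suminf summable_exp_generic) auto
  then show ?thesis by (simp add: exp_def field_simps)
qed

text \<open>
  One term of the exponential series of \<open>c / t\<close> outweighs \<open>t ^ j\<close>; taking the term of order
  \<open>j + 2\<close> leaves a quadratic bound, which makes the derivative at \<open>0\<close> vanish.
\<close>

lemma flat_quadratic_bound:
  assumes "c > 0"
  shows "\<bar>flat c j t\<bar> \<le> fact (j + 2) / c ^ (j + 2) * t\<^sup>2"
proof (cases "t > 0")
  case True
  have "(c / t) ^ (j + 2) / fact (j + 2) \<le> exp (c / t)"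
    using True assms by (intro power_div_fact_le_exp) auto
  then have "exp (- (c / t)) \<le> fact (j + 2) / (c / t) ^ (j + 2)"
    using True assms by (simp add: exp_minus field_simps del: power_Suc fact_Suc)
  also have "\<dots> = fact (j + 2) / c ^ (j + 2) * t\<^sup>2 * t ^ j"
    using True assms by (simp add: power_divide power_add power2_eq_square field_simps del: fact_Suc)
  finally show ?thesis
    using True by (simp add: flat_def divide_inverse [symmetric] power_inverse pos_divide_le_eq del: fact_Suc)
qed (use assms in \<open>simp add: flat_def\<close>)

lemma flat_has_real_derivative:
  assumes "c > 0"
  shows "(flat c j has_real_derivative c * flat c (j + 2) t - j * flat c (j + 1) t) (at t)"
proof -
  consider "t > 0" | "t < 0" | "t = 0" by linarith
  then show ?thesis
  proof cases
    case 1
    have "((\<lambda>t. exp (- c * inverse t) * inverse t ^ j) has_real_derivative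
        exp (- c * inverse t) * (c * inverse t ^ 2) * inverse t ^ j
          + exp (- c * inverse t) * (j * inverse t ^ (j - 1) * - (inverse t ^ 2))) (at t)"
      using 1 by (auto intro!: derivative_eq_intros simp: power2_eq_square)
    also have "exp (- c * inverse t) * (c * inverse t ^ 2) * inverse t ^ j
          + exp (- c * inverse t) * (j * inverse t ^ (j - 1) * - (inverse t ^ 2))
        = c * flat c (j + 2) t - j * flat c (j + 1) t"
      using 1 by (cases j) (simp_all add: flat_def power2_eq_square mult_ac)
    finally have "((\<lambda>t. exp (- c * inverse t) * inverse t ^ j) has_real_derivative
        c * flat c (j + 2) t - j * flat c (j + 1) t) (at t)" .
    then show ?thesis
      by (rule has_field_derivative_transform_within_open[of _ _ _ "{0<..}"]) (use 1 in \<open>auto simp: flat_def\<close>)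
  next
    case 2
    have "((\<lambda>t. 0) has_real_derivative c * flat c (j + 2) t - j * flat c (j + 1) t) (at t)"
      using 2 by (simp add: flat_def)
    then show ?thesis
      by (rule has_field_derivative_transform_within_open[of _ _ _ "{..<0}"]) (use 2 in \<open>auto simp: flat_def\<close>)
  next
    case 3
    define M where "M = fact (j + 2) / c ^ (j + 2)"
    have "((\<lambda>h. flat c j h / h) \<longlongrightarrow> 0) (at 0)"
    proof (rule Lim_null_comparison)
      have "norm (flat c j h / h) \<le> M * \<bar>h\<bar>" if "h \<noteq> 0" for h
      proof -
        have "\<bar>flat c j h\<bar> \<le> (M * \<bar>h\<bar>) * \<bar>h\<bar>"
          using flat_quadratic_bound[OF assms, of j h] by (simp add: M_def power2_eq_square mult.assoc)
        then show ?thesis using that by (simp add: pos_divide_le_eq)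
      qed
      then show "\<forall>\<^sub>F h in at 0. norm (flat c j h / h) \<le> M * \<bar>h\<bar>"
        by (simp add: eventually_at_filter)
      show "((\<lambda>h. M * \<bar>h\<bar>) \<longlongrightarrow> 0) (at 0)"
        by (auto intro!: tendsto_eq_intros)
    qed
    then show ?thesis
      using 3 by (simp add: DERIV_def flat_def)
  qed
qed

text \<open>
  The algebra generated by the flat functions of the distances to coordinate hyperplanes.
  It is generated inductively so that its closure under partial derivatives, hence the smoothness
  of its members, follows by rule induction from the product rule.
\<close>

inductive_set bump_algebra :: "(real^'n::finite \<Rightarrow> real) set" where
  left: "c > 0 \<Longrightarrow> (\<lambda>x. flat c j (x $ i - a)) \<in> bump_algebra"
| right: "c > 0 \<Longrightarrow> (\<lambda>x. flat c j (a - x $ i)) \<in> bump_algebra"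
| const: "(\<lambda>x. a) \<in> bump_algebra"
| add: "f \<in> bump_algebra \<Longrightarrow> g \<in> bump_algebra \<Longrightarrow> (\<lambda>x. f x + g x) \<in> bump_algebra"
| mult: "f \<in> bump_algebra \<Longrightarrow> g \<in> bump_algebra \<Longrightarrow> (\<lambda>x. f x * g x) \<in> bump_algebra"

lemma bump_algebra_derivative:
  assumes "f \<in> bump_algebra"
  shows "\<exists>D. (\<forall>x. (f has_derivative D x) (at x)) \<and> (\<forall>h. (\<lambda>x. D x h) \<in> bump_algebra)"
  using assms
proof induction
  case (left c j i a)
  let ?d = "\<lambda>t. c * flat c (j + 2) t - j * flat c (j + 1) t"
  have "((\<lambda>x. flat c j (x $ i - a)) has_derivative (\<lambda>h. h $ i * ?d (x $ i - a))) (at x)" for x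
    by (rule has_derivative_compose[OF _ flat_has_real_derivative[OF left, unfolded has_field_derivative_def], of "\<lambda>x. x $ i - a" "\<lambda>h. h $ i", THEN has_derivative_eq_rhs])
      (auto intro!: derivative_eq_intros bounded_linear_imp_has_derivative bounded_linear_vec_nth)
  moreover have "(\<lambda>x. h * (c * flat c (j + 2) (x $ i - a) + (- real j) * flat c (j + 1) (x $ i - a))) \<in> bump_algebra" for h
    by (intro bump_algebra.intros left)
  ultimately show ?case
    by (intro exI[of _ "\<lambda>x h. h $ i * ?d (x $ i - a)"]) simp
next
  case (right c j a i)
  let ?d = "\<lambda>t. c * flat c (j + 2) t - j * flat c (j + 1) t"
  have "((\<lambda>x. flat c j (a - x $ i)) has_derivative (\<lambda>h. - h $ i * ?d (a - x $ i))) (at x)" for x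
    by (rule has_derivative_compose[OF _ flat_has_real_derivative[OF right, unfolded has_field_derivative_def], of "\<lambda>x. a - x $ i" "\<lambda>h. - h $ i", THEN has_derivative_eq_rhs])
      (auto intro!: derivative_eq_intros bounded_linear_imp_has_derivative bounded_linear_vec_nth)
  moreover have "(\<lambda>x. (- h) * (c * flat c (j + 2) (a - x $ i) + (- real j) * flat c (j + 1) (a - x $ i))) \<in> bump_algebra" for h
    by (intro bump_algebra.intros right)
  ultimately show ?case
    by (intro exI[of _ "\<lambda>x h. - h $ i * ?d (a - x $ i)"]) simp
next
  case (const a)
  have "(\<lambda>x. 0) \<in> bump_algebra" by (rule bump_algebra.const)
  then show ?case by (intro exI[of _ "\<lambda>x h. 0"]) simp
next
  case (add f g)
  then obtain D E where DE: "\<And>x. (f has_derivative D x) (at x)" "\<And>h. (\<lambda>x. D x h) \<in> bump_algebra"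
    "\<And>x. (g has_derivative E x) (at x)" "\<And>h. (\<lambda>x. E x h) \<in> bump_algebra"
    by metis
  then show ?case
    by (intro exI[of _ "\<lambda>x h. D x h + E x h"]) (auto intro: has_derivative_add bump_algebra.add)
next
  case (mult f g)
  then obtain D E where DE: "\<And>x. (f has_derivative D x) (at x)" "\<And>h. (\<lambda>x. D x h) \<in> bump_algebra"
    "\<And>x. (g has_derivative E x) (at x)" "\<And>h. (\<lambda>x. E x h) \<in> bump_algebra"
    by metis
  with mult show ?case
    by (intro exI[of _ "\<lambda>x h. f x * E x h + D x h * g x"])
       (auto intro!: has_derivative_mult bump_algebra.add bump_algebra.mult)
qed

lemma bump_algebra_smooth:
  assumes "f \<in> bump_algebra" shows "smooth f"
proof (rule smooth_coinduct[OF assms])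
  fix f :: "real^'n \<Rightarrow> real" and x i
  assume "f \<in> bump_algebra"
  then obtain D where D: "\<And>x. (f has_derivative D x) (at x)" "\<And>h. (\<lambda>x. D x h) \<in> bump_algebra"
    using bump_algebra_derivative by blast
  then show "f differentiable at x"
    unfolding differentiable_def by blast
  have "partial_deriv i f = (\<lambda>x. D x (axis i 1))"
    using partial_deriv_eqI[OF D(1)] by blast
  with D(2) show "partial_deriv i f \<in> bump_algebra" by simp
qed

text \<open>
  A product of flat functions of the distances to the faces of the box; as \<open>c = 1 / (m + 1)\<close> tends
  to \<open>0\<close>, each factor increases to \<open>1\<close> inside the box.
\<close>

definition box_bump :: "real^'n::finite \<Rightarrow> real^'n \<Rightarrow> nat \<Rightarrow> real^'n \<Rightarrow> real"
  where "box_bump a b m x =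
    (\<Prod>i\<in>UNIV. flat (1 / Suc m) 0 (x $ i - a $ i) * flat (1 / Suc m) 0 (b $ i - x $ i))"

lemma flat_0_range: "c > 0 \<Longrightarrow> 0 \<le> flat c 0 t \<and> flat c 0 t \<le> 1"
  by (simp add: flat_def)

lemma flat_0_tendsto: "(\<lambda>m. flat (1 / Suc m) 0 t) \<longlonglongrightarrow> (if t > 0 then 1 else 0)"
proof (cases "t > 0")
  case True
  have "(\<lambda>m. exp (- (1 / real (Suc m)) * inverse t)) \<longlonglongrightarrow> exp (- 0 * inverse t)"
    by (intro tendsto_intros LIMSEQ_Suc lim_1_over_n)
  with True show ?thesis by (simp add: flat_def)
qed (simp add: flat_def)

lemma box_bump_range: "0 \<le> box_bump a b m x" "box_bump a b m x \<le> 1"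
  unfolding box_bump_def
  by (auto intro!: prod_nonneg prod_le_1 mult_le_one mult_nonneg_nonneg simp: flat_0_range)

lemma box_bump_nonzero: "box_bump a b m x \<noteq> 0 \<Longrightarrow> x \<in> box a b"
  by (auto simp: box_bump_def flat_def mem_box_cart split: if_splits)

lemma box_bump_tendsto: "(\<lambda>m. box_bump a b m x) \<longlonglongrightarrow> indicator (box a b) x"
proof -
  have "(\<lambda>m. box_bump a b m x) \<longlonglongrightarrow>
    (\<Prod>i\<in>UNIV. (if x $ i - a $ i > 0 then 1 else 0) * (if b $ i - x $ i > 0 then 1 else 0))"
    unfolding box_bump_def by (intro tendsto_prod tendsto_mult flat_0_tendsto)
  also have "(\<Prod>i\<in>UNIV. (if x $ i - a $ i > 0 then 1 else 0) * (if b $ i - x $ i > 0 then 1 else 0)) = (indicator (box a b) x :: real)"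
    by (auto simp: indicator_def mem_box_cart prod_zero_iff)
  finally show ?thesis .
qed

lemma test_function_box_bump: "test_function (box_bump a b m)"
proof -
  let ?f = "\<lambda>i x. flat (1 / Suc m) 0 (x $ i - a $ i) * flat (1 / Suc m) 0 (b $ i - x $ i)"
  have "(\<lambda>x. \<Prod>i\<in>I. ?f i x) \<in> bump_algebra" if "finite I" for I :: "'a set"
    using that
  proof induction
    case empty
    then show ?case using bump_algebra.const[of 1] by simp
  next
    case (insert i I)
    have "(\<lambda>x. ?f i x * (\<Prod>i\<in>I. ?f i x)) \<in> bump_algebra"
      by (intro bump_algebra.mult bump_algebra.left bump_algebra.right insert) simp_all
    with insert show ?case by simp
  qed
  from this[of UNIV] have "smooth (box_bump a b m)"
    unfolding box_bump_def by (simp add: bump_algebra_smooth)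
  moreover have "closure {x. box_bump a b m x \<noteq> 0} \<subseteq> cbox a b"
    using box_bump_nonzero box_subset_cbox by (intro closure_minimal) blast+
  then have "compact (closure {x. box_bump a b m x \<noteq> 0})"
    by (meson bounded_cbox bounded_subset closed_closure compact_eq_bounded_closed)
  ultimately show ?thesis by (simp add: test_function_def)
qed

section \<open>Symmetry of mixed partial derivatives\<close>

lemma smooth_has_real_derivative_along:
  assumes "smooth f"
  shows "((\<lambda>t. f (x + t *\<^sub>R axis i 1)) has_real_derivative partial_deriv i f (x + t *\<^sub>R axis i 1)) (at t)"
proof -
  let ?y = "x + t *\<^sub>R axis i 1"
  have f: "(f has_derivative frechet_derivative f (at ?y)) (at ?y)"
    using smooth_imp_differentiable[OF assms] frechet_derivative_works by blast
  have "((\<lambda>t. f (x + t *\<^sub>R axis i 1)) has_derivative (\<lambda>h. frechet_derivative f (at ?y) (h *\<^sub>R axis i 1))) (at t)"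
    by (rule has_derivative_compose[of "\<lambda>t. x + t *\<^sub>R axis i 1" "\<lambda>h. h *\<^sub>R axis i 1", OF _ f])
      (auto intro!: derivative_eq_intros)
  then show ?thesis
    unfolding has_field_derivative_def partial_deriv_def
    using linear_scale[OF has_derivative_linear[OF f]] by (simp add: mult.commute[of _ "frechet_derivative f (at ?y) (axis i 1)"])
qed

text \<open>
  The second difference is the increment in direction \<open>i\<close> of the increment in direction \<open>j\<close>, so the
  mean value theorem applies twice. The left-hand side is symmetric in \<open>i\<close> and \<open>j\<close>, the right-hand side
  is not; this is what forces mixed derivatives to agree.
\<close>

lemma second_difference_mean_value:
  assumes f: "smooth f" and s: "s > 0"
  shows "\<exists>a b. 0 \<le> a \<and> a \<le> s \<and> 0 \<le> b \<and> b \<le> s \<and>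
    f (x + s *\<^sub>R axis i 1 + s *\<^sub>R axis j 1) - f (x + s *\<^sub>R axis i 1) - f (x + s *\<^sub>R axis j 1) + f x
      = s * (s * partial_deriv j (partial_deriv i f) (x + a *\<^sub>R axis i 1 + b *\<^sub>R axis j 1))"
proof -
  let ?G = "\<lambda>t. f ((x + s *\<^sub>R axis j 1) + t *\<^sub>R axis i 1) - f (x + t *\<^sub>R axis i 1)"
  obtain a where a: "0 < a" "a < s"
    "?G s - ?G 0 = (s - 0) * (partial_deriv i f ((x + s *\<^sub>R axis j 1) + a *\<^sub>R axis i 1) - partial_deriv i f (x + a *\<^sub>R axis i 1))"
    using MVT2[OF s, of ?G "\<lambda>a. partial_deriv i f ((x + s *\<^sub>R axis j 1) + a *\<^sub>R axis i 1) - partial_deriv i f (x + a *\<^sub>R axis i 1)"]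
      smooth_has_real_derivative_along[OF f] DERIV_diff by blast
  let ?H = "\<lambda>t. partial_deriv i f ((x + a *\<^sub>R axis i 1) + t *\<^sub>R axis j 1)"
  obtain b where b: "0 < b" "b < s"
    "?H s - ?H 0 = (s - 0) * partial_deriv j (partial_deriv i f) ((x + a *\<^sub>R axis i 1) + b *\<^sub>R axis j 1)"
    using MVT2[OF s, of ?H "\<lambda>b. partial_deriv j (partial_deriv i f) ((x + a *\<^sub>R axis i 1) + b *\<^sub>R axis j 1)"]
      smooth_has_real_derivative_along[OF smooth_partial_deriv[OF f]] by blast
  from a b show ?thesis
    by (intro exI[of _ a] exI[of _ b]) (simp add: algebra_simps)
qed

text \<open>
  Divide the two mean value representations of the same second difference by the squared step
  and let the step tend to \<open>0\<close>; the second derivatives are continuous, being differentiable.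
\<close>

lemma partial_deriv_commute:
  assumes f: "smooth f"
  shows "partial_deriv i (partial_deriv j f) = partial_deriv j (partial_deriv i f)"
proof
  fix x
  define s where "s n = 1 / real (Suc n)" for n
  have s: "s n > 0" for n by (simp add: s_def)
  have s0: "s \<longlonglongrightarrow> 0"
    unfolding s_def by (rule LIMSEQ_Suc[OF lim_1_over_n])
  have lim: "(\<lambda>n. partial_deriv k (partial_deriv l f) (x + a n *\<^sub>R axis l 1 + b n *\<^sub>R axis k 1))
       \<longlonglongrightarrow> partial_deriv k (partial_deriv l f) x"
    if ab: "\<And>n. 0 \<le> a n \<and> a n \<le> s n \<and> 0 \<le> b n \<and> b n \<le> s n" for a b k l
  proof -
    have "a \<longlonglongrightarrow> 0" "b \<longlonglongrightarrow> 0"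
      by (rule tendsto_sandwich[OF _ _ tendsto_const s0]; use ab in simp)+
    then have "(\<lambda>n. x + a n *\<^sub>R axis l 1 + b n *\<^sub>R axis k 1) \<longlonglongrightarrow> x + 0 *\<^sub>R axis l 1 + 0 *\<^sub>R axis k 1"
      by (intro tendsto_intros)
    moreover have "isCont (partial_deriv k (partial_deriv l f)) x"
      using f by (intro differentiable_imp_continuous_within smooth_imp_differentiable smooth_partial_deriv)
    ultimately show ?thesis
      using isCont_tendsto_compose by fastforce
  qed
  have "\<exists>a b. \<forall>n. (0 \<le> a n \<and> a n \<le> s n \<and> 0 \<le> b n \<and> b n \<le> s n) \<and>
    f (x + s n *\<^sub>R axis k 1 + s n *\<^sub>R axis l 1) - f (x + s n *\<^sub>R axis k 1) - f (x + s n *\<^sub>R axis l 1) + f x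
      = s n * (s n * partial_deriv l (partial_deriv k f) (x + a n *\<^sub>R axis k 1 + b n *\<^sub>R axis l 1))" for k l
    using second_difference_mean_value[OF f s, where x=x and i=k and j=l] by metis
  note * = this
  obtain a b where ab: "\<And>n. 0 \<le> a n \<and> a n \<le> s n \<and> 0 \<le> b n \<and> b n \<le> s n"
    "\<And>n. f (x + s n *\<^sub>R axis i 1 + s n *\<^sub>R axis j 1) - f (x + s n *\<^sub>R axis i 1) - f (x + s n *\<^sub>R axis j 1) + f x
      = s n * (s n * partial_deriv j (partial_deriv i f) (x + a n *\<^sub>R axis i 1 + b n *\<^sub>R axis j 1))"
    using *[of i j] by blast
  obtain c d where cd: "\<And>n. 0 \<le> c n \<and> c n \<le> s n \<and> 0 \<le> d n \<and> d n \<le> s n"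
    "\<And>n. f (x + s n *\<^sub>R axis j 1 + s n *\<^sub>R axis i 1) - f (x + s n *\<^sub>R axis j 1) - f (x + s n *\<^sub>R axis i 1) + f x
      = s n * (s n * partial_deriv i (partial_deriv j f) (x + c n *\<^sub>R axis j 1 + d n *\<^sub>R axis i 1))"
    using *[of j i] by blast
  have "partial_deriv j (partial_deriv i f) (x + a n *\<^sub>R axis i 1 + b n *\<^sub>R axis j 1) =
        partial_deriv i (partial_deriv j f) (x + c n *\<^sub>R axis j 1 + d n *\<^sub>R axis i 1)" for n
  proof -
    \<comment> \<open>both second differences are the same number\<close>
    have eq: "x + s n *\<^sub>R axis j 1 + s n *\<^sub>R axis i 1 = x + s n *\<^sub>R axis i 1 + s n *\<^sub>R axis j 1"
      by simp
    have "s n * (s n * partial_deriv j (partial_deriv i f) (x + a n *\<^sub>R axis i 1 + b n *\<^sub>R axis j 1)) =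
        s n * (s n * partial_deriv i (partial_deriv j f) (x + c n *\<^sub>R axis j 1 + d n *\<^sub>R axis i 1))"
      unfolding ab(2)[of n, symmetric] cd(2)[of n, symmetric] eq by simp
    then show ?thesis using s[of n] by simp
  qed
  with lim[OF ab(1), of j i] lim[OF cd(1), of i j]
  show "partial_deriv i (partial_deriv j f) x = partial_deriv j (partial_deriv i f) x"
    using LIMSEQ_unique by force
qed

lemma iter_partial_partial_deriv_commute:
  assumes "smooth f"
  shows "iter_partial is (partial_deriv i f) = partial_deriv i (iter_partial is f)"
  by (induction "is") (use assms in \<open>simp_all add: partial_deriv_commute smooth_iter_partial\<close>)

lemma iter_partial_permute:
  assumes "smooth f" "\<And>i. count_list is i = count_list js i"
  shows "iter_partial is f = iter_partial js f"
  using assms(2)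
proof (induction "is" arbitrary: js)
  case Nil
  have "js = []"
  proof (cases js)
    case (Cons j js')
    then show ?thesis using Nil[of j] by simp
  qed simp
  then show ?case by simp
next
  case (Cons i "is")
  have "i \<in> set js"
    using Cons.prems[of i] count_notin[of i js] by fastforce
  then obtain ys zs where js: "js = ys @ i # zs" by (meson split_list)
  have "count_list is k = count_list (ys @ zs) k" for k
    using Cons.prems[of k] by (auto simp: js split: if_splits)
  then have "iter_partial is f = iter_partial (ys @ zs) f"
    by (rule Cons.IH)
  then show ?case
    using assms(1) by (simp add: js iter_partial_append iter_partial_partial_deriv_commute smooth_iter_partial)
qed

lemma ex_list_with_counts: "\<exists>is. \<forall>i. count_list is i = (\<alpha> (i :: 'n::finite) :: nat)"
proof -
  obtain "is" where "mset is = Abs_multiset \<alpha>"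
    using ex_mset by blast
  then have "count (mset is) = \<alpha>"
    by (simp add: Abs_multiset_inverse)
  then show ?thesis
    by (metis count_mset)
qed

text \<open>
  By symmetry the value does not depend on the list that the choice operator picks.
\<close>

lemma classical_deriv_eq:
  assumes "smooth f" "\<And>i. count_list is i = \<alpha> i"
  shows "classical_deriv \<alpha> f = iter_partial is f"
  unfolding classical_deriv_def
proof (rule someI2_ex[OF ex_list_with_counts[of \<alpha>]])
  fix js assume "\<forall>i. count_list js i = \<alpha> i"
  then show "iter_partial js f = iter_partial is f"
    using assms by (intro iter_partial_permute) auto
qed

lemma classical_deriv_mi_unit:
  assumes "smooth f"
  shows "classical_deriv (mi_unit i) f = partial_deriv i f"
  using classical_deriv_eq[OF assms, of "[i]" "mi_unit i"] by (auto simp: mi_unit_def)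

text \<open>
  This is where the symmetry of derivatives enters the theorem: a derivative of order \<open>\<alpha>\<close> of a
  partial derivative is a classical derivative of order \<open>\<alpha> + e\<^sub>i\<close>, whatever order of differentiation
  either side has picked.
\<close>

lemma classical_deriv_partial_deriv:
  assumes "smooth f"
  shows "classical_deriv \<alpha> (partial_deriv i f) = classical_deriv (\<lambda>k. \<alpha> k + mi_unit i k) f"
proof -
  obtain "is" where "is": "\<And>i. count_list is i = \<alpha> i"
    using ex_list_with_counts by metis
  have "classical_deriv \<alpha> (partial_deriv i f) = iter_partial is (partial_deriv i f)"
    by (intro classical_deriv_eq smooth_partial_deriv assms "is")
  also have "\<dots> = iter_partial (is @ [i]) f"
    by (simp add: iter_partial_append)
  also have "\<dots> = classical_deriv (\<lambda>k. \<alpha> k + mi_unit i k) f"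
    by (intro classical_deriv_eq[symmetric] assms) (auto simp: "is" mi_unit_def)
  finally show ?thesis .
qed

lemma mi_order_add_unit: "mi_order (\<lambda>k. \<alpha> k + mi_unit i k) = mi_order \<alpha> + 1"
  by (simp add: mi_order_def mi_unit_def sum.distrib)

lemma mi_order_unit: "mi_order (mi_unit i) = 1"
  by (simp add: mi_order_def mi_unit_def)

section \<open>The fundamental lemma of the calculus of variations\<close>

text \<open>
  The positive and the negative part of the function are densities of two measures that agree
  on all boxes. Boxes generate the Borel sets and are closed under intersection, so the measures, and
  therefore the densities, agree.
\<close>

lemma AE_zero_if_box_integrals_zero:
  fixes w :: "'a::euclidean_space \<Rightarrow> real"
  assumes [measurable]: "w \<in> borel_measurable borel"
    and int: "\<And>a b. integrable lborel (\<lambda>x. indicator (box a b) x * w x)"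
    and zero: "\<And>a b. (LINT x|lborel. indicator (box a b) x * w x) = 0"
  shows "AE x in lborel. w x = 0"
proof -
  have pos: "emeasure (density lborel (\<lambda>x. ennreal (max 0 (s * w x)))) (box a b)
      = ennreal (LINT x|lborel. indicator (box a b) x * max 0 (s * w x))" 
    and posint: "integrable lborel (\<lambda>x. indicator (box a b) x * max 0 (s * w x))" for a b s
  proof -
    have "integrable lborel (\<lambda>x. max 0 (s * (indicator (box a b) x * w x)))"
      by (intro integrable_max integrable_mult_right int) simp
    moreover have eq: "(\<lambda>x. max 0 (s * (indicator (box a b) x * w x))) = (\<lambda>x. indicator (box a b) x * max 0 (s * w x))"
      by (auto simp: fun_eq_iff indicator_def)
    ultimately show *: "integrable lborel (\<lambda>x. indicator (box a b) x * max 0 (s * w x))" by simp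
    have "emeasure (density lborel (\<lambda>x. ennreal (max 0 (s * w x)))) (box a b)
       = (\<integral>\<^sup>+x. ennreal (max 0 (s * w x)) * indicator (box a b) x \<partial>lborel)"
      by (subst emeasure_density) auto
    also have "\<dots> = (\<integral>\<^sup>+x. ennreal (indicator (box a b) x * max 0 (s * w x)) \<partial>lborel)"
      by (intro nn_integral_cong) (auto simp: indicator_def)
    also have "\<dots> = ennreal (LINT x|lborel. indicator (box a b) x * max 0 (s * w x))"
      using * by (intro nn_integral_eq_integral) auto
    finally show "emeasure (density lborel (\<lambda>x. ennreal (max 0 (s * w x)))) (box a b)
      = ennreal (LINT x|lborel. indicator (box a b) x * max 0 (s * w x))" .
  qed
  have "density lborel (\<lambda>x. ennreal (max 0 (1 * w x))) = density lborel (\<lambda>x. ennreal (max 0 ((-1) * w x)))"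
  proof (rule measure_eqI_generator_eq)
    show "Int_stable (range (\<lambda>(a, b). box a b :: 'a set))"
      by (auto simp: Int_stable_def box_Int_box)
    \<comment> \<open>an exhaustion by generators of finite measure\<close>
    let ?A = "\<lambda>n::nat. box (- (real n *\<^sub>R One)) (real n *\<^sub>R One) :: 'a set"
    show "range ?A \<subseteq> range (\<lambda>(a, b). box a b :: 'a set)" by auto
    show "(\<Union>n. ?A n) = UNIV"
      using UN_box_eq_UNIV by simp
    show "emeasure (density lborel (\<lambda>x. ennreal (max 0 (1 * w x)))) (?A i) \<noteq> \<infinity>" for i
      by (simp only: pos) simp
    fix X assume "X \<in> range (\<lambda>(a, b). box a b :: 'a set)"
    then obtain a b where X: "X = box a b" by auto
    have "(LINT x|lborel. indicator (box a b) x * max 0 (1 * w x)) - (LINT x|lborel. indicator (box a b) x * max 0 ((-1) * w x))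
      = (LINT x|lborel. indicator (box a b) x * w x)"
      by (subst Bochner_Integration.integral_diff[symmetric, OF posint posint])
         (auto intro!: Bochner_Integration.integral_cong simp: indicator_def)
    then show "emeasure (density lborel (\<lambda>x. ennreal (max 0 (1 * w x)))) X = emeasure (density lborel (\<lambda>x. ennreal (max 0 ((-1) * w x)))) X"
      unfolding X pos using zero[of a b] by simp
  qed (auto simp: borel_eq_box)
  then have "AE x in lborel. ennreal (max 0 (1 * w x)) = ennreal (max 0 ((-1) * w x))"
    by (intro sigma_finite_measure.density_unique[OF sigma_finite_lborel]) auto
  then show ?thesis
    by eventually_elim (auto simp: max_def split: if_splits)
qed

text \<open>
  Bump functions converge boundedly to the indicator of a box, so by dominated convergence the
  integral over every box vanishes.
\<close>

lemma fundamental_lemma: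
  fixes w :: "real^'n::finite \<Rightarrow> real"
  assumes w [measurable]: "w \<in> borel_measurable borel"
    and int: "\<And>a b. integrable lborel (\<lambda>x. indicator (cbox a b) x * w x)"
    and zero: "\<And>\<phi>. test_function \<phi> \<Longrightarrow> (LINT x|lborel. w x * \<phi> x) = 0"
  shows "AE x in lborel. w x = 0"
proof (rule AE_zero_if_box_integrals_zero[OF w])
  fix a b :: "real^'n"
  show "integrable lborel (\<lambda>x. indicator (box a b) x * w x)"
    by (rule Bochner_Integration.integrable_bound[OF int[of a b]])
       (use box_subset_cbox[of a b] in \<open>auto simp: indicator_def\<close>)
  have [measurable]: "box_bump a b m \<in> borel_measurable borel" for m
    by (intro test_function_measurable test_function_box_bump)
  have "(\<lambda>m. LINT x|lborel. w x * box_bump a b m x) \<longlonglongrightarrow> (LINT x|lborel. w x * indicator (box a b) x)"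
  proof (rule integral_dominated_convergence)
    show "integrable lborel (\<lambda>x. \<bar>indicator (cbox a b) x * w x\<bar>)"
      using int by (rule integrable_abs)
    show "AE x in lborel. norm (w x * box_bump a b m x) \<le> \<bar>indicator (cbox a b) x * w x\<bar>" for m
    proof (rule AE_I2)
      fix x
      show "norm (w x * box_bump a b m x) \<le> \<bar>indicator (cbox a b) x * w x\<bar>"
        using box_bump_nonzero[of a b m x] box_subset_cbox[of a b] box_bump_range[of a b m x]
        by (cases "box_bump a b m x = 0") (auto simp: abs_mult indicator_def subset_iff intro: mult_left_le)
    qed
    show "AE x in lborel. (\<lambda>m. w x * box_bump a b m x) \<longlonglongrightarrow> w x * indicator (box a b) x"
      by (intro AE_I2 tendsto_mult tendsto_const box_bump_tendsto)
  qed auto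
  then have "(LINT x|lborel. w x * indicator (box a b) x) = 0"
    by (simp add: zero[OF test_function_box_bump] LIMSEQ_const_iff)
  then show "(LINT x|lborel. indicator (box a b) x * w x) = 0"
    by (simp add: mult.commute)
qed

section \<open>Continuity of translation in $L^p$\<close>

lemma nn_integral_lborel_shift:
  fixes f :: "'a::euclidean_space \<Rightarrow> ennreal"
  assumes [measurable]: "f \<in> borel_measurable borel"
  shows "(\<integral>\<^sup>+x. f (x + c) \<partial>lborel) = (\<integral>\<^sup>+x. f x \<partial>lborel)"
proof -
  have "(\<integral>\<^sup>+x. f x \<partial>lborel) = (\<integral>\<^sup>+x. f x \<partial>distr lborel borel ((+) c))"
    by (simp add: lborel_distr_plus)
  also have "\<dots> = (\<integral>\<^sup>+x. f (x + c) \<partial>lborel)"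
    by (subst nn_integral_distr) (simp_all add: add.commute)
  finally show ?thesis by simp
qed

lemma integrable_lborel_shift_iff:
  fixes f :: "'a::euclidean_space \<Rightarrow> 'b::{banach, second_countable_topology}"
  assumes [measurable]: "f \<in> borel_measurable borel"
  shows "integrable lborel (\<lambda>x. f (x + c)) \<longleftrightarrow> integrable lborel f"
proof -
  have "integrable lborel f \<longleftrightarrow> integrable (distr lborel borel ((+) c)) f"
    by (simp add: lborel_distr_plus)
  also have "\<dots> \<longleftrightarrow> integrable lborel (\<lambda>x. f (x + c))"
    by (subst integrable_distr_eq) (simp_all add: add.commute)
  finally show ?thesis by simp
qed

lemma integral_lborel_shift:
  fixes f :: "'a::euclidean_space \<Rightarrow> 'b::{banach, second_countable_topology}"
  assumes [measurable]: "f \<in> borel_measurable borel"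
  shows "(LINT x|lborel. f (x + c)) = (LINT x|lborel. f x)"
proof -
  have "(LINT x|lborel. f x) = (LINT x|distr lborel borel ((+) c). f x)"
    by (simp add: lborel_distr_plus)
  also have "\<dots> = (LINT x|lborel. f (x + c))"
    by (subst integral_distr) (simp_all add: add.commute)
  finally show ?thesis by simp
qed

lemma tendsto_0_ennrealI:
  fixes f :: "'a \<Rightarrow> ennreal"
  assumes "\<And>e::real. e > 0 \<Longrightarrow> eventually (\<lambda>x. f x \<le> ennreal e) F"
  shows "(f \<longlongrightarrow> 0) F"
proof (rule order_tendstoI)
  fix a :: ennreal assume "0 < a"
  then obtain b where b: "0 < b" "b < a" using dense by blast
  then obtain e where e: "b = ennreal e" "e > 0"
    by (cases b) auto
  show "eventually (\<lambda>x. f x < a) F"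
    using assms[OF e(2)] by eventually_elim (use b e in auto)
qed simp

lemma tendsto_0_ennrealD:
  fixes f :: "'a \<Rightarrow> ennreal"
  assumes "(f \<longlongrightarrow> 0) F" "e > (0::real)"
  shows "eventually (\<lambda>x. f x \<le> ennreal e) F"
  using order_tendstoD(2)[OF assms(1), of "ennreal e"] assms(2)
  by (auto elim: eventually_mono)

lemma tendsto_0_ennreal_mono:
  fixes f g :: "'a \<Rightarrow> ennreal"
  assumes "(g \<longlongrightarrow> 0) F" "\<And>x. f x \<le> g x"
  shows "(f \<longlongrightarrow> 0) F"
  by (rule tendsto_sandwich[OF _ _ tendsto_const assms(1)]) (simp_all add: assms(2))

lemma powr_sum3_le:
  fixes a b c :: real
  assumes "a \<ge> 0" "b \<ge> 0" "c \<ge> 0" "p \<ge> 0" "d \<le> a + b + c" "d \<ge> 0"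
  shows "d powr p \<le> 3 powr p * (a powr p + b powr p + c powr p)"
proof -
  define m where "m = max a (max b c)"
  have "d powr p \<le> (3 * m) powr p"
    using assms by (intro powr_mono2) (auto simp: m_def)
  also have "\<dots> = 3 powr p * m powr p"
    using assms by (intro powr_mult)
  also have "m powr p \<le> a powr p + b powr p + c powr p"
    by (auto simp: m_def max_def)
  finally show ?thesis by simp
qed

lemma Lp_triangle3:
  fixes f :: "'a \<Rightarrow> 'b::{real_normed_vector, second_countable_topology}"
  assumes [measurable]: "f \<in> borel_measurable M" "g \<in> borel_measurable M" "h \<in> borel_measurable M" "d \<in> borel_measurable M"
    and "p \<ge> 0" and d: "\<And>x. d x = f x + g x + h x"
  shows "(\<integral>\<^sup>+x. ennreal (norm (d x) powr p) \<partial>M)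
    \<le> ennreal (3 powr p) * ((\<integral>\<^sup>+x. ennreal (norm (f x) powr p) \<partial>M) +
       (\<integral>\<^sup>+x. ennreal (norm (g x) powr p) \<partial>M) + (\<integral>\<^sup>+x. ennreal (norm (h x) powr p) \<partial>M))"
proof -
  have "norm (d x) powr p \<le> 3 powr p * (norm (f x) powr p + norm (g x) powr p + norm (h x) powr p)" for x
    unfolding d using \<open>p \<ge> 0\<close>
    by (intro powr_sum3_le order_trans[OF norm_triangle_ineq add_right_mono[OF norm_triangle_ineq]]) auto
  then have "(\<integral>\<^sup>+x. ennreal (norm (d x) powr p) \<partial>M)
    \<le> (\<integral>\<^sup>+x. ennreal (3 powr p) * (ennreal (norm (f x) powr p) + ennreal (norm (g x) powr p) + ennreal (norm (h x) powr p)) \<partial>M)"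
    by (intro nn_integral_mono) (simp add: ennreal_plus[symmetric] ennreal_mult[symmetric] del: ennreal_plus)
  also have "\<dots> = ennreal (3 powr p) * ((\<integral>\<^sup>+x. ennreal (norm (f x) powr p) \<partial>M) +
       (\<integral>\<^sup>+x. ennreal (norm (g x) powr p) \<partial>M) + (\<integral>\<^sup>+x. ennreal (norm (h x) powr p) \<partial>M))"
    by (simp add: nn_integral_cmult nn_integral_add)
  finally show ?thesis .
qed

text \<open>
  Sequences rather than a limit in the shift, because the dominated convergence theorem is
  sequential.
\<close>

definition translation_continuous :: "real \<Rightarrow> ('a::euclidean_space \<Rightarrow> 'b::real_normed_vector) \<Rightarrow> bool"
  where "translation_continuous p f \<longleftrightarrow> (\<forall>k. k \<longlonglongrightarrow> 0 \<longrightarrow>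
    (\<lambda>n. \<integral>\<^sup>+x. ennreal (norm (f (x + k n) - f x) powr p) \<partial>lborel) \<longlonglongrightarrow> 0)"

text \<open>
  The triangle inequality for \<open>f(\<cdot> + k) - g(\<cdot> + k)\<close>, \<open>g(\<cdot> + k) - g\<close> and \<open>g - f\<close>; the outer two
  have the same norm because Lebesgue measure is translation invariant.
\<close>

lemma translation_continuous_approx:
  fixes f :: "'a::euclidean_space \<Rightarrow> 'b::{real_normed_vector, second_countable_topology}"
  assumes [measurable]: "f \<in> borel_measurable borel" and p: "p \<ge> 0"
    and approx: "\<And>e::real. e > 0 \<Longrightarrow> \<exists>g\<in>borel_measurable borel. translation_continuous p g \<and>
      (\<integral>\<^sup>+x. ennreal (norm (f x - g x) powr p) \<partial>lborel) \<le> ennreal e"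
  shows "translation_continuous p f"
  unfolding translation_continuous_def
proof (intro allI impI tendsto_0_ennrealI)
  fix k :: "nat \<Rightarrow> 'a" and e :: real
  assume k: "k \<longlonglongrightarrow> 0" and e: "e > 0"
  \<comment> \<open>three terms, and the factor \<open>3 powr p\<close> of the triangle inequality for \<open>p\<close>-th powers\<close>
  define e' where "e' = e / (3 * 3 powr p)"
  have e': "e' > 0" using e by (simp add: e'_def)
  obtain g where g[measurable]: "g \<in> borel_measurable borel" and tc: "translation_continuous p g"
    and fg: "(\<integral>\<^sup>+x. ennreal (norm (f x - g x) powr p) \<partial>lborel) \<le> ennreal e'"
    using approx[OF e'] by blast
  have "\<forall>\<^sub>F n in sequentially. (\<integral>\<^sup>+x. ennreal (norm (g (x + k n) - g x) powr p) \<partial>lborel) \<le> ennreal e'"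
    using tc k e' unfolding translation_continuous_def by (intro tendsto_0_ennrealD) auto
  then show "\<forall>\<^sub>F n in sequentially. (\<integral>\<^sup>+x. ennreal (norm (f (x + k n) - f x) powr p) \<partial>lborel) \<le> ennreal e"
  proof eventually_elim
    case (elim n)
    have "(\<integral>\<^sup>+x. ennreal (norm (f (x + k n) - f x) powr p) \<partial>lborel)
      \<le> ennreal (3 powr p) * ((\<integral>\<^sup>+x. ennreal (norm (f (x + k n) - g (x + k n)) powr p) \<partial>lborel)
        + (\<integral>\<^sup>+x. ennreal (norm (g (x + k n) - g x) powr p) \<partial>lborel)
        + (\<integral>\<^sup>+x. ennreal (norm (g x - f x) powr p) \<partial>lborel))"
      using p by (intro Lp_triangle3) auto
    also have "(\<integral>\<^sup>+x. ennreal (norm (f (x + k n) - g (x + k n)) powr p) \<partial>lborel) = (\<integral>\<^sup>+x. ennreal (norm (f x - g x) powr p) \<partial>lborel)"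
      by (rule nn_integral_lborel_shift[of "\<lambda>x. ennreal (norm (f x - g x) powr p)"]) simp
    also have "(\<integral>\<^sup>+x. ennreal (norm (g x - f x) powr p) \<partial>lborel) = (\<integral>\<^sup>+x. ennreal (norm (f x - g x) powr p) \<partial>lborel)"
      by (simp add: norm_minus_commute)
    also have "ennreal (3 powr p) * ((\<integral>\<^sup>+x. ennreal (norm (f x - g x) powr p) \<partial>lborel)
        + (\<integral>\<^sup>+x. ennreal (norm (g (x + k n) - g x) powr p) \<partial>lborel)
        + (\<integral>\<^sup>+x. ennreal (norm (f x - g x) powr p) \<partial>lborel)) \<le> ennreal (3 powr p) * (ennreal e' + ennreal e' + ennreal e')"
      by (intro mult_left_mono add_mono fg elim) simp
    also have "\<dots> = ennreal e"
      using e' by (simp add: ennreal_plus[symmetric] ennreal_mult[symmetric] del: ennreal_plus) (simp add: e'_def)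
    finally show ?case .
  qed
qed

text \<open>
  A point of an open set stays in it under small shifts, so the part of \<open>U\<close> that a shift by \<open>k\<close>
  moves outside has measure tending to \<open>0\<close>; the part that enters \<open>U\<close> is the same for the shift by \<open>- k\<close>.
\<close>

lemma open_translation_L1:
  fixes U :: "'a::euclidean_space set"
  assumes U: "open U" "emeasure lborel U < \<infinity>" and k: "k \<longlonglongrightarrow> 0"
  shows "(\<lambda>n. \<integral>\<^sup>+x. ennreal \<bar>indicator U (x + k n) - indicator U x\<bar> \<partial>lborel) \<longlonglongrightarrow> 0"
proof -
  have [measurable]: "U \<in> sets borel" using U by auto
  define L where "L c = (\<integral>\<^sup>+x. ennreal (indicator U x * (1 - indicator U (x + c))) \<partial>lborel)" for c
  have lim: "(\<lambda>n. L (c n)) \<longlonglongrightarrow> 0" if c: "c \<longlonglongrightarrow> 0" for c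
  proof -
    have "(\<lambda>n. L (c n)) \<longlonglongrightarrow> (\<integral>\<^sup>+(x::'a). 0 \<partial>lborel)"
      unfolding L_def
    proof (rule nn_integral_dominated_convergence)
      show "(\<integral>\<^sup>+x. indicator U x \<partial>lborel) < \<infinity>" using U by simp
      show "AE x in lborel. (\<lambda>n. ennreal (indicator U x * (1 - indicator U (x + c n)))) \<longlonglongrightarrow> 0"
      proof (rule AE_I2)
        fix x
        show "(\<lambda>n. ennreal (indicator U x * (1 - indicator U (x + c n)))) \<longlonglongrightarrow> 0"
        proof (cases "x \<in> U")
          case True
          have "(\<lambda>n. x + c n) \<longlonglongrightarrow> x + 0" using c by (intro tendsto_intros)
          then have "\<forall>\<^sub>F n in sequentially. x + c n \<in> U"
            using U True by (intro topological_tendstoD[of _ x]) auto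
          then have "\<forall>\<^sub>F n in sequentially. ennreal (indicator U x * (1 - indicator U (x + c n))) = 0"
            by eventually_elim simp
          then show ?thesis by (rule tendsto_eventually)
        qed simp
      qed
    qed (auto simp: indicator_def)
    then show ?thesis by simp
  qed
  have "(\<integral>\<^sup>+x. ennreal \<bar>indicator U (x + c) - indicator U x\<bar> \<partial>lborel) = L c + L (- c)" for c
  proof -
    have "L (- c) = (\<integral>\<^sup>+x. ennreal (indicator U (x + c) * (1 - indicator U (x + c - c))) \<partial>lborel)"
      unfolding L_def
      using nn_integral_lborel_shift[of "\<lambda>x. ennreal (indicator U x * (1 - indicator U (x - c)))" c] by simp
    then have "L c + L (- c) = (\<integral>\<^sup>+x. ennreal (indicator U x * (1 - indicator U (x + c)))
         + ennreal (indicator U (x + c) * (1 - indicator U x)) \<partial>lborel)"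
      unfolding L_def by (subst nn_integral_add) auto
    also have "\<dots> = (\<integral>\<^sup>+x. ennreal \<bar>indicator U (x + c) - indicator U x\<bar> \<partial>lborel)"
      by (intro nn_integral_cong) (auto simp: indicator_def)
    finally show ?thesis by simp
  qed
  moreover have "(\<lambda>n. L (k n) + L (- k n)) \<longlonglongrightarrow> 0 + 0"
    using k tendsto_minus[OF k] by (intro tendsto_add lim) simp_all
  ultimately show ?thesis by simp
qed

text \<open>
  By outer regularity a measurable set is close in measure to an open set.
\<close>

lemma translation_continuous_indicator:
  fixes A :: "'a::euclidean_space set" and c :: "'b::{real_normed_vector, second_countable_topology}"
  assumes A: "A \<in> sets borel" "emeasure lborel A < \<infinity>"
  shows "translation_continuous 1 (\<lambda>x. indicator A x *\<^sub>R c)"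
proof (rule translation_continuous_approx)
  fix e :: real assume e: "e > 0"
  \<comment> \<open>\<open>1 + norm c\<close> instead of \<open>norm c\<close> allows for \<open>c = 0\<close>\<close>
  define e' where "e' = e / (1 + norm c)"
  have e': "e' > 0" using e by (simp add: e'_def add_pos_nonneg)
  obtain U where U: "open U" "A \<subseteq> U" and UA: "emeasure lborel (U - A) < e'"
    using outer_regular_lborel[OF A(1) e'] .
  have [measurable]: "U \<in> sets borel" "A \<in> sets borel" using U A by auto
  have "emeasure lborel (A \<union> (U - A)) \<le> emeasure lborel A + emeasure lborel (U - A)"
    by (intro emeasure_subadditive) auto
  moreover have "A \<union> (U - A) = U" using U by auto
  moreover have "emeasure lborel A + emeasure lborel (U - A) < \<infinity>"
    using A UA by (auto simp: less_top[symmetric] top_unique)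
  ultimately have finU: "emeasure lborel U < \<infinity>" by (metis order_le_less_trans)
  let ?g = "\<lambda>x. indicator U x *\<^sub>R c"
  have "translation_continuous 1 ?g"
    unfolding translation_continuous_def
  proof (intro allI impI)
    fix k :: "nat \<Rightarrow> 'a" assume k: "k \<longlonglongrightarrow> 0"
    have "(\<integral>\<^sup>+x. ennreal (norm (?g (x + k n) - ?g x) powr 1) \<partial>lborel)
       = ennreal (norm c) * (\<integral>\<^sup>+x. ennreal \<bar>indicator U (x + k n) - indicator U x\<bar> \<partial>lborel)" for n
    proof -
      have "(\<integral>\<^sup>+x. ennreal (norm (?g (x + k n) - ?g x) powr 1) \<partial>lborel)
        = (\<integral>\<^sup>+x. ennreal (norm c) * ennreal \<bar>indicator U (x + k n) - indicator U x\<bar> \<partial>lborel)"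
        by (intro nn_integral_cong) (auto simp: indicator_def)
      then show ?thesis by (simp add: nn_integral_cmult)
    qed
    moreover have "(\<lambda>n. ennreal (norm c) * (\<integral>\<^sup>+x. ennreal \<bar>indicator U (x + k n) - indicator U x\<bar> \<partial>lborel)) \<longlonglongrightarrow> ennreal (norm c) * 0"
      by (intro ennreal_tendsto_cmult open_translation_L1 U finU k) simp
    ultimately show "(\<lambda>n. \<integral>\<^sup>+x. ennreal (norm (?g (x + k n) - ?g x) powr 1) \<partial>lborel) \<longlonglongrightarrow> 0"
      by simp
  qed
  moreover have "(\<integral>\<^sup>+x. ennreal (norm (indicator A x *\<^sub>R c - ?g x) powr 1) \<partial>lborel) \<le> ennreal e"
  proof -
    have "(\<integral>\<^sup>+x. ennreal (norm (indicator A x *\<^sub>R c - ?g x) powr 1) \<partial>lborel)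
      = (\<integral>\<^sup>+x. ennreal (norm c) * indicator (U - A) x \<partial>lborel)"
      using U by (intro nn_integral_cong) (auto simp: indicator_def)
    also have "\<dots> = ennreal (norm c) * emeasure lborel (U - A)"
      by (simp add: nn_integral_cmult)
    also have "\<dots> \<le> ennreal (norm c) * ennreal e'"
      using UA by (intro mult_left_mono) auto
    also have "\<dots> \<le> ennreal e"
    proof -
      have "1 + norm c > 0" by (simp add: add_pos_nonneg)
      then have "e' * (1 + norm c) = e" by (simp add: e'_def)
      then have "norm c * e' \<le> e" using e' by (simp add: algebra_simps)
      then show ?thesis by (simp add: ennreal_mult'[symmetric] ennreal_leI)
    qed
    finally show ?thesis .
  qed
  ultimately show "\<exists>g\<in>borel_measurable borel. translation_continuous 1 g \<and>
      (\<integral>\<^sup>+x. ennreal (norm (indicator A x *\<^sub>R c - g x) powr 1) \<partial>lborel) \<le> ennreal e"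
    by (intro bexI[of _ ?g]) auto
qed (use A in auto)

lemma translation_continuous_L1:
  fixes f :: "'a::euclidean_space \<Rightarrow> 'b::{banach, second_countable_topology}"
  assumes "integrable lborel f"
  shows "translation_continuous 1 f"
  using assms
proof (induction rule: integrable_induct)
  case (base A c)
  then show ?case by (intro translation_continuous_indicator) auto
next
  case (add f g)
  have [measurable]: "f \<in> borel_measurable borel" "g \<in> borel_measurable borel"
    using add borel_measurable_integrable by (force simp: measurable_lborel1)+
  show ?case unfolding translation_continuous_def
  proof (intro allI impI)
    fix k :: "nat \<Rightarrow> 'a" assume k: "k \<longlonglongrightarrow> 0"
    let ?I = "\<lambda>f n. \<integral>\<^sup>+x. ennreal (norm (f (x + k n) - f x) powr 1) \<partial>lborel"
    have "(\<lambda>n. ?I f n + ?I g n) \<longlonglongrightarrow> 0 + 0"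
      using add k unfolding translation_continuous_def by (intro tendsto_add) auto
    moreover have "?I (\<lambda>x. f x + g x) n \<le> ?I f n + ?I g n" for n
    proof -
      have "?I (\<lambda>x. f x + g x) n \<le> (\<integral>\<^sup>+x. ennreal (norm (f (x + k n) - f x) powr 1) + ennreal (norm (g (x + k n) - g x) powr 1) \<partial>lborel)"
        by (intro nn_integral_mono) (simp add: ennreal_plus[symmetric] norm_diff_triangle_ineq add_diff_add norm_triangle_ineq del: ennreal_plus)
      also have "\<dots> = ?I f n + ?I g n" by (subst nn_integral_add) auto
      finally show ?thesis .
    qed
    ultimately show "?I (\<lambda>x. f x + g x) \<longlonglongrightarrow> 0"
      unfolding add_0_right by (rule tendsto_0_ennreal_mono)
  qed
next
  case (lim f s)
  have [measurable]: "f \<in> borel_measurable borel" "s i \<in> borel_measurable borel" for i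
    using lim borel_measurable_integrable by (force simp: measurable_lborel1)+
  show ?case
  proof (rule translation_continuous_approx)
    fix e :: real assume e: "e > 0"
    have "(\<lambda>i. \<integral>\<^sup>+x. norm (f x - s i x) \<partial>lborel) \<longlonglongrightarrow> 0"
    proof (rule nn_integral_dominated_convergence_norm)
      show "AE x in lborel. norm (s j x) \<le> 2 * norm (f x)" for j using lim by simp
      show "(\<integral>\<^sup>+x. ennreal (2 * norm (f x)) \<partial>lborel) < \<infinity>"
        using integrable_mult_right[OF integrable_norm[OF \<open>integrable lborel f\<close>], of 2] by (simp add: integrable_iff_bounded ennreal_mult nn_integral_cmult ennreal_mult_less_top)
      show "AE x in lborel. (\<lambda>i. s i x) \<longlonglongrightarrow> f x" using lim by simp
    qed auto
    from tendsto_0_ennrealD[OF this e] obtain i where "(\<integral>\<^sup>+x. norm (f x - s i x) \<partial>lborel) \<le> ennreal e"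
      by (auto simp: eventually_sequentially)
    then show "\<exists>g\<in>borel_measurable borel. translation_continuous 1 g \<and>
      (\<integral>\<^sup>+x. ennreal (norm (f x - g x) powr 1) \<partial>lborel) \<le> ennreal e"
      using lim by (intro bexI[of _ "s i"]) auto
  qed auto
qed

text \<open>
  For a function bounded by \<open>M\<close>, the \<open>p\<close>-th power of a difference is at most \<open>(2 M) powr (p - 1)\<close>
  times the difference.
\<close>

lemma translation_continuous_bounded:
  fixes f :: "'a::euclidean_space \<Rightarrow> 'b::{real_normed_vector, second_countable_topology}"
  assumes tc: "translation_continuous 1 f" and [measurable]: "f \<in> borel_measurable borel"
    and M: "\<And>x. norm (f x) \<le> M" and p: "p \<ge> 1"
  shows "translation_continuous p f"
  unfolding translation_continuous_def
proof (intro allI impI)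
  fix k :: "nat \<Rightarrow> 'a" assume k: "k \<longlonglongrightarrow> 0"
  let ?I = "\<lambda>p n. \<integral>\<^sup>+x. ennreal (norm (f (x + k n) - f x) powr p) \<partial>lborel"
  have "norm (f (x + c) - f x) powr p \<le> (2 * M) powr (p - 1) * norm (f (x + c) - f x) powr 1" for x c
  proof -
    have "norm (f (x + c) - f x) \<le> 2 * M"
      using M[of x] M[of "x + c"] norm_triangle_ineq4[of "f (x + c)" "f x"] by linarith
    then have "norm (f (x + c) - f x) powr (p - 1) \<le> (2 * M) powr (p - 1)"
      using p by (intro powr_mono2) auto
    then have "norm (f (x + c) - f x) powr (p - 1) * norm (f (x + c) - f x) powr 1 \<le> (2 * M) powr (p - 1) * norm (f (x + c) - f x) powr 1"
      by (intro mult_right_mono) auto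
    then show ?thesis by (simp only: powr_add[symmetric]) simp
  qed
  then have "?I p n \<le> (\<integral>\<^sup>+x. ennreal ((2 * M) powr (p - 1)) * ennreal (norm (f (x + k n) - f x) powr 1) \<partial>lborel)" for n
    by (intro nn_integral_mono) (simp add: ennreal_mult'[symmetric])
  then have le: "?I p n \<le> ennreal ((2 * M) powr (p - 1)) * ?I 1 n" for n
    by (subst (asm) nn_integral_cmult) simp_all
  have "(\<lambda>n. ennreal ((2 * M) powr (p - 1)) * ?I 1 n) \<longlonglongrightarrow> ennreal ((2 * M) powr (p - 1)) * 0"
    using tc k unfolding translation_continuous_def by (intro ennreal_tendsto_cmult) auto
  then have "(\<lambda>n. ennreal ((2 * M) powr (p - 1)) * ?I 1 n) \<longlonglongrightarrow> 0"
    by simp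
  then show "?I p \<longlonglongrightarrow> 0"
    using le by (rule tendsto_0_ennreal_mono)
qed

text \<open>
  Truncating a function in range and in domain yields bounded integrable functions that converge
  to it in \<open>L\<^sup>p\<close>.
\<close>

theorem translation_continuous_Lp:
  fixes f :: "'a::euclidean_space \<Rightarrow> 'b::{banach, second_countable_topology}"
  assumes [measurable]: "f \<in> borel_measurable borel" and p: "p \<ge> 1"
    and fin: "(\<integral>\<^sup>+x. ennreal (norm (f x) powr p) \<partial>lborel) < \<infinity>"
  shows "translation_continuous p f"
proof (rule translation_continuous_approx)
  fix e :: real assume e: "e > 0"
  define g where "g M x = (if norm (f x) \<le> real M \<and> norm x \<le> real M then f x else 0)" for M x
  have [measurable]: "g M \<in> borel_measurable borel" for M unfolding g_def by measurable
  have tc: "translation_continuous p (g M)" for M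
  proof (rule translation_continuous_bounded[OF translation_continuous_L1 _ _ p])
    show "integrable lborel (g M)"
    proof (rule Bochner_Integration.integrable_bound)
      have "emeasure lborel (cball 0 (real M) :: 'a set) < \<infinity>"
        by (intro emeasure_bounded_finite) auto
      then show "integrable lborel (\<lambda>x::'a. real M * indicator (cball 0 (real M)) x)"
        by (intro integrable_mult_right integrable_real_indicator) auto
      show "AE x in lborel. norm (g M x) \<le> norm (real M * indicator (cball 0 (real M)) x)"
        by (intro AE_I2) (auto simp: g_def indicator_def)
    qed auto
    show "norm (g M x) \<le> real M" for x by (simp add: g_def)
  qed auto
  have "(\<lambda>M. \<integral>\<^sup>+x. ennreal (norm (f x - g M x) powr p) \<partial>lborel) \<longlonglongrightarrow> (\<integral>\<^sup>+(x::'a). 0 \<partial>lborel)"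
  proof (rule nn_integral_dominated_convergence[where w="\<lambda>x. ennreal (norm (f x) powr p)"])
    show "AE x in lborel. ennreal (norm (f x - g M x) powr p) \<le> ennreal (norm (f x) powr p)" for M
      by (intro AE_I2) (simp add: g_def)
    show "AE x in lborel. (\<lambda>M. ennreal (norm (f x - g M x) powr p)) \<longlonglongrightarrow> 0"
    proof (rule AE_I2, rule tendsto_eventually)
      fix x
      obtain M where M: "norm (f x) \<le> real M" "norm x \<le> real M"
        using real_arch_simple[of "max (norm (f x)) (norm x)"] by auto
      show "\<forall>\<^sub>F M in sequentially. ennreal (norm (f x - g M x) powr p) = 0"
        unfolding eventually_sequentially
        by (rule exI[of _ M]) (use M p in \<open>auto simp: g_def\<close>)
    qed
  qed (use fin in auto)
  then have "(\<lambda>M. \<integral>\<^sup>+x. ennreal (norm (f x - g M x) powr p) \<partial>lborel) \<longlonglongrightarrow> 0" by simp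
  from tendsto_0_ennrealD[OF this e] obtain M where "(\<integral>\<^sup>+x. ennreal (norm (f x - g M x) powr p) \<partial>lborel) \<le> ennreal e"
    by (auto simp: eventually_sequentially)
  then show "\<exists>g\<in>borel_measurable borel. translation_continuous p g \<and>
      (\<integral>\<^sup>+x. ennreal (norm (f x - g x) powr p) \<partial>lborel) \<le> ennreal e"
    using tc by (intro bexI[of _ "g M"]) auto
qed (use p in auto)

corollary Lp_translation_modulus:
  fixes f :: "'a::euclidean_space \<Rightarrow> 'b::{banach, second_countable_topology}"
  assumes "f \<in> borel_measurable borel" "p \<ge> 1"
    and "(\<integral>\<^sup>+x. ennreal (norm (f x) powr p) \<partial>lborel) < \<infinity>" and e: "e > (0::real)"
  obtains d where "d > 0"
    "\<And>k. norm k < d \<Longrightarrow> (\<integral>\<^sup>+x. ennreal (norm (f (x + k) - f x) powr p) \<partial>lborel) \<le> ennreal e"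
proof (rule ccontr)
  let ?I = "\<lambda>k. \<integral>\<^sup>+x. ennreal (norm (f (x + k) - f x) powr p) \<partial>lborel"
  assume "\<not> thesis"
  then have "\<exists>k. norm k < 1 / Suc n \<and> \<not> ?I k \<le> ennreal e" for n
    using that[of "1 / Suc n"] by (meson divide_pos_pos of_nat_0_less_iff zero_less_Suc zero_less_one)
  then obtain k where k: "\<And>n. norm (k n) < 1 / Suc n" "\<And>n. \<not> ?I (k n) \<le> ennreal e" by metis
  have "k \<longlonglongrightarrow> 0"
  proof (rule Lim_null_comparison)
    show "\<forall>\<^sub>F n in sequentially. norm (k n) \<le> 1 / Suc n"
      using k(1) less_imp_le by (intro always_eventually) blast
    show "(\<lambda>n. 1 / real (Suc n)) \<longlonglongrightarrow> 0" by (rule LIMSEQ_Suc[OF lim_1_over_n])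
  qed
  with translation_continuous_Lp[OF assms(1-3)] have "(\<lambda>n. ?I (k n)) \<longlonglongrightarrow> 0"
    unfolding translation_continuous_def by blast
  from tendsto_0_ennrealD[OF this e] show False
    using k(2) by (auto simp: eventually_sequentially)
qed

section \<open>Jensen's inequality for powers\<close>

lemma powr_above_tangent:
  fixes A y p :: real
  assumes "A > 0" "y \<ge> 0" "p \<ge> 1"
  shows "A powr p + p * A powr (p - 1) * (y - A) \<le> y powr p"
proof (cases "y = 0")
  case True
  have "A powr p = A powr (p - 1) * A"
    using assms by (simp add: powr_diff)
  then have "A powr p + p * A powr (p - 1) * (y - A) = (1 - p) * A powr p"
    using True by (simp add: algebra_simps)
  also have "\<dots> \<le> 0" using assms by (intro mult_nonpos_nonneg) auto
  finally show ?thesis using True by simp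
next
  case False
  have "y powr p - A powr p \<ge> p * A powr (p - 1) * (y - A)"
  proof (rule convex_on_imp_above_tangent[where A="{0<..}"])
    show "((\<lambda>x. x powr p) has_real_derivative p * A powr (p - 1)) (at A within {0<..})"
      using assms by (auto intro!: derivative_eq_intros)
  qed (use assms False in \<open>auto simp: powr_convex interior_open\<close>)
  then show ?thesis by simp
qed

text \<open>
  Jensen's inequality for \<open>\<bar>\<cdot>\<bar> powr p\<close>: integrate the tangent inequality at the mean \<open>A\<close> of \<open>\<bar>f\<bar>\<close>. The
  right-hand side may be infinite.
\<close>

lemma jensen_powr:
  fixes f :: "'a \<Rightarrow> real"
  assumes M: "emeasure M (space M) = 1" and f: "integrable M f" and p: "p \<ge> 1"
  shows "ennreal (\<bar>LINT x|M. f x\<bar> powr p) \<le> (\<integral>\<^sup>+x. ennreal (\<bar>f x\<bar> powr p) \<partial>M)"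
proof -
  interpret finite_measure M using M by (intro finite_measureI) simp
  have M1: "measure M (space M) = 1" using M by (simp add: measure_def)
  have [measurable]: "f \<in> borel_measurable M" using f by auto
  \<comment> \<open>the tangent inequality requires \<open>A > 0\<close>; for \<open>A = 0\<close> the left-hand side is \<open>0\<close>\<close>
  define A where "A = (LINT x|M. \<bar>f x\<bar>)"
  have "\<bar>LINT x|M. f x\<bar> \<le> A"
    unfolding A_def using integral_norm_bound[of M f] by simp
  then have le: "ennreal (\<bar>LINT x|M. f x\<bar> powr p) \<le> ennreal (A powr p)"
    using p by (intro ennreal_leI powr_mono2) auto
  show ?thesis
  proof (cases "A > 0 \<and> (\<integral>\<^sup>+x. ennreal (\<bar>f x\<bar> powr p) \<partial>M) < \<infinity>")
    case True
    then have int: "integrable M (\<lambda>x. \<bar>f x\<bar> powr p)"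
      by (simp add: integrable_iff_bounded)
    have "A powr p = (LINT x|M. A powr p + p * A powr (p - 1) * (\<bar>f x\<bar> - A))"
      using f M1 by (simp add: A_def[symmetric])
    also have "\<dots> \<le> (LINT x|M. \<bar>f x\<bar> powr p)"
      using True p f int by (intro integral_mono powr_above_tangent) auto
    finally have "ennreal (A powr p) \<le> ennreal (LINT x|M. \<bar>f x\<bar> powr p)" by (rule ennreal_leI)
    also have "\<dots> = (\<integral>\<^sup>+x. ennreal (\<bar>f x\<bar> powr p) \<partial>M)"
      using int by (intro nn_integral_eq_integral[symmetric]) auto
    finally show ?thesis by (rule order_trans[OF le])
  next
    case False
    moreover have "A \<ge> 0" by (simp add: A_def)
    ultimately show ?thesis
      using le p by (auto simp: less_top[symmetric])
  qed
qed

section \<open>Weak derivatives along segments\<close>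

text \<open>
  Lebesgue measure on \<open>[0, 1]\<close> as a measure on the whole line: it is a probability measure, and
  Borel measurability and product measures apply without restriction to a subspace.
\<close>

definition unit_measure :: "real measure"
  where "unit_measure = density lborel (indicator {0..1})"

lemma sets_unit_measure [measurable_cong, simp]: "sets unit_measure = sets borel"
  by (simp add: unit_measure_def)

lemma space_unit_measure [simp]: "space unit_measure = UNIV"
  by (simp add: unit_measure_def)

lemma emeasure_unit_measure_space: "emeasure unit_measure UNIV = 1"
  by (simp add: unit_measure_def emeasure_density)

interpretation unit_measure: finite_measure unit_measure
  by (rule finite_measureI) (simp add: emeasure_unit_measure_space)

interpretation unit_lborel: pair_sigma_finite unit_measure "lborel :: 'a::euclidean_space measure" ..

lemma AE_unit_measure: "AE t in unit_measure. 0 \<le> t \<and> t \<le> 1"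
  unfolding unit_measure_def by (subst AE_density) (auto simp: indicator_def)

lemma nn_integral_unit_measure_const: "(\<integral>\<^sup>+t. c \<partial>unit_measure) = c"
  by (simp add: emeasure_unit_measure_space)

lemma unit_measure_FTC:
  fixes F f :: "real \<Rightarrow> real"
  assumes F: "\<And>t. (F has_real_derivative f t) (at t)" and f: "continuous_on UNIV f"
  shows "(LINT t|unit_measure. f t) = F 1 - F 0"
proof -
  have [measurable]: "f \<in> borel_measurable borel" using f by (rule borel_measurable_continuous_onI)
  have "(LINT t|unit_measure. f t) = (LINT t|lborel. indicator {0..1} t *\<^sub>R f t)"
    unfolding unit_measure_def ennreal_indicator[symmetric] by (rule integral_density) auto
  also have "\<dots> = F 1 - F 0"
    using F f by (intro integral_FTC_atLeastAtMost)
      (auto intro: continuous_on_subset has_field_derivative_at_within simp: has_real_derivative_iff_has_vector_derivative[symmetric])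
  finally show ?thesis .
qed

lemma cball_borel [measurable]: "cball x r \<in> sets borel"
  by (simp add: borel_closed)

lemma ball_borel [measurable]: "ball x r \<in> sets borel"
  by (simp add: borel_open)

definition borel_locally_integrable :: "(real^'n::finite \<Rightarrow> real) \<Rightarrow> bool"
  where "borel_locally_integrable f \<longleftrightarrow> f \<in> borel_measurable borel \<and>
    (\<forall>R. (\<integral>\<^sup>+x. ennreal (\<bar>f x\<bar> * indicator (cball 0 R) x) \<partial>lborel) < \<infinity>)"

lemma borel_locally_integrable_integrable:
  assumes f: "borel_locally_integrable f" and [measurable]: "\<psi> \<in> borel_measurable borel"
    and C: "\<And>x. \<bar>\<psi> x\<bar> \<le> C" and R: "\<And>x. norm x > R \<Longrightarrow> \<psi> x = 0"
  shows "integrable lborel (\<lambda>x. f x * \<psi> x)"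
proof (rule integrableI_bounded)
  have [measurable]: "f \<in> borel_measurable borel" using f by (simp add: borel_locally_integrable_def)
  show "(\<lambda>x. f x * \<psi> x) \<in> borel_measurable lborel" by measurable
  have C0: "C \<ge> 0" using C[of 0] by linarith
  have "(\<integral>\<^sup>+x. ennreal (norm (f x * \<psi> x)) \<partial>lborel) \<le> (\<integral>\<^sup>+x. ennreal C * ennreal (\<bar>f x\<bar> * indicator (cball 0 R) x) \<partial>lborel)"
  proof (rule nn_integral_mono)
    fix x
    have "\<bar>f x * \<psi> x\<bar> \<le> C * (\<bar>f x\<bar> * indicator (cball 0 R) x)"
    proof (cases "norm x > R")
      case False
      have "\<bar>f x\<bar> * \<bar>\<psi> x\<bar> \<le> \<bar>f x\<bar> * C" using C by (intro mult_left_mono) auto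
      then show ?thesis using False by (simp add: abs_mult mult.commute)
    qed (simp add: R)
    then show "ennreal (norm (f x * \<psi> x)) \<le> ennreal C * ennreal (\<bar>f x\<bar> * indicator (cball 0 R) x)"
      using C0 by (simp add: ennreal_mult'[symmetric] ennreal_leI)
  qed
  also have "\<dots> = ennreal C * (\<integral>\<^sup>+x. ennreal (\<bar>f x\<bar> * indicator (cball 0 R) x) \<partial>lborel)"
    by (rule nn_integral_cmult) simp
  also have "\<dots> < \<infinity>"
    using f by (simp add: borel_locally_integrable_def ennreal_mult_less_top)
  finally show "(\<integral>\<^sup>+x. ennreal (norm (f x * \<psi> x)) \<partial>lborel) < \<infinity>" .
qed

text \<open>
  A bound on the integrals of the slices that is uniform in the parameter suffices, because the
  parameter ranges over a probability space.
\<close>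

lemma integrable_unit_lborel_bound:
  fixes G :: "real \<Rightarrow> 'a::euclidean_space \<Rightarrow> real"
  assumes [measurable]: "(\<lambda>(t, x). G t x) \<in> borel_measurable (unit_measure \<Otimes>\<^sub>M lborel)"
    and le: "\<And>t. 0 \<le> t \<Longrightarrow> t \<le> 1 \<Longrightarrow> (\<integral>\<^sup>+x. ennreal \<bar>G t x\<bar> \<partial>lborel) \<le> B" and B: "B < \<infinity>"
  shows "integrable (unit_measure \<Otimes>\<^sub>M lborel) (\<lambda>(t, x). G t x)"
proof (rule integrableI_bounded)
  have "(\<integral>\<^sup>+z. ennreal (norm (case z of (t, x) \<Rightarrow> G t x)) \<partial>(unit_measure \<Otimes>\<^sub>M lborel))
    = (\<integral>\<^sup>+t. \<integral>\<^sup>+x. ennreal (norm (case (t, x) of (t, x) \<Rightarrow> G t x)) \<partial>lborel \<partial>unit_measure)"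
    by (rule lborel.nn_integral_fst[symmetric]) simp
  also have "\<dots> \<le> (\<integral>\<^sup>+t. B \<partial>unit_measure)"
    by (rule nn_integral_mono_AE, rule AE_mp[OF AE_unit_measure]) (use le in simp)
  also have "\<dots> < \<infinity>" using B by (simp only: nn_integral_unit_measure_const)
  finally show "(\<integral>\<^sup>+z. ennreal (norm (case z of (t, x) \<Rightarrow> G t x)) \<partial>(unit_measure \<Otimes>\<^sub>M lborel)) < \<infinity>" .
qed simp

lemma integrable_moving_test:
  assumes f: "borel_locally_integrable f" and [measurable]: "\<psi> \<in> borel_measurable borel"
    and C: "\<And>x. \<bar>\<psi> x\<bar> \<le> C" and R: "\<And>x. norm x > R \<Longrightarrow> \<psi> x = 0"
  shows "integrable (unit_measure \<Otimes>\<^sub>M lborel) (\<lambda>(t, x). f x * \<psi> (x - t *\<^sub>R h))"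
proof (rule integrable_unit_lborel_bound)
  have [measurable]: "f \<in> borel_measurable borel" using f by (simp add: borel_locally_integrable_def)
  show "(\<lambda>(t, x). f x * \<psi> (x - t *\<^sub>R h)) \<in> borel_measurable (unit_measure \<Otimes>\<^sub>M lborel)" by measurable
  \<comment> \<open>for \<open>0 \<le> t \<le> 1\<close> all translates of \<open>\<psi>\<close> are supported in one ball of radius \<open>R + norm h\<close>\<close>
  let ?\<psi> = "\<lambda>x. C * indicator (cball 0 (R + norm h)) x :: real"
  have C0: "C \<ge> 0" using C[of 0] by linarith
  have "integrable lborel (\<lambda>x. f x * ?\<psi> x)"
    by (rule borel_locally_integrable_integrable[OF f, of _ C "R + norm h"]) (use C0 in \<open>auto simp: indicator_def\<close>)
  then show "(\<integral>\<^sup>+x. ennreal (norm (f x * ?\<psi> x)) \<partial>lborel) < \<infinity>"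
    by (simp only: integrable_iff_bounded)
  fix t :: real assume t: "0 \<le> t" "t \<le> 1"
  show "(\<integral>\<^sup>+x. ennreal \<bar>f x * \<psi> (x - t *\<^sub>R h)\<bar> \<partial>lborel) \<le> (\<integral>\<^sup>+x. ennreal (norm (f x * ?\<psi> x)) \<partial>lborel)"
  proof (intro nn_integral_mono ennreal_leI)
    fix x
    have "\<bar>\<psi> (x - t *\<^sub>R h)\<bar> \<le> ?\<psi> x"
    proof (cases "norm (x - t *\<^sub>R h) > R")
      case True
      then show ?thesis using R[of "x - t *\<^sub>R h"] C0 by simp
    next
      case False
      have "norm x \<le> norm (x - t *\<^sub>R h) + norm (t *\<^sub>R h)" by (metis diff_add_cancel norm_triangle_ineq)
      also have "norm (t *\<^sub>R h) \<le> norm h" using t by (simp add: mult_left_le_one_le)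
      finally show ?thesis using False C[of "x - t *\<^sub>R h"] by simp
    qed
    then show "\<bar>f x * \<psi> (x - t *\<^sub>R h)\<bar> \<le> norm (f x * ?\<psi> x)"
      using C0 by (simp add: abs_mult mult_left_mono)
  qed
qed

lemma integrable_moving_function:
  assumes f: "borel_locally_integrable f" and [measurable]: "\<psi> \<in> borel_measurable borel"
    and C: "\<And>x. \<bar>\<psi> x\<bar> \<le> C" and R: "\<And>x. norm x > R \<Longrightarrow> \<psi> x = 0"
  shows "integrable (unit_measure \<Otimes>\<^sub>M lborel) (\<lambda>(t, x). f (x + t *\<^sub>R h) * \<psi> x)"
proof (rule integrable_unit_lborel_bound)
  have [measurable]: "f \<in> borel_measurable borel" using f by (simp add: borel_locally_integrable_def)
  show "(\<lambda>(t, x). f (x + t *\<^sub>R h) * \<psi> x) \<in> borel_measurable (unit_measure \<Otimes>\<^sub>M lborel)" by measurable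
  let ?\<psi> = "\<lambda>x. C * indicator (cball 0 (R + norm h)) x :: real"
  have C0: "C \<ge> 0" using C[of 0] by linarith
  have "integrable lborel (\<lambda>x. f x * ?\<psi> x)"
    by (rule borel_locally_integrable_integrable[OF f, of _ C "R + norm h"]) (use C0 in \<open>auto simp: indicator_def\<close>)
  then show "(\<integral>\<^sup>+x. ennreal (norm (f x * ?\<psi> x)) \<partial>lborel) < \<infinity>"
    by (simp only: integrable_iff_bounded)
  fix t :: real assume t: "0 \<le> t" "t \<le> 1"
  have "(\<integral>\<^sup>+x. ennreal \<bar>f (x + t *\<^sub>R h) * \<psi> x\<bar> \<partial>lborel) \<le> (\<integral>\<^sup>+x. ennreal (norm (f (x + t *\<^sub>R h) * ?\<psi> (x + t *\<^sub>R h))) \<partial>lborel)"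
  proof (intro nn_integral_mono ennreal_leI)
    fix x
    have "\<bar>\<psi> x\<bar> \<le> ?\<psi> (x + t *\<^sub>R h)"
    proof (cases "norm x > R")
      case True
      then show ?thesis using R[of x] C0 by simp
    next
      case False
      have "norm (x + t *\<^sub>R h) \<le> norm x + norm (t *\<^sub>R h)" by (rule norm_triangle_ineq)
      also have "norm (t *\<^sub>R h) \<le> norm h" using t by (simp add: mult_left_le_one_le)
      finally show ?thesis using False C[of x] by simp
    qed
    then show "\<bar>f (x + t *\<^sub>R h) * \<psi> x\<bar> \<le> norm (f (x + t *\<^sub>R h) * ?\<psi> (x + t *\<^sub>R h))"
      using C0 by (simp add: abs_mult mult_left_mono)
  qed
  also have "\<dots> = (\<integral>\<^sup>+x. ennreal (norm (f x * ?\<psi> x)) \<partial>lborel)"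
    by (rule nn_integral_lborel_shift) simp
  finally show "(\<integral>\<^sup>+x. ennreal \<bar>f (x + t *\<^sub>R h) * \<psi> x\<bar> \<partial>lborel) \<le> (\<integral>\<^sup>+x. ennreal (norm (f x * ?\<psi> x)) \<partial>lborel)" .
qed

definition directional_deriv :: "real^'n::finite \<Rightarrow> (real^'n \<Rightarrow> real) \<Rightarrow> real^'n \<Rightarrow> real"
  where "directional_deriv h \<phi> x = (\<Sum>i\<in>UNIV. h $ i * partial_deriv i \<phi> x)"

lemma directional_deriv_bounds:
  assumes "test_function \<phi>"
  obtains C R where "\<And>x. \<bar>directional_deriv h \<phi> x\<bar> \<le> C" "\<And>x. norm x > R \<Longrightarrow> directional_deriv h \<phi> x = 0"
proof -
  have "\<exists>C R. C \<ge> 0 \<and> R > 0 \<and> (\<forall>x. \<bar>partial_deriv i \<phi> x\<bar> \<le> C) \<and> (\<forall>x. norm x > R \<longrightarrow> partial_deriv i \<phi> x = 0)" for i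
    using test_function_bounds[OF test_function_partial_deriv[OF assms]] by metis
  then obtain C R where C: "\<And>i x. \<bar>partial_deriv i \<phi> x\<bar> \<le> C i" and R0: "\<And>i. R i > 0"
    and R: "\<And>i x. norm x > R i \<Longrightarrow> partial_deriv i \<phi> x = 0"
    by metis
  show ?thesis
  proof
    show "\<bar>directional_deriv h \<phi> x\<bar> \<le> (\<Sum>i\<in>UNIV. \<bar>h $ i\<bar> * C i)" for x
      unfolding directional_deriv_def
      by (rule order_trans[OF sum_abs]) (auto intro!: sum_mono mult_left_mono simp: abs_mult C)
    show "directional_deriv h \<phi> x = 0" if x: "norm x > (\<Sum>i\<in>UNIV. R i)" for x
    proof -
      have "R i \<le> (\<Sum>i\<in>UNIV. R i)" for i
        using R0 by (intro member_le_sum) (auto intro: less_imp_le)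
      then show ?thesis
        unfolding directional_deriv_def using R x by (intro sum.neutral) (metis order_le_less_trans mult_zero_right)
    qed
  qed
qed

lemma directional_deriv_continuous: "test_function \<phi> \<Longrightarrow> continuous_on UNIV (directional_deriv h \<phi>)"
  unfolding directional_deriv_def
  by (intro continuous_intros test_function_continuous test_function_partial_deriv)

text \<open>
  The fundamental theorem of calculus along the segment from \<open>x - h\<close> to \<open>x\<close>.
\<close>

lemma test_function_line_integral:
  assumes \<phi>: "test_function \<phi>"
  shows "(LINT t|unit_measure. directional_deriv h \<phi> (x - t *\<^sub>R h)) = \<phi> x - \<phi> (x - h)"
proof -
  have D: "((\<lambda>t. \<phi> (x - t *\<^sub>R h)) has_real_derivative - directional_deriv h \<phi> (x - t *\<^sub>R h)) (at t)" for t
  proof -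
    have f: "(\<phi> has_derivative (\<lambda>k. \<Sum>i\<in>UNIV. k $ i * partial_deriv i \<phi> (x - t *\<^sub>R h))) (at (x - t *\<^sub>R h))"
      using \<phi> by (intro has_derivative_partial_derivs smooth_imp_differentiable) (simp add: test_function_def)
    have "((\<lambda>t. \<phi> (x - t *\<^sub>R h)) has_derivative (\<lambda>s. \<Sum>i\<in>UNIV. (- s *\<^sub>R h) $ i * partial_deriv i \<phi> (x - t *\<^sub>R h))) (at t)"
      by (rule has_derivative_compose[of "\<lambda>t. x - t *\<^sub>R h" "\<lambda>s. - s *\<^sub>R h", OF _ f])
        (auto intro!: derivative_eq_intros)
    moreover have "(\<lambda>s. \<Sum>i\<in>UNIV. (- s *\<^sub>R h) $ i * partial_deriv i \<phi> (x - t *\<^sub>R h)) = (*) (- directional_deriv h \<phi> (x - t *\<^sub>R h))"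
      by (auto simp: directional_deriv_def fun_eq_iff sum_distrib_left sum_negf mult_ac)
    ultimately show ?thesis by (simp add: has_field_derivative_def)
  qed
  have "continuous_on UNIV (\<lambda>t. - directional_deriv h \<phi> (x - t *\<^sub>R h))"
    by (intro continuous_intros continuous_on_compose2[OF directional_deriv_continuous[OF \<phi>]]) auto
  from unit_measure_FTC[OF D this] show ?thesis by simp
qed

text \<open>
  The fundamental theorem of calculus along segments for a weak derivative. Tested against \<open>\<phi>\<close>, the
  difference \<open>u (x + h) - u x\<close> turns, after a shift of variables, into \<open>u\<close> tested against \<open>\<phi> (x - h) - \<phi> x\<close>,
  which is an integral of directional derivatives of shifted test functions. The definition of the
  weak derivative moves the derivative to \<open>u\<close>, Fubini's theorem moves the integral over the segment
  outside of the test, and the fundamental lemma removes \<open>\<phi>\<close>.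
\<close>

lemma weak_line_identity:
  fixes u W :: "real^'n::finite \<Rightarrow> real"
  assumes u: "borel_locally_integrable u" and W: "borel_locally_integrable W"
    and weak: "\<And>\<phi>. test_function \<phi> \<Longrightarrow> (LINT x|lborel. u x * directional_deriv h \<phi> x) = - (LINT x|lborel. W x * \<phi> x)"
  shows "AE x in lborel. u (x + h) - u x = (LINT t|unit_measure. W (x + t *\<^sub>R h))"
proof -
  have [measurable]: "u \<in> borel_measurable borel" "W \<in> borel_measurable borel"
    using u W by (auto simp: borel_locally_integrable_def)
  let ?I = "\<lambda>x. LINT t|unit_measure. W (x + t *\<^sub>R h)"
  have [measurable]: "?I \<in> borel_measurable borel" by measurable
  have uh: "borel_locally_integrable (\<lambda>x. u (x + h))"
    unfolding borel_locally_integrable_def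
  proof safe
    fix R
    have "(\<integral>\<^sup>+x. ennreal (\<bar>u (x + h)\<bar> * indicator (cball 0 R) x) \<partial>lborel)
       \<le> (\<integral>\<^sup>+x. ennreal (\<bar>u (x + h)\<bar> * indicator (cball 0 (R + norm h)) (x + h)) \<partial>lborel)"
      by (intro nn_integral_mono ennreal_leI mult_left_mono) (auto simp: indicator_def intro: norm_triangle_le)
    also have "\<dots> = (\<integral>\<^sup>+x. ennreal (\<bar>u x\<bar> * indicator (cball 0 (R + norm h)) x) \<partial>lborel)"
      by (rule nn_integral_lborel_shift) simp
    also have "\<dots> < \<infinity>" using u by (simp add: borel_locally_integrable_def)
    finally show "(\<integral>\<^sup>+x. ennreal (\<bar>u (x + h)\<bar> * indicator (cball 0 R) x) \<partial>lborel) < \<infinity>" .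
  qed simp
  have intI: "integrable lborel (\<lambda>x. ?I x * \<psi> x)"
    if [measurable]: "\<psi> \<in> borel_measurable borel" and "\<And>x. \<bar>\<psi> x\<bar> \<le> C" "\<And>x. norm x > R \<Longrightarrow> \<psi> x = 0" for \<psi> C R
    using unit_lborel.integrable_snd[OF integrable_moving_function[OF W that, where h=h]] by simp
  have "AE x in lborel. u (x + h) - u x - ?I x = 0"
  proof (rule fundamental_lemma)
    fix a b :: "real^'n"
    obtain R where R: "cbox a b \<subseteq> cball 0 R"
      using bounded_cbox[of a b] by (auto simp: bounded_iff subset_iff)
    have b: "\<bar>indicator (cbox a b) x :: real\<bar> \<le> 1" "norm x > R \<Longrightarrow> indicator (cbox a b) x = (0::real)" for x
      using R by (auto simp: indicator_def subset_iff)
    have "integrable lborel (\<lambda>x. u (x + h) * indicator (cbox a b) x - u x * indicator (cbox a b) x - ?I x * indicator (cbox a b) x)"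
      by (intro Bochner_Integration.integrable_diff borel_locally_integrable_integrable[OF uh _ b]
          borel_locally_integrable_integrable[OF u _ b] intI[OF _ b]) auto
    then show "integrable lborel (\<lambda>x. indicator (cbox a b) x * (u (x + h) - u x - ?I x))"
      by (simp add: algebra_simps)
  next
    fix \<phi> :: "real^'n \<Rightarrow> real" assume \<phi>: "test_function \<phi>"
    have [measurable]: "\<phi> \<in> borel_measurable borel" using \<phi> by (rule test_function_measurable)
    have [measurable]: "directional_deriv h \<phi> \<in> borel_measurable borel"
      using directional_deriv_continuous[OF \<phi>] by (rule borel_measurable_continuous_onI)
    obtain C R where CR: "C \<ge> 0" "R > 0" "\<And>x. \<bar>\<phi> x\<bar> \<le> C" "\<And>x. norm x > R \<Longrightarrow> \<phi> x = 0"
      using test_function_bounds[OF \<phi>] by metis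
    obtain C' R' where CR': "\<And>x. \<bar>directional_deriv h \<phi> x\<bar> \<le> C'" "\<And>x. norm x > R' \<Longrightarrow> directional_deriv h \<phi> x = 0"
      using directional_deriv_bounds[OF \<phi>] by metis
    have \<phi>s: "test_function (\<lambda>x. \<phi> (x + c))" for c using \<phi> by (rule test_function_shift)
    have dir_shift: "directional_deriv h (\<lambda>x. \<phi> (x + c)) x = directional_deriv h \<phi> (x + c)" for c x
      by (simp add: directional_deriv_def partial_deriv_shift)
    note int1 = borel_locally_integrable_integrable[OF u _ CR(3,4)]
    have int2: "integrable lborel (\<lambda>x. u (x + h) * \<phi> x)"
      by (rule borel_locally_integrable_integrable[OF uh _ CR(3,4)]) simp
    \<comment> \<open>move the shift from \<open>u\<close> to the test function\<close>
    have "(LINT x|lborel. u (x + h) * \<phi> x) = (LINT x|lborel. u (x + h) * \<phi> (x + h - h))" by simp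
    also have "\<dots> = (LINT x|lborel. u x * \<phi> (x - h))"
      by (rule integral_lborel_shift) simp
    finally have s: "(LINT x|lborel. u (x + h) * \<phi> x) = (LINT x|lborel. u x * \<phi> (x - h))" .
    have int3: "integrable lborel (\<lambda>x. u x * \<phi> (x - h))"
      using int2 integrable_lborel_shift_iff[of "\<lambda>x. u x * \<phi> (x - h)" h] by simp
    have "(LINT x|lborel. u (x + h) * \<phi> x) - (LINT x|lborel. u x * \<phi> x)
        = (LINT x|lborel. u x * \<phi> (x - h) - u x * \<phi> x)"
      unfolding s using int1 int3 by (subst Bochner_Integration.integral_diff) auto
    also have "\<dots> = (LINT x|lborel. LINT t|unit_measure. - (u x * directional_deriv h \<phi> (x - t *\<^sub>R h)))"
      by (intro Bochner_Integration.integral_cong refl) (simp add: test_function_line_integral[OF \<phi>] algebra_simps)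
    also have "\<dots> = (LINT t|unit_measure. LINT x|lborel. - (u x * directional_deriv h \<phi> (x - t *\<^sub>R h)))"
      using integrable_moving_test[OF u, where \<psi>="directional_deriv h \<phi>" and h=h, OF _ CR']
      by (intro unit_lborel.Fubini_integral) (simp add: case_prod_beta')
    also have "\<dots> = (LINT t|unit_measure. LINT x|lborel. W (x + t *\<^sub>R h) * \<phi> x)"
    proof (rule Bochner_Integration.integral_cong[OF refl])
      fix t
      have "(LINT x|lborel. - (u x * directional_deriv h \<phi> (x - t *\<^sub>R h))) = (LINT x|lborel. W x * \<phi> (x - t *\<^sub>R h))"
        using weak[OF \<phi>s[of "- t *\<^sub>R h"], unfolded dir_shift] by simp
      also have "\<dots> = (LINT x|lborel. W (x + t *\<^sub>R h) * \<phi> (x + t *\<^sub>R h - t *\<^sub>R h))"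
        by (rule integral_lborel_shift[symmetric]) simp
      finally show "(LINT x|lborel. - (u x * directional_deriv h \<phi> (x - t *\<^sub>R h))) = (LINT x|lborel. W (x + t *\<^sub>R h) * \<phi> x)" by simp
    qed
    also have "\<dots> = (LINT x|lborel. LINT t|unit_measure. W (x + t *\<^sub>R h) * \<phi> x)"
      using integrable_moving_function[OF W, where \<psi>=\<phi> and h=h, OF _ CR(3,4)]
      by (intro unit_lborel.Fubini_integral[symmetric]) simp
    also have "\<dots> = (LINT x|lborel. ?I x * \<phi> x)" by simp
    finally have *: "(LINT x|lborel. u (x + h) * \<phi> x) - (LINT x|lborel. u x * \<phi> x) = (LINT x|lborel. ?I x * \<phi> x)" .
    have "(LINT x|lborel. (u (x + h) - u x - ?I x) * \<phi> x)
       = (LINT x|lborel. u (x + h) * \<phi> x - u x * \<phi> x - ?I x * \<phi> x)"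
      by (simp add: algebra_simps)
    also have "\<dots> = (LINT x|lborel. u (x + h) * \<phi> x) - (LINT x|lborel. u x * \<phi> x) - (LINT x|lborel. ?I x * \<phi> x)"
      using int1 int2 intI[OF _ CR(3,4)] by simp
    also have "\<dots> = 0" using * by simp
    finally show "(LINT x|lborel. (u (x + h) - u x - ?I x) * \<phi> x) = 0" .
  qed simp
  then show ?thesis by eventually_elim simp
qed

text \<open>
  Fubini's theorem on a sequence of balls that exhausts the space.
\<close>

lemma AE_integrable_on_segment:
  assumes W: "borel_locally_integrable W"
  shows "AE x in lborel. integrable unit_measure (\<lambda>t. W (x + t *\<^sub>R h))"
proof -
  have "AE x in lborel. integrable unit_measure (\<lambda>t. W (x + t *\<^sub>R h) * indicator (cball 0 (real n)) x)" for n
    by (rule unit_lborel.AE_integrable_snd[OF integrable_moving_function[OF W, of _ 1 "real n"]])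
       (auto simp: indicator_def)
  then have "AE x in lborel. \<forall>n. integrable unit_measure (\<lambda>t. W (x + t *\<^sub>R h) * indicator (cball 0 (real n)) x)"
    unfolding AE_all_countable by blast
  then show ?thesis
  proof eventually_elim
    case (elim x)
    obtain n where "norm x \<le> real n" using real_arch_simple by blast
    with elim[rule_format, of n] show ?case by simp
  qed
qed

section \<open>Comparing increments with their linear part\<close>

lemma measure_unit_measure_UNIV: "measure unit_measure UNIV = 1"
  by (simp add: measure_def emeasure_unit_measure_space)

lemma Lp_borel_locally_integrable:
  fixes f :: "real^'n::finite \<Rightarrow> real"
  assumes [measurable]: "f \<in> borel_measurable borel" and p: "p \<ge> 1"
    and fin: "(\<integral>\<^sup>+x. ennreal (\<bar>f x\<bar> powr p) \<partial>lborel) < \<infinity>"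
  shows "borel_locally_integrable f"
  unfolding borel_locally_integrable_def
proof safe
  fix R
  have "(\<integral>\<^sup>+x. ennreal (\<bar>f x\<bar> * indicator (cball 0 R) x) \<partial>lborel)
      \<le> (\<integral>\<^sup>+x. indicator (cball 0 R) x + ennreal (\<bar>f x\<bar> powr p) \<partial>lborel)"
  proof (rule nn_integral_mono)
    fix x
    have "\<bar>f x\<bar> \<le> 1 + \<bar>f x\<bar> powr p"
    proof (cases "\<bar>f x\<bar> \<le> 1")
      case True
      then show ?thesis using powr_ge_zero[of "\<bar>f x\<bar>" p] by linarith
    next
      case False
      then have "\<bar>f x\<bar> powr 1 \<le> \<bar>f x\<bar> powr p" using p by (intro powr_mono) auto
      then show ?thesis by simp
    qed
    then show "ennreal (\<bar>f x\<bar> * indicator (cball 0 R) x) \<le> indicator (cball 0 R) x + ennreal (\<bar>f x\<bar> powr p)"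
      by (auto simp: indicator_def ennreal_1[symmetric] ennreal_plus[symmetric] ennreal_leI simp del: ennreal_1 ennreal_plus)
  qed
  also have "\<dots> = emeasure lborel (cball 0 R :: (real^'n) set) + (\<integral>\<^sup>+x. ennreal (\<bar>f x\<bar> powr p) \<partial>lborel)"
    by (subst nn_integral_add) auto
  also have "\<dots> < \<infinity>"
    using fin emeasure_bounded_finite[of "cball 0 R :: (real^'n) set"] by simp
  finally show "(\<integral>\<^sup>+x. ennreal (\<bar>f x\<bar> * indicator (cball 0 R) x) \<partial>lborel) < \<infinity>" .
qed simp

text \<open>
  Averaging over the segment parameter does not increase the \<open>p\<close>-th power of the \<open>L\<^sup>p\<close> norm.
\<close>

lemma jensen_unit_average:
  assumes G [measurable]: "(\<lambda>(t, x). G t x) \<in> borel_measurable (unit_measure \<Otimes>\<^sub>M (lborel :: 'a::euclidean_space measure))"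
    and int: "AE x in lborel. integrable unit_measure (\<lambda>t. G t x)" and p: "p \<ge> 1"
  shows "(\<integral>\<^sup>+x. ennreal (\<bar>LINT t|unit_measure. G t x\<bar> powr p) \<partial>lborel)
     \<le> (\<integral>\<^sup>+t. \<integral>\<^sup>+x. ennreal (\<bar>G t x\<bar> powr p) \<partial>lborel \<partial>unit_measure)"
proof -
  have "(\<integral>\<^sup>+x. ennreal (\<bar>LINT t|unit_measure. G t x\<bar> powr p) \<partial>lborel)
     \<le> (\<integral>\<^sup>+x. \<integral>\<^sup>+t. ennreal (\<bar>G t x\<bar> powr p) \<partial>unit_measure \<partial>lborel)"
  proof (rule nn_integral_mono_AE, use int in eventually_elim)
    case (elim x)
    then show ?case using p by (intro jensen_powr) (auto simp: emeasure_unit_measure_space)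
  qed
  also have "\<dots> = (\<integral>\<^sup>+t. \<integral>\<^sup>+x. ennreal (\<bar>G t x\<bar> powr p) \<partial>lborel \<partial>unit_measure)"
    by (rule unit_lborel.Fubini') measurable
  finally show ?thesis .
qed

lemma powr_convex_combination:
  fixes x y s p :: real
  assumes "x \<ge> 0" "y \<ge> 0" "0 < s" "s < 1" "p \<ge> 1"
  shows "(s * x + (1 - s) * y) powr p \<le> s * x powr p + (1 - s) * y powr p"
proof (cases "s * x + (1 - s) * y = 0")
  case False
  define A where "A = s * x + (1 - s) * y"
  have A: "A > 0" using False assms by (simp add: A_def less_le)
  define c where "c = p * A powr (p - 1)"
  have "s * (A powr p + c * (x - A)) + (1 - s) * (A powr p + c * (y - A)) \<le> s * x powr p + (1 - s) * y powr p"
    unfolding c_def using assms A by (intro add_mono mult_left_mono powr_above_tangent) auto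
  moreover have "s * (A powr p + c * (x - A)) + (1 - s) * (A powr p + c * (y - A)) = A powr p + c * (s * x + (1 - s) * y - A)"
    by (simp add: algebra_simps)
  ultimately show ?thesis by (simp add: A_def)
qed (use assms in simp)

text \<open>
  Convexity applied to \<open>\<bar>a\<bar> \<le> s (\<bar>b\<bar> / s) + (1 - s) (\<bar>b - a\<bar> / (1 - s))\<close>. For \<open>s\<close> close to \<open>1\<close> the factor
  of \<open>\<bar>b\<bar> powr p\<close> is close to \<open>1\<close>, at the price of a large factor of the error term.
\<close>

lemma powr_split:
  fixes a b s p :: real
  assumes "0 < s" "s < 1" "p \<ge> 1"
  shows "\<bar>a\<bar> powr p \<le> s powr (1 - p) * \<bar>b\<bar> powr p + (1 - s) powr (1 - p) * \<bar>b - a\<bar> powr p"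
proof -
  have "\<bar>a\<bar> powr p \<le> (s * (\<bar>b\<bar> / s) + (1 - s) * (\<bar>b - a\<bar> / (1 - s))) powr p"
    using assms by (intro powr_mono2) auto
  also have "\<dots> \<le> s * (\<bar>b\<bar> / s) powr p + (1 - s) * (\<bar>b - a\<bar> / (1 - s)) powr p"
    using assms by (intro powr_convex_combination) auto
  also have "\<dots> = s powr (1 - p) * \<bar>b\<bar> powr p + (1 - s) powr (1 - p) * \<bar>b - a\<bar> powr p"
    using assms by (simp add: powr_divide powr_diff)
  finally show ?thesis .
qed

text \<open>
  A function of \<open>W\<^sup>1\<^sup>,\<^sup>p\<close> together with its weak gradient, both given by Borel representatives, because
  measurability of \<open>g (x + t h)\<close> in \<open>(t, x)\<close> is then immediate.
\<close>

locale borel_W1p =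
  fixes p :: real and u :: "real^'n::finite \<Rightarrow> real" and g :: "real^'n \<Rightarrow> real^'n"
  assumes p: "p \<ge> 1"
    and u_borel [measurable]: "u \<in> borel_measurable borel"
    and g_borel [measurable]: "g \<in> borel_measurable borel"
    and u_Lp: "(\<integral>\<^sup>+x. ennreal (\<bar>u x\<bar> powr p) \<partial>lborel) < \<infinity>"
    and g_Lp: "(\<integral>\<^sup>+x. ennreal (norm (g x) powr p) \<partial>lborel) < \<infinity>"
    and weak_gradient: "\<And>\<phi> i. test_function \<phi> \<Longrightarrow>
      (LINT x|lborel. u x * partial_deriv i \<phi> x) = - (LINT x|lborel. g x $ i * \<phi> x)"
begin

definition increment :: "real^'n \<Rightarrow> ennreal"
  where "increment h = (\<integral>\<^sup>+x. ennreal (\<bar>u (x + h) - u x\<bar> powr p) \<partial>lborel)"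

definition slope :: "real^'n \<Rightarrow> ennreal"
  where "slope h = (\<integral>\<^sup>+x. ennreal (\<bar>h \<bullet> g x\<bar> powr p) \<partial>lborel)"

lemma increment_measurable [measurable]: "increment \<in> borel_measurable borel"
  unfolding increment_def by measurable

lemma slope_measurable [measurable]: "slope \<in> borel_measurable borel"
  unfolding slope_def by measurable

lemma slope_le: "slope h \<le> ennreal (norm h powr p) * (\<integral>\<^sup>+x. ennreal (norm (g x) powr p) \<partial>lborel)"
proof -
  have "slope h \<le> (\<integral>\<^sup>+x. ennreal (norm h powr p) * ennreal (norm (g x) powr p) \<partial>lborel)"
    unfolding slope_def
  proof (rule nn_integral_mono)
    fix x
    have "\<bar>h \<bullet> g x\<bar> powr p \<le> (norm h * norm (g x)) powr p"
      using p by (intro powr_mono2 Cauchy_Schwarz_ineq2) auto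
    then show "ennreal (\<bar>h \<bullet> g x\<bar> powr p) \<le> ennreal (norm h powr p) * ennreal (norm (g x) powr p)"
      by (simp add: ennreal_mult'[symmetric] powr_mult ennreal_leI)
  qed
  then show ?thesis by (simp add: nn_integral_cmult)
qed

lemma slope_finite: "slope h < \<infinity>"
  using slope_le[of h] g_Lp by (simp add: ennreal_mult_less_top le_less_trans)

lemma increment_bounded: "\<exists>C::real. \<forall>h. increment h \<le> ennreal C"
proof -
  let ?U = "\<integral>\<^sup>+x. ennreal (\<bar>u x\<bar> powr p) \<partial>lborel"
  have "increment h \<le> ennreal (3 powr p) * (?U + ?U + 0)" for h
  proof -
    have "increment h \<le> ennreal (3 powr p) * ((\<integral>\<^sup>+x. ennreal (norm (u (x + h)) powr p) \<partial>lborel) +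
       (\<integral>\<^sup>+x. ennreal (norm (- u x) powr p) \<partial>lborel) + (\<integral>\<^sup>+(x::real^'n). ennreal (norm (0::real) powr p) \<partial>lborel))"
      unfolding increment_def real_norm_def[symmetric] using p by (intro Lp_triangle3) auto
    also have "(\<integral>\<^sup>+x. ennreal (norm (u (x + h)) powr p) \<partial>lborel) = ?U"
      using nn_integral_lborel_shift[of "\<lambda>x. ennreal (\<bar>u x\<bar> powr p)" h] by simp
    finally show ?thesis by simp
  qed
  moreover have "ennreal (3 powr p) * (?U + ?U + 0) < \<infinity>"
    using u_Lp by (simp add: ennreal_mult_less_top)
  then obtain C where "ennreal (3 powr p) * (?U + ?U + 0) = ennreal C"
    by (cases "ennreal (3 powr p) * (?U + ?U + 0)") auto
  ultimately show ?thesis by metis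
qed

lemma u_locally_integrable: "borel_locally_integrable u"
  using u_Lp p by (intro Lp_borel_locally_integrable) auto

lemma inner_g_locally_integrable: "borel_locally_integrable (\<lambda>x. h \<bullet> g x)"
  using slope_finite[of h] p by (intro Lp_borel_locally_integrable) (auto simp: slope_def)

lemma weak_directional:
  assumes \<phi>: "test_function \<phi>"
  shows "(LINT x|lborel. u x * directional_deriv h \<phi> x) = - (LINT x|lborel. (h \<bullet> g x) * \<phi> x)"
proof -
  have [measurable]: "\<phi> \<in> borel_measurable borel" "partial_deriv i \<phi> \<in> borel_measurable borel" for i
    using \<phi> by (auto intro: test_function_measurable test_function_partial_deriv)
  have int: "integrable lborel (\<lambda>x. f x * \<psi> x)" if \<psi>: "test_function \<psi>" and f: "borel_locally_integrable f" for f \<psi>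
  proof -
    obtain C R where "\<And>x. \<bar>\<psi> x\<bar> \<le> C" "\<And>x. norm x > R \<Longrightarrow> \<psi> x = 0"
      using test_function_bounds[OF \<psi>] by metis
    then show ?thesis
      using \<psi> f by (intro borel_locally_integrable_integrable[of f \<psi> C R] test_function_measurable)
  qed
  have 1: "integrable lborel (\<lambda>x. u x * partial_deriv i \<phi> x)" for i
    using \<phi> by (intro int test_function_partial_deriv u_locally_integrable)
  have "borel_locally_integrable (\<lambda>x. g x $ i)" for i
    using inner_g_locally_integrable[of "axis i 1"] by (simp add: inner_axis')
  then have 2: "integrable lborel (\<lambda>x. g x $ i * \<phi> x)" for i
    using \<phi> by (intro int)
  have "(LINT x|lborel. u x * directional_deriv h \<phi> x) = (LINT x|lborel. (\<Sum>i\<in>UNIV. h $ i * (u x * partial_deriv i \<phi> x)))"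
    by (simp add: directional_deriv_def sum_distrib_left mult_ac)
  also have "\<dots> = (\<Sum>i\<in>UNIV. h $ i * (LINT x|lborel. u x * partial_deriv i \<phi> x))"
    using 1 by (subst Bochner_Integration.integral_sum) auto
  also have "\<dots> = - (\<Sum>i\<in>UNIV. h $ i * (LINT x|lborel. g x $ i * \<phi> x))"
    by (simp add: weak_gradient[OF \<phi>] sum_negf)
  also have "(\<Sum>i\<in>UNIV. h $ i * (LINT x|lborel. g x $ i * \<phi> x)) = (LINT x|lborel. (\<Sum>i\<in>UNIV. h $ i * (g x $ i * \<phi> x)))"
    using 2 by (subst Bochner_Integration.integral_sum) auto
  also have "\<dots> = (LINT x|lborel. (h \<bullet> g x) * \<phi> x)"
    by (simp add: inner_vec_def sum_distrib_left sum_distrib_right mult_ac)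
  finally show ?thesis .
qed

lemma line_identity:
  "AE x in lborel. u (x + h) - u x = (LINT t|unit_measure. h \<bullet> g (x + t *\<^sub>R h))"
  using weak_line_identity[OF u_locally_integrable inner_g_locally_integrable weak_directional] .

text \<open>
  The increment is an average of \<open>h \<bullet> g\<close> over translates, all of which have the same \<open>L\<^sup>p\<close> norm.
\<close>

lemma increment_le_slope: "increment h \<le> slope h"
proof -
  have "increment h = (\<integral>\<^sup>+x. ennreal (\<bar>LINT t|unit_measure. h \<bullet> g (x + t *\<^sub>R h)\<bar> powr p) \<partial>lborel)"
    unfolding increment_def
    by (rule nn_integral_cong_AE, use line_identity[of h] in eventually_elim) simp
  also have "\<dots> \<le> (\<integral>\<^sup>+t. \<integral>\<^sup>+x. ennreal (\<bar>h \<bullet> g (x + t *\<^sub>R h)\<bar> powr p) \<partial>lborel \<partial>unit_measure)"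
    using AE_integrable_on_segment[OF inner_g_locally_integrable] p by (intro jensen_unit_average) auto
  also have "\<dots> = (\<integral>\<^sup>+t. slope h \<partial>unit_measure)"
    unfolding slope_def
    by (intro nn_integral_cong nn_integral_lborel_shift[of "\<lambda>x. ennreal (\<bar>h \<bullet> g x\<bar> powr p)"]) simp
  also have "\<dots> = slope h" by (rule nn_integral_unit_measure_const)
  finally show ?thesis .
qed

text \<open>
  The error of the linearization is the average of \<open>h \<bullet> (g (x + t h) - g x)\<close> over the segment.
\<close>

lemma linearization_error:
  "(\<integral>\<^sup>+x. ennreal (\<bar>u (x + h) - u x - h \<bullet> g x\<bar> powr p) \<partial>lborel)
    \<le> ennreal (norm h powr p) *
        (\<integral>\<^sup>+t. \<integral>\<^sup>+x. ennreal (norm (g (x + t *\<^sub>R h) - g x) powr p) \<partial>lborel \<partial>unit_measure)"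
proof -
  have int: "AE x in lborel. integrable unit_measure (\<lambda>t. h \<bullet> g (x + t *\<^sub>R h) - h \<bullet> g x)"
    using AE_integrable_on_segment[OF inner_g_locally_integrable[of h], of h] by eventually_elim simp
  have "(\<integral>\<^sup>+x. ennreal (\<bar>u (x + h) - u x - h \<bullet> g x\<bar> powr p) \<partial>lborel)
     = (\<integral>\<^sup>+x. ennreal (\<bar>LINT t|unit_measure. h \<bullet> g (x + t *\<^sub>R h) - h \<bullet> g x\<bar> powr p) \<partial>lborel)"
  proof (rule nn_integral_cong_AE, use line_identity[of h] AE_integrable_on_segment[OF inner_g_locally_integrable[of h], of h] in eventually_elim)
    case (elim x)
    then show ?case
      by (subst Bochner_Integration.integral_diff) (simp_all add: measure_unit_measure_UNIV)
  qed
  also have "\<dots> \<le> (\<integral>\<^sup>+t. \<integral>\<^sup>+x. ennreal (\<bar>h \<bullet> g (x + t *\<^sub>R h) - h \<bullet> g x\<bar> powr p) \<partial>lborel \<partial>unit_measure)"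
    using int p by (intro jensen_unit_average) auto
  also have "\<dots> \<le> (\<integral>\<^sup>+t. \<integral>\<^sup>+x. ennreal (norm h powr p) * ennreal (norm (g (x + t *\<^sub>R h) - g x) powr p) \<partial>lborel \<partial>unit_measure)"
  proof (intro nn_integral_mono)
    fix x t
    have "\<bar>h \<bullet> g (x + t *\<^sub>R h) - h \<bullet> g x\<bar> powr p \<le> (norm h * norm (g (x + t *\<^sub>R h) - g x)) powr p"
      using p by (intro powr_mono2) (auto simp: inner_diff_right[symmetric] Cauchy_Schwarz_ineq2)
    then show "ennreal (\<bar>h \<bullet> g (x + t *\<^sub>R h) - h \<bullet> g x\<bar> powr p)
        \<le> ennreal (norm h powr p) * ennreal (norm (g (x + t *\<^sub>R h) - g x) powr p)"
      by (simp add: ennreal_mult'[symmetric] powr_mult ennreal_leI)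
  qed
  also have "\<dots> = ennreal (norm h powr p) *
        (\<integral>\<^sup>+t. \<integral>\<^sup>+x. ennreal (norm (g (x + t *\<^sub>R h) - g x) powr p) \<partial>lborel \<partial>unit_measure)"
    by (simp add: nn_integral_cmult)
  finally show ?thesis .
qed

text \<open>
  Up to a factor close to \<open>1\<close> and an error \<open>e \<bar>h\<bar>\<^sup>p\<close>, the upper bound \<open>slope\<close> of \<open>increment\<close> is also a
  lower bound near \<open>h = 0\<close>, uniformly in the direction of \<open>h\<close>. The uniformity comes from the
  continuity of translation in \<open>L\<^sup>p\<close> for the vector-valued function \<open>g\<close>.
\<close>

lemma slope_le_increment:
  assumes s: "0 < s" "s < 1" and e: "e > 0"
  obtains d where "d > 0"
    "\<And>h. norm h < d \<Longrightarrow> slope h \<le> ennreal (s powr (1 - p)) * increment h + ennreal e * ennreal (norm h powr p)"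
proof -
  \<comment> \<open>this modulus compensates the large factor of the error term in the convexity inequality\<close>
  define e' where "e' = e / (1 - s) powr (1 - p)"
  have e': "e' > 0" using e s by (simp add: e'_def)
  obtain d where d: "d > 0"
    "\<And>k. norm k < d \<Longrightarrow> (\<integral>\<^sup>+x. ennreal (norm (g (x + k) - g x) powr p) \<partial>lborel) \<le> ennreal e'"
    by (rule Lp_translation_modulus[OF g_borel p g_Lp e']) (rule that)
  show ?thesis
  proof
    fix h :: "real^'n" assume h: "norm h < d"
    have "(\<integral>\<^sup>+t. \<integral>\<^sup>+x. ennreal (norm (g (x + t *\<^sub>R h) - g x) powr p) \<partial>lborel \<partial>unit_measure)
       \<le> (\<integral>\<^sup>+t. ennreal e' \<partial>unit_measure)"
    proof (rule nn_integral_mono_AE, use AE_unit_measure in eventually_elim)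
      case (elim t)
      then have "norm (t *\<^sub>R h) < d"
        using h mult_left_le_one_le[of "norm h" "\<bar>t\<bar>"] by simp
      then show ?case by (rule d(2))
    qed
    then have avg: "(\<integral>\<^sup>+t. \<integral>\<^sup>+x. ennreal (norm (g (x + t *\<^sub>R h) - g x) powr p) \<partial>lborel \<partial>unit_measure) \<le> ennreal e'"
      by (simp only: nn_integral_unit_measure_const)
    let ?E = "\<integral>\<^sup>+x. ennreal (\<bar>u (x + h) - u x - h \<bullet> g x\<bar> powr p) \<partial>lborel"
    have E: "?E \<le> ennreal (norm h powr p) * ennreal e'"
      by (rule order_trans[OF linearization_error]) (intro mult_left_mono avg, simp)
    have "slope h \<le> (\<integral>\<^sup>+x. ennreal (s powr (1 - p)) * ennreal (\<bar>u (x + h) - u x\<bar> powr p)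
        + ennreal ((1 - s) powr (1 - p)) * ennreal (\<bar>u (x + h) - u x - h \<bullet> g x\<bar> powr p) \<partial>lborel)"
      unfolding slope_def
    proof (rule nn_integral_mono)
      fix x
      show "ennreal (\<bar>h \<bullet> g x\<bar> powr p) \<le> ennreal (s powr (1 - p)) * ennreal (\<bar>u (x + h) - u x\<bar> powr p)
        + ennreal ((1 - s) powr (1 - p)) * ennreal (\<bar>u (x + h) - u x - h \<bullet> g x\<bar> powr p)"
        using powr_split[OF s p, of "h \<bullet> g x" "u (x + h) - u x"]
        by (simp add: ennreal_mult'[symmetric] ennreal_plus[symmetric] ennreal_leI del: ennreal_plus)
    qed
    also have "\<dots> = ennreal (s powr (1 - p)) * increment h + ennreal ((1 - s) powr (1 - p)) * ?E"
      unfolding increment_def by (subst nn_integral_add) (auto simp: nn_integral_cmult)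
    also have "\<dots> \<le> ennreal (s powr (1 - p)) * increment h
        + ennreal ((1 - s) powr (1 - p)) * (ennreal (norm h powr p) * ennreal e')"
      by (intro add_left_mono mult_left_mono E) simp
    also have "ennreal ((1 - s) powr (1 - p)) * (ennreal (norm h powr p) * ennreal e') = ennreal e * ennreal (norm h powr p)"
      using s e by (simp add: ennreal_mult'[symmetric] e'_def)
    finally show "slope h \<le> ennreal (s powr (1 - p)) * increment h + ennreal e * ennreal (norm h powr p)" .
  qed (use d in simp)
qed

end

section \<open>Rotations and radial integration\<close>

lemma nn_integral_lborel_scale:
  fixes f :: "'a::euclidean_space \<Rightarrow> ennreal"
  assumes [measurable]: "f \<in> borel_measurable borel" and c: "c > 0"
  shows "(\<integral>\<^sup>+x. f x \<partial>lborel) = ennreal (c ^ DIM('a)) * (\<integral>\<^sup>+x. f (c *\<^sub>R x) \<partial>lborel)"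
proof -
  have "(\<integral>\<^sup>+x. f x \<partial>lborel) = (\<integral>\<^sup>+x. f x \<partial>density (distr lborel borel (\<lambda>x. 0 + c *\<^sub>R x)) (\<lambda>_. \<bar>c\<bar> ^ DIM('a)))"
    using c by (subst lborel_affine[of c 0]) auto
  also have "\<dots> = ennreal (c ^ DIM('a)) * (\<integral>\<^sup>+x. f (c *\<^sub>R x) \<partial>lborel)"
    using c by (subst nn_integral_density) (auto simp: nn_integral_distr nn_integral_cmult)
  finally show ?thesis .
qed

text \<open>
  Rotation invariance of Lebesgue measure, by the argument for the uniqueness of Haar measure.
  The functional \<open>\<phi> \<mapsto> \<integral> \<phi> (f y) dy\<close> is invariant under translations of \<open>\<phi>\<close>, because \<open>f\<close> is linear and
  onto. Multiply it by the volume of the unit ball, written as an integral, shift \<open>\<phi>\<close> by the variable of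
  the ball and exchange the integrals: what remains is the volume of a preimage under \<open>f\<close> of a
  translate of the ball, which is a translate of the ball because \<open>f\<close> preserves norms.
\<close>

lemma nn_integral_orthogonal_transformation:
  fixes \<phi> :: "'a::euclidean_space \<Rightarrow> ennreal" and f :: "'a \<Rightarrow> 'a"
  assumes f: "orthogonal_transformation f" and [measurable]: "\<phi> \<in> borel_measurable borel"
  shows "(\<integral>\<^sup>+x. \<phi> (f x) \<partial>lborel) = (\<integral>\<^sup>+x. \<phi> x \<partial>lborel)"
proof -
  have lin: "linear f" using f by (rule orthogonal_transformation_linear)
  have [measurable]: "f \<in> borel_measurable borel"
    using lin by (intro borel_measurable_continuous_onI linear_continuous_on) (simp add: linear_linear)
  have surj: "surj f"
    using linear_injective_imp_surjective[OF lin orthogonal_transformation_inj[OF f]] by simp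
  let ?B = "indicator (ball 0 1) :: 'a \<Rightarrow> ennreal"
  let ?b = "emeasure lborel (ball 0 1 :: 'a set)"
  have shift: "(\<integral>\<^sup>+y. \<phi> (f y + c) \<partial>lborel) = (\<integral>\<^sup>+y. \<phi> (f y) \<partial>lborel)" for c
  proof -
    obtain c' where "c = f c'" using surj by blast
    then have "(\<integral>\<^sup>+y. \<phi> (f y + c) \<partial>lborel) = (\<integral>\<^sup>+y. \<phi> (f (y + c')) \<partial>lborel)"
      using lin by (simp add: linear_add)
    then show ?thesis
      using nn_integral_lborel_shift[of "\<lambda>y. \<phi> (f y)" c'] by simp
  qed
  have ball: "(\<integral>\<^sup>+y. ?B (x - f y) \<partial>lborel) = ?b" for x
  proof -
    obtain x' where x: "x = f x'" using surj by blast
    have "norm (x - f y) = norm (y - x')" for y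
      using orthogonal_transformation_norm[OF f, of "x' - y"] lin by (simp add: x linear_diff norm_minus_commute)
    then have "(\<integral>\<^sup>+y. ?B (x - f y) \<partial>lborel) = (\<integral>\<^sup>+y. ?B (y + - x') \<partial>lborel)"
      by (intro nn_integral_cong) (simp add: indicator_def)
    also have "\<dots> = (\<integral>\<^sup>+y. ?B y \<partial>lborel)" by (rule nn_integral_lborel_shift) simp
    finally show ?thesis by simp
  qed
  have "?b * (\<integral>\<^sup>+y. \<phi> (f y) \<partial>lborel) = (\<integral>\<^sup>+x. ?B x * (\<integral>\<^sup>+y. \<phi> (f y + x) \<partial>lborel) \<partial>lborel)"
    by (simp add: shift nn_integral_multc)
  also have "\<dots> = (\<integral>\<^sup>+x. \<integral>\<^sup>+y. ?B x * \<phi> (f y + x) \<partial>lborel \<partial>lborel)"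
    by (simp add: nn_integral_cmult)
  also have "\<dots> = (\<integral>\<^sup>+y. \<integral>\<^sup>+x. ?B x * \<phi> (f y + x) \<partial>lborel \<partial>lborel)"
    by (rule lborel_pair.Fubini'[symmetric]) measurable
  also have "\<dots> = (\<integral>\<^sup>+y. \<integral>\<^sup>+x. ?B (x - f y) * \<phi> x \<partial>lborel \<partial>lborel)"
  proof (rule nn_integral_cong)
    fix y
    show "(\<integral>\<^sup>+x. ?B x * \<phi> (f y + x) \<partial>lborel) = (\<integral>\<^sup>+x. ?B (x - f y) * \<phi> x \<partial>lborel)"
      using nn_integral_lborel_shift[of "\<lambda>x. ?B (x - f y) * \<phi> x" "f y"] by (simp add: add.commute)
  qed
  also have "\<dots> = (\<integral>\<^sup>+x. \<integral>\<^sup>+y. ?B (x - f y) * \<phi> x \<partial>lborel \<partial>lborel)"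
    by (rule lborel_pair.Fubini'[symmetric]) measurable
  also have "\<dots> = ?b * (\<integral>\<^sup>+x. \<phi> x \<partial>lborel)"
    by (simp add: nn_integral_multc ball nn_integral_cmult)
  finally have eq: "?b * (\<integral>\<^sup>+y. \<phi> (f y) \<partial>lborel) = ?b * (\<integral>\<^sup>+x. \<phi> x \<partial>lborel)" .
  have "?b \<noteq> 0"
    using open_not_negligible[of "ball (0::'a) 1"] by (auto simp: negligible_iff_emeasure0)
  moreover have "?b \<noteq> top"
    using emeasure_lborel_ball_finite[of "0::'a" 1] by auto
  ultimately show ?thesis
    using eq by (simp add: ennreal_mult_cancel_left)
qed

lemma nn_integral_powr_0:
  assumes "a > -1" "R \<ge> 0"
  shows "(\<integral>\<^sup>+r. ennreal (indicator {0..R} r * r powr a) \<partial>lborel) = ennreal (R powr (a + 1) / (a + 1))"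
  by (rule nn_integral_has_integral_lebesgue) (use assms in \<open>auto intro: has_integral_powr_from_0\<close>)

lemma nn_integral_powr_inf:
  assumes "a < -1" "R > 0"
  shows "(\<integral>\<^sup>+r. ennreal (indicator {R..} r * r powr a) \<partial>lborel) = ennreal (- (R powr (a + 1)) / (a + 1))"
  by (rule nn_integral_has_integral_lebesgue) (use assms has_integral_powr_to_inf[of a R] in auto)

lemma nn_integral_powr_Icc:
  assumes "q > 0" "0 < a" "a \<le> b"
  shows "(\<integral>\<^sup>+r. ennreal (q * r powr (- q - 1)) * indicator {a..b} r \<partial>lborel) = ennreal (a powr - q - b powr - q)"
proof -
  have "(\<integral>\<^sup>+r. ennreal (q * r powr (- q - 1)) * indicator {a..b} r \<partial>lborel) = - (b powr - q) - - (a powr - q)"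
    using assms by (intro nn_integral_FTC_Icc) (auto intro!: derivative_eq_intros)
  then show ?thesis by simp
qed

lemma nn_integral_homogeneous_ball:
  fixes Q :: "'a::euclidean_space \<Rightarrow> ennreal"
  assumes [measurable]: "Q \<in> borel_measurable borel"
    and hom: "\<And>c x. c > 0 \<Longrightarrow> Q (c *\<^sub>R x) = Q x" and r: "r > 0"
  shows "(\<integral>\<^sup>+x. Q x * indicator (ball 0 r) x \<partial>lborel) = ennreal (r ^ DIM('a)) * (\<integral>\<^sup>+x. Q x * indicator (ball 0 1) x \<partial>lborel)"
proof -
  have "(\<integral>\<^sup>+x. Q x * indicator (ball 0 r) x \<partial>lborel) = ennreal (r ^ DIM('a)) * (\<integral>\<^sup>+x. Q (r *\<^sub>R x) * indicator (ball 0 r) (r *\<^sub>R x) \<partial>lborel)"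
    using r by (intro nn_integral_lborel_scale) auto
  also have "(\<lambda>x. Q (r *\<^sub>R x) * indicator (ball 0 r) (r *\<^sub>R x)) = (\<lambda>x. Q x * indicator (ball 0 1) x)"
    using r hom by (auto simp: fun_eq_iff indicator_def)
  finally show ?thesis .
qed

text \<open>
  A substitute for polar coordinates. For \<open>0 < \<bar>x\<bar> < R\<close> and \<open>q = n - s\<close>, the weight \<open>\<bar>x\<bar> powr - q\<close> is
  \<open>R powr - q\<close> plus the integral of \<open>q r powr (- q - 1)\<close> over \<open>\<bar>x\<bar> < r < R\<close>. Exchanging the integrals
  reduces the claim to the integrals of \<open>Q\<close> over balls of radius \<open>r\<close>, which scale like \<open>r ^ n\<close>.
\<close>

lemma nn_integral_homogeneous_powr:
  fixes Q :: "'a::euclidean_space \<Rightarrow> ennreal" and s R :: real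
  assumes Q [measurable]: "Q \<in> borel_measurable borel"
    and hom: "\<And>c x. c > 0 \<Longrightarrow> Q (c *\<^sub>R x) = Q x" and R: "R > 0" and s: "0 < s" "s < DIM('a)"
  shows "(\<integral>\<^sup>+x. Q x * ennreal (norm x powr (s - DIM('a))) * indicator (ball 0 R) x \<partial>lborel)
    = ennreal (DIM('a) * R powr s / s) * (\<integral>\<^sup>+x. Q x * indicator (ball 0 1) x \<partial>lborel)"
proof -
  define N where "N = real DIM('a)"
  define q where "q = N - s"
  have q: "q > 0" using s by (simp add: q_def N_def)
  let ?a = "\<integral>\<^sup>+x. Q x * indicator (ball 0 1) x \<partial>lborel"
  have pw: "r ^ DIM('a) = r powr N" if "r > 0" for r
    using that by (simp add: N_def powr_realpow)
  have hb: "(\<integral>\<^sup>+x. Q x * indicator (ball 0 r) x \<partial>lborel) = ennreal (r powr N) * ?a" if "r > 0" for r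
    using nn_integral_homogeneous_ball[OF Q hom that] by (simp only: pw[OF that])
  define k where "k x r = ennreal (q * r powr (- q - 1)) * (if norm x < r \<and> r < R then 1 else 0)" for x :: 'a and r
  have [measurable]: "(\<lambda>(x, r). k x r) \<in> borel_measurable (lborel \<Otimes>\<^sub>M lborel)"
    unfolding k_def by measurable
  have [measurable]: "k x \<in> borel_measurable borel" for x
    unfolding k_def by measurable
  have layer: "ennreal (norm x powr - q) * indicator (ball 0 R) x
      = (ennreal (R powr - q) + (\<integral>\<^sup>+r. k x r \<partial>lborel)) * indicator (ball 0 R) x" if "x \<noteq> 0" for x
  proof (cases "norm x < R")
    case True
    have "(\<integral>\<^sup>+r. k x r \<partial>lborel) = (\<integral>\<^sup>+r. ennreal (q * r powr (- q - 1)) * indicator {norm x..R} r \<partial>lborel)"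
    proof (rule nn_integral_cong_AE, use AE_lborel_singleton[of "norm x"] AE_lborel_singleton[of R] in eventually_elim)
      case (elim r)
      then show ?case by (auto simp: k_def indicator_def)
    qed
    also have "\<dots> = ennreal (norm x powr - q - R powr - q)"
      using that True q by (intro nn_integral_powr_Icc) auto
    finally have "ennreal (R powr - q) + (\<integral>\<^sup>+r. k x r \<partial>lborel) = ennreal (norm x powr - q)"
      using that True q by (simp add: ennreal_plus[symmetric] powr_mono2' del: ennreal_plus)
    then show ?thesis by simp
  qed simp
  have radial: "(\<integral>\<^sup>+x. Q x * k x r * indicator (ball 0 R) x \<partial>lborel)
      = ennreal (q * (indicator {0..R} r * r powr (s - 1))) * ?a" if "r \<noteq> 0" "r \<noteq> R" for r
  proof (cases "0 < r \<and> r < R")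
    case True
    have "(\<integral>\<^sup>+x. Q x * k x r * indicator (ball 0 R) x \<partial>lborel)
       = (\<integral>\<^sup>+x. ennreal (q * r powr (- q - 1)) * (Q x * indicator (ball 0 r) x) \<partial>lborel)"
      using True by (intro nn_integral_cong) (auto simp: k_def indicator_def mult_ac)
    also have "\<dots> = ennreal (q * r powr (- q - 1)) * (ennreal (r powr N) * ?a)"
      using True by (subst nn_integral_cmult, simp, subst hb) auto
    also have "\<dots> = ennreal (q * r powr (- q - 1) * r powr N) * ?a"
      using q by (simp add: ennreal_mult' mult.assoc)
    also have "q * r powr (- q - 1) * r powr N = q * r powr (s - 1)"
      by (simp add: mult.assoc powr_add[symmetric] q_def)
    finally show ?thesis using True by simp
  next
    case False
    then have "k x r = 0" for x
      using that norm_ge_zero[of x] by (auto simp: k_def simp del: norm_ge_zero)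
    moreover have "indicator {0..R} r = (0::real)"
      using False that by (auto simp: indicator_def)
    ultimately show ?thesis by simp
  qed
  have "(\<integral>\<^sup>+x. Q x * ennreal (norm x powr (s - DIM('a))) * indicator (ball 0 R) x \<partial>lborel)
     = (\<integral>\<^sup>+x. ennreal (R powr - q) * (Q x * indicator (ball 0 R) x) + (\<integral>\<^sup>+r. Q x * k x r * indicator (ball 0 R) x \<partial>lborel) \<partial>lborel)"
  proof (rule nn_integral_cong_AE, use AE_lborel_singleton[of "0::'a"] in eventually_elim)
    case (elim x)
    have "Q x * ennreal (norm x powr (s - DIM('a))) * indicator (ball 0 R) x = Q x * (ennreal (norm x powr - q) * indicator (ball 0 R) x)"
      by (simp add: q_def N_def mult.assoc)
    also have "\<dots> = ennreal (R powr - q) * (Q x * indicator (ball 0 R) x) + Q x * indicator (ball 0 R) x * (\<integral>\<^sup>+r. k x r \<partial>lborel)"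
      unfolding layer[OF elim] by (simp add: algebra_simps)
    also have "Q x * indicator (ball 0 R) x * (\<integral>\<^sup>+r. k x r \<partial>lborel) = (\<integral>\<^sup>+r. (Q x * indicator (ball 0 R) x) * k x r \<partial>lborel)"
      by (rule nn_integral_cmult[symmetric]) simp
    finally show ?case by (simp add: mult_ac)
  qed
  also have "\<dots> = ennreal (R powr - q) * (ennreal (R powr N) * ?a)
      + (\<integral>\<^sup>+x. \<integral>\<^sup>+r. Q x * k x r * indicator (ball 0 R) x \<partial>lborel \<partial>lborel)"
    by (subst nn_integral_add, simp, simp, subst nn_integral_cmult, simp, subst hb[OF R], rule refl)
  also have "(\<integral>\<^sup>+x. \<integral>\<^sup>+r. Q x * k x r * indicator (ball 0 R) x \<partial>lborel \<partial>lborel)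
      = (\<integral>\<^sup>+r. \<integral>\<^sup>+x. Q x * k x r * indicator (ball 0 R) x \<partial>lborel \<partial>lborel)"
    by (rule lborel_pair.Fubini'[symmetric]) measurable
  also have "\<dots> = (\<integral>\<^sup>+r. ennreal (q * (indicator {0..R} r * r powr (s - 1))) * ?a \<partial>lborel)"
  proof (rule nn_integral_cong_AE, use AE_lborel_singleton[of "0::real"] AE_lborel_singleton[of R] in eventually_elim)
    case (elim r)
    then show ?case by (rule radial)
  qed
  also have "\<dots> = ennreal q * (\<integral>\<^sup>+r. ennreal (indicator {0..R} r * r powr (s - 1)) \<partial>lborel) * ?a"
    using q by (simp add: nn_integral_multc ennreal_mult' nn_integral_cmult)
  also have "\<dots> = ennreal (q * (R powr s / s)) * ?a"
  proof -
    have "(\<integral>\<^sup>+r. ennreal (indicator {0..R} r * r powr (s - 1)) \<partial>lborel) = ennreal (R powr s / s)"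
      using nn_integral_powr_0[of "s - 1" R] s R by simp
    then show ?thesis using q by (simp only: ennreal_mult'[symmetric] less_imp_le)
  qed
  also have "ennreal (R powr - q) * (ennreal (R powr N) * ?a) = ennreal (R powr s) * ?a"
    by (simp add: mult.assoc[symmetric] ennreal_mult'[symmetric] powr_add[symmetric] q_def)
  also have "ennreal (R powr s) * ?a + ennreal (q * (R powr s / s)) * ?a = ennreal (R powr s + q * (R powr s / s)) * ?a"
    using q s by (simp add: distrib_right)
  also have "R powr s + q * (R powr s / s) = DIM('a) * R powr s / s"
    using s by (simp add: q_def N_def field_simps)
  finally show ?thesis .
qed

text \<open>
  The same layer decomposition of a power of \<open>\<bar>x\<bar>\<close>, now over radii \<open>r > \<bar>x\<bar>\<close> without upper limit.
\<close>

lemma nn_integral_powr_tail_finite: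
  fixes q :: real
  assumes q: "q > DIM('a::euclidean_space)"
  shows "(\<integral>\<^sup>+x. ennreal (norm (x::'a) powr - q) * indicator (- ball 0 1) x \<partial>lborel) < \<infinity>"
proof -
  define N where "N = real DIM('a)"
  have q0: "q > 0" using q by linarith
  let ?v = "\<integral>\<^sup>+(x::'a). 1 * indicator (ball 0 1) x \<partial>lborel"
  have hb: "(\<integral>\<^sup>+(x::'a). 1 * indicator (ball 0 r) x \<partial>lborel) = ennreal (r ^ DIM('a)) * ?v" if "r > 0" for r
    by (rule nn_integral_homogeneous_ball) (use that in auto)
  define k where "k x r = ennreal (q * r powr (- q - 1)) * (if 1 \<le> r \<and> norm x < r then 1 else 0)" for x :: 'a and r
  have [measurable]: "(\<lambda>(x, r). k x r) \<in> borel_measurable (lborel \<Otimes>\<^sub>M lborel)"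
    unfolding k_def by measurable
  have "(\<integral>\<^sup>+x. ennreal (norm (x::'a) powr - q) * indicator (- ball 0 1) x \<partial>lborel) \<le> (\<integral>\<^sup>+x. \<integral>\<^sup>+r. k x r \<partial>lborel \<partial>lborel)"
  proof (rule nn_integral_mono)
    fix x :: 'a
    show "ennreal (norm x powr - q) * indicator (- ball 0 1) x \<le> (\<integral>\<^sup>+r. k x r \<partial>lborel)"
    proof (cases "norm x < 1")
      case False
      have "(\<integral>\<^sup>+r. k x r \<partial>lborel) = (\<integral>\<^sup>+r. ennreal q * ennreal (indicator {norm x..} r * r powr (- q - 1)) \<partial>lborel)"
      proof (rule nn_integral_cong_AE, use AE_lborel_singleton[of "norm x"] in eventually_elim)
        case (elim r)
        then show ?case using False q0 by (auto simp: k_def indicator_def ennreal_mult')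
      qed
      also have "\<dots> = ennreal q * ennreal (- (norm x powr (- q - 1 + 1)) / (- q - 1 + 1))"
        using q0 False by (subst nn_integral_cmult, simp, subst nn_integral_powr_inf) auto
      also have "\<dots> = ennreal (norm x powr - q)"
        using q0 by (simp add: ennreal_mult'[symmetric])
      finally show ?thesis using False by simp
    qed simp
  qed
  also have "\<dots> = (\<integral>\<^sup>+r. \<integral>\<^sup>+x. k x r \<partial>lborel \<partial>lborel)"
    by (rule lborel_pair.Fubini'[symmetric]) measurable
  also have "\<dots> = (\<integral>\<^sup>+r. ennreal q * ennreal (indicator {1..} r * r powr (N - q - 1)) * ?v \<partial>lborel)"
  proof (rule nn_integral_cong)
    fix r :: real
    show "(\<integral>\<^sup>+x. k x r \<partial>lborel) = ennreal q * ennreal (indicator {1..} r * r powr (N - q - 1)) * ?v"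
    proof (cases "r \<ge> 1")
      case True
      have "(\<integral>\<^sup>+x. k x r \<partial>lborel) = (\<integral>\<^sup>+(x::'a). ennreal (q * r powr (- q - 1)) * (1 * indicator (ball 0 r) x) \<partial>lborel)"
        using True by (intro nn_integral_cong) (auto simp: k_def indicator_def)
      also have "\<dots> = ennreal (q * r powr (- q - 1)) * (ennreal (r ^ DIM('a)) * ?v)"
        using True by (subst nn_integral_cmult, simp, subst hb) auto
      also have "\<dots> = ennreal (q * (r powr (- q - 1) * r powr N)) * ?v"
        using True q0 by (simp add: N_def powr_realpow mult.assoc[symmetric] ennreal_mult'[symmetric])
      also have "r powr (- q - 1) * r powr N = r powr (N - q - 1)"
        by (simp add: powr_add[symmetric] algebra_simps)
      finally show ?thesis using True q0 by (simp add: ennreal_mult')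
    qed (simp add: k_def)
  qed
  also have "\<dots> = ennreal q * ennreal (- (1 powr (N - q - 1 + 1)) / (N - q - 1 + 1)) * ?v"
    using q by (subst nn_integral_multc, simp, subst nn_integral_cmult, simp, subst nn_integral_powr_inf) (auto simp: N_def)
  also have "\<dots> < \<infinity>"
    using emeasure_lborel_ball_finite[of "0::'a" 1] by (simp add: ennreal_mult_less_top)
  finally show ?thesis .
qed

text \<open>
  The surface measure is \<open>n\<close> times the image of the volume of the punctured ball under radial
  projection; the centre is a null set.
\<close>

lemma nn_integral_sphere_measure:
  fixes f :: "real^'n::finite \<Rightarrow> ennreal"
  assumes [measurable]: "f \<in> borel_measurable borel"
  shows "(\<integral>\<^sup>+\<omega>. f \<omega> \<partial>sphere_measure) =
    of_nat CARD('n) * (\<integral>\<^sup>+x. f (x /\<^sub>R norm x) * indicator (ball 0 1) x \<partial>lborel)"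
proof -
  let ?B = "ball 0 1 - {0} :: (real^'n) set"
  have [measurable]: "?B \<in> sets borel" by auto
  have meas: "(\<lambda>x. x /\<^sub>R norm x) \<in> restrict_space lborel ?B \<rightarrow>\<^sub>M restrict_space borel (sphere 0 1)"
    by (intro measurable_restrict_space2 measurable_restrict_space1) (auto simp: space_restrict_space)
  have f': "f \<in> borel_measurable (restrict_space borel (sphere 0 1))"
    by (intro measurable_restrict_space1) simp
  have "(\<integral>\<^sup>+\<omega>. f \<omega> \<partial>sphere_measure) = of_nat CARD('n) *
      (\<integral>\<^sup>+\<omega>. f \<omega> \<partial>distr (restrict_space lborel ?B) (restrict_space borel (sphere 0 1)) (\<lambda>x. x /\<^sub>R norm x))"
    unfolding sphere_measure_def using f' by (intro nn_integral_scale_measure) simp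
  also have "(\<integral>\<^sup>+\<omega>. f \<omega> \<partial>distr (restrict_space lborel ?B) (restrict_space borel (sphere 0 1)) (\<lambda>x. x /\<^sub>R norm x))
      = (\<integral>\<^sup>+x. f (x /\<^sub>R norm x) \<partial>restrict_space lborel ?B)"
    using meas f' by (intro nn_integral_distr) simp_all
  also have "\<dots> = (\<integral>\<^sup>+x. f (x /\<^sub>R norm x) * indicator ?B x \<partial>lborel)"
    by (intro nn_integral_restrict_space) simp
  also have "\<dots> = (\<integral>\<^sup>+x. f (x /\<^sub>R norm x) * indicator (ball 0 1) x \<partial>lborel)"
    by (rule nn_integral_cong_AE, use AE_lborel_singleton[of "0::real^'n"] in eventually_elim) (auto simp: indicator_def)
  finally show ?thesis .
qed

lemma K_const_nn_integral:
  fixes \<nu> :: "real^'n::finite"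
  assumes "norm \<nu> = 1" and p: "p \<ge> 0"
  shows "ennreal (K_const p \<nu>) =
    of_nat CARD('n) * (\<integral>\<^sup>+x. ennreal (\<bar>(x /\<^sub>R norm x) \<bullet> \<nu>\<bar> powr p) * indicator (ball 0 1) x \<partial>lborel)"
proof -
  let ?f = "\<lambda>\<omega>. \<bar>\<omega> \<bullet> \<nu>\<bar> powr p"
  have *: "(\<integral>\<^sup>+\<omega>. ennreal (?f \<omega>) \<partial>sphere_measure) =
    of_nat CARD('n) * (\<integral>\<^sup>+x. ennreal (?f (x /\<^sub>R norm x)) * indicator (ball 0 1) x \<partial>lborel)"
    by (rule nn_integral_sphere_measure) simp
  have "(\<integral>\<^sup>+x. ennreal (?f (x /\<^sub>R norm x)) * indicator (ball 0 1) x \<partial>lborel) \<le> (\<integral>\<^sup>+(x::real^'n). 1 * indicator (ball 0 1) x \<partial>lborel)"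
  proof (intro nn_integral_mono mult_right_mono)
    fix x :: "real^'n"
    have "\<bar>(x /\<^sub>R norm x) \<bullet> \<nu>\<bar> \<le> norm (x /\<^sub>R norm x) * norm \<nu>" by (rule Cauchy_Schwarz_ineq2)
    also have "\<dots> \<le> 1" using assms by (cases "x = 0") auto
    finally have "?f (x /\<^sub>R norm x) \<le> 1 powr p" using p by (intro powr_mono2) auto
    then show "ennreal (?f (x /\<^sub>R norm x)) \<le> 1" by simp
  qed simp
  also have "\<dots> < \<infinity>" using emeasure_lborel_ball_finite[of "0::real^'n" 1] by simp
  finally have "(\<integral>\<^sup>+\<omega>. ennreal (?f \<omega>) \<partial>sphere_measure) < \<infinity>"
    unfolding * by (simp add: ennreal_mult_less_top of_nat_less_top)
  moreover have "?f \<in> borel_measurable (restrict_space borel (sphere 0 1))"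
    by (intro measurable_restrict_space1) simp
  then have meas: "?f \<in> borel_measurable sphere_measure"
    by (simp add: sphere_measure_def cong: measurable_cong_sets)
  then have "K_const p \<nu> = enn2real (\<integral>\<^sup>+\<omega>. ennreal (?f \<omega>) \<partial>sphere_measure)"
    unfolding K_const_def by (intro integral_eq_nn_integral) auto
  ultimately show ?thesis
    using * by simp
qed

text \<open>
  A rotation takes the multiple \<open>\<bar>w\<bar> \<nu>\<close> of the reference direction to \<open>w\<close>. This shows in particular
  that \<open>K_const p \<nu>\<close> is the same for all unit vectors.
\<close>

lemma K_const_any_vector:
  fixes \<nu> w :: "real^'n::finite"
  assumes \<nu>: "norm \<nu> = 1" and p: "p \<ge> 1"
  shows "of_nat CARD('n) * (\<integral>\<^sup>+x. ennreal (\<bar>(x /\<^sub>R norm x) \<bullet> w\<bar> powr p) * indicator (ball 0 1) x \<partial>lborel)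
    = ennreal (K_const p \<nu>) * ennreal (norm w powr p)"
proof -
  have "norm w = norm (norm w *\<^sub>R \<nu>)" using \<nu> by simp
  then obtain f where f: "orthogonal_transformation f" "f (norm w *\<^sub>R \<nu>) = w"
    using orthogonal_transformation_exists[of "norm w *\<^sub>R \<nu>" w] by metis
  have w: "(f x /\<^sub>R norm (f x)) \<bullet> w = norm w * ((x /\<^sub>R norm x) \<bullet> \<nu>)" for x
  proof -
    have "f x \<bullet> w = x \<bullet> (norm w *\<^sub>R \<nu>)"
      using f unfolding orthogonal_transformation_def by metis
    then show ?thesis using orthogonal_transformation_norm[OF f(1)] by simp
  qed
  have "(\<integral>\<^sup>+x. ennreal (\<bar>(x /\<^sub>R norm x) \<bullet> w\<bar> powr p) * indicator (ball 0 1) x \<partial>lborel)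
      = (\<integral>\<^sup>+x. ennreal (\<bar>(f x /\<^sub>R norm (f x)) \<bullet> w\<bar> powr p) * indicator (ball 0 1) (f x) \<partial>lborel)"
    by (rule nn_integral_orthogonal_transformation[OF f(1), symmetric]) simp
  also have "\<dots> = (\<integral>\<^sup>+x. ennreal (norm w powr p) * (ennreal (\<bar>(x /\<^sub>R norm x) \<bullet> \<nu>\<bar> powr p) * indicator (ball 0 1) x) \<partial>lborel)"
  proof (rule nn_integral_cong)
    fix x
    have "ennreal (\<bar>(f x /\<^sub>R norm (f x)) \<bullet> w\<bar> powr p) = ennreal (norm w powr p) * ennreal (\<bar>(x /\<^sub>R norm x) \<bullet> \<nu>\<bar> powr p)"
      by (simp only: w abs_mult powr_mult ennreal_mult' powr_ge_zero abs_norm_cancel)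
    moreover have "indicator (ball 0 1) (f x) = (indicator (ball 0 1) x :: ennreal)"
      by (simp add: indicator_def orthogonal_transformation_norm[OF f(1)])
    ultimately show "ennreal (\<bar>(f x /\<^sub>R norm (f x)) \<bullet> w\<bar> powr p) * indicator (ball 0 1) (f x)
        = ennreal (norm w powr p) * (ennreal (\<bar>(x /\<^sub>R norm x) \<bullet> \<nu>\<bar> powr p) * indicator (ball 0 1) x)"
      by (simp only: mult.assoc)
  qed
  also have "\<dots> = ennreal (norm w powr p) * (\<integral>\<^sup>+x. ennreal (\<bar>(x /\<^sub>R norm x) \<bullet> \<nu>\<bar> powr p) * indicator (ball 0 1) x \<partial>lborel)"
    by (rule nn_integral_cmult) simp
  finally show ?thesis
    using p by (simp add: K_const_nn_integral[OF \<nu>] mult_ac)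
qed

section \<open>The limit of the rescaled energy\<close>

context borel_W1p
begin

definition gradient_energy :: ennreal
  where "gradient_energy = (\<integral>\<^sup>+x. ennreal (norm (g x) powr p) \<partial>lborel)"

definition frac_kernel :: "real \<Rightarrow> real^'n \<Rightarrow> ennreal"
  where "frac_kernel \<sigma> h = ennreal (norm h powr - (CARD('n) + p * \<sigma>))"

lemma frac_kernel_measurable [measurable]: "frac_kernel \<sigma> \<in> borel_measurable borel"
  unfolding frac_kernel_def by measurable

text \<open>
  The slope for \<open>h\<close> normalized to unit length, which depends only on the direction of \<open>h\<close>.
\<close>

definition direction_slope :: "real^'n \<Rightarrow> ennreal"
  where "direction_slope h = (\<integral>\<^sup>+x. ennreal (\<bar>(h /\<^sub>R norm h) \<bullet> g x\<bar> powr p) \<partial>lborel)"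

lemma direction_slope_measurable [measurable]: "direction_slope \<in> borel_measurable borel"
  unfolding direction_slope_def by measurable

lemma direction_slope_scale:
  assumes "c > 0"
  shows "direction_slope (c *\<^sub>R h) = direction_slope h"
proof -
  have "inverse (norm (c *\<^sub>R h)) * c = inverse (norm h)"
    using assms by (simp add: field_simps)
  then show ?thesis
    by (simp only: direction_slope_def scaleR_scaleR)
qed

lemma slope_eq: "slope h = direction_slope h * ennreal (norm h powr p)"
proof -
  have "slope h = (\<integral>\<^sup>+x. ennreal (\<bar>(h /\<^sub>R norm h) \<bullet> g x\<bar> powr p) * ennreal (norm h powr p) \<partial>lborel)"
    unfolding slope_def
  proof (rule nn_integral_cong)
    fix x
    have "\<bar>h \<bullet> g x\<bar> = norm h * \<bar>(h /\<^sub>R norm h) \<bullet> g x\<bar>"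
      by (cases "h = 0") (simp_all add: abs_mult)
    then show "ennreal (\<bar>h \<bullet> g x\<bar> powr p) = ennreal (\<bar>(h /\<^sub>R norm h) \<bullet> g x\<bar> powr p) * ennreal (norm h powr p)"
      by (simp only: powr_mult ennreal_mult'[symmetric] powr_ge_zero mult.commute)
  qed
  then show ?thesis by (simp add: direction_slope_def nn_integral_multc)
qed

text \<open>
  The weight left over once the slope is normalized: the exponent \<open>s - n\<close> with
  \<open>s = p (1 - \<sigma>)\<close> is just integrable at the origin, with integral of order \<open>1 / s\<close>.
\<close>

lemma frac_kernel_times_powr: "ennreal (norm h powr p) * frac_kernel \<sigma> h = ennreal (norm h powr (p * (1 - \<sigma>) - CARD('n)))"
  by (simp add: frac_kernel_def ennreal_mult'[symmetric] powr_add[symmetric] algebra_simps)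

text \<open>
  Fubini's theorem: for each point \<open>x\<close>, averaging \<open>\<bar>\<omega> \<bullet> g x\<bar>\<^sup>p\<close> over the directions produces the
  constant \<open>K_const p \<nu>\<close> and the factor \<open>\<bar>g x\<bar>\<^sup>p\<close>.
\<close>

lemma direction_slope_ball:
  fixes \<nu> :: "real^'n"
  assumes \<nu>: "norm \<nu> = 1"
  shows "of_nat CARD('n) * (\<integral>\<^sup>+h. direction_slope h * indicator (ball 0 1) h \<partial>lborel) = ennreal (K_const p \<nu>) * gradient_energy"
proof -
  have "(\<integral>\<^sup>+h. direction_slope h * indicator (ball 0 1) h \<partial>lborel)
      = (\<integral>\<^sup>+h. \<integral>\<^sup>+x. ennreal (\<bar>(h /\<^sub>R norm h) \<bullet> g x\<bar> powr p) * indicator (ball 0 1) h \<partial>lborel \<partial>lborel)"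
    unfolding direction_slope_def by (simp add: nn_integral_multc)
  also have "\<dots> = (\<integral>\<^sup>+x. \<integral>\<^sup>+h. ennreal (\<bar>(h /\<^sub>R norm h) \<bullet> g x\<bar> powr p) * indicator (ball 0 1) h \<partial>lborel \<partial>lborel)"
    by (rule lborel_pair.Fubini'[symmetric]) measurable
  finally have "of_nat CARD('n) * (\<integral>\<^sup>+h. direction_slope h * indicator (ball 0 1) h \<partial>lborel)
      = (\<integral>\<^sup>+x. of_nat CARD('n) * (\<integral>\<^sup>+h. ennreal (\<bar>(h /\<^sub>R norm h) \<bullet> g x\<bar> powr p) * indicator (ball 0 1) h \<partial>lborel) \<partial>lborel)"
    by (simp add: nn_integral_cmult)
  also have "\<dots> = (\<integral>\<^sup>+x. ennreal (K_const p \<nu>) * ennreal (norm (g x) powr p) \<partial>lborel)"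
    by (simp only: K_const_any_vector[OF \<nu> p])
  also have "\<dots> = ennreal (K_const p \<nu>) * gradient_energy"
    by (simp add: gradient_energy_def nn_integral_cmult)
  finally show ?thesis .
qed

lemma slope_ball_integral:
  fixes \<nu> :: "real^'n"
  assumes \<nu>: "norm \<nu> = 1" and R: "R > 0" and s: "0 < p * (1 - \<sigma>)" "p * (1 - \<sigma>) < 1"
  shows "(\<integral>\<^sup>+h. slope h * frac_kernel \<sigma> h * indicator (ball 0 R) h \<partial>lborel)
    = ennreal (R powr (p * (1 - \<sigma>)) / (p * (1 - \<sigma>))) * (ennreal (K_const p \<nu>) * gradient_energy)"
proof -
  let ?s = "p * (1 - \<sigma>)"
  have "real CARD('n) \<ge> 1" by (simp add: Suc_leI)
  then have "?s < CARD('n)" using s(2) by linarith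
  then have sN: "?s < DIM(real^'n)" by simp
  have "(\<integral>\<^sup>+h. slope h * frac_kernel \<sigma> h * indicator (ball 0 R) h \<partial>lborel)
     = (\<integral>\<^sup>+h. direction_slope h * ennreal (norm h powr (?s - DIM(real^'n))) * indicator (ball 0 R) h \<partial>lborel)"
    by (simp only: slope_eq mult.assoc[of "direction_slope _"] frac_kernel_times_powr) simp
  also have "\<dots> = ennreal (DIM(real^'n) * R powr ?s / ?s) * (\<integral>\<^sup>+h. direction_slope h * indicator (ball 0 1) h \<partial>lborel)"
    using sN s R by (intro nn_integral_homogeneous_powr direction_slope_scale) auto
  also have "\<dots> = ennreal (R powr ?s / ?s) * (of_nat CARD('n) * (\<integral>\<^sup>+h. direction_slope h * indicator (ball 0 1) h \<partial>lborel))"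
  proof -
    have "ennreal (DIM(real^'n) * R powr ?s / ?s) = ennreal (R powr ?s / ?s) * of_nat CARD('n)"
      using s by (simp add: ennreal_mult'[symmetric] ennreal_of_nat_eq_real_of_nat mult.commute)
    then show ?thesis by (simp only: mult.assoc)
  qed
  finally show ?thesis by (simp only: direction_slope_ball[OF \<nu>])
qed

lemma powr_ball_integral:
  assumes R: "R > 0" and s: "0 < p * (1 - \<sigma>)" "p * (1 - \<sigma>) < 1"
  shows "(\<integral>\<^sup>+h. ennreal (norm h powr p) * frac_kernel \<sigma> h * indicator (ball 0 R) h \<partial>lborel)
    = ennreal (CARD('n) * R powr (p * (1 - \<sigma>)) / (p * (1 - \<sigma>)) * measure lborel (ball (0::real^'n) 1))"
proof -
  let ?s = "p * (1 - \<sigma>)"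
  have "real CARD('n) \<ge> 1" by (simp add: Suc_leI)
  then have "?s < CARD('n)" using s(2) by linarith
  then have sN: "?s < DIM(real^'n)" by simp
  have "(\<integral>\<^sup>+h. ennreal (norm h powr p) * frac_kernel \<sigma> h * indicator (ball 0 R) h \<partial>lborel)
     = (\<integral>\<^sup>+(h::real^'n). 1 * ennreal (norm h powr (?s - DIM(real^'n))) * indicator (ball 0 R) h \<partial>lborel)"
    by (simp only: frac_kernel_times_powr) simp
  also have "\<dots> = ennreal (DIM(real^'n) * R powr ?s / ?s) * (\<integral>\<^sup>+(h::real^'n). 1 * indicator (ball 0 1) h \<partial>lborel)"
    using sN s R by (intro nn_integral_homogeneous_powr) auto
  also have "(\<integral>\<^sup>+(h::real^'n). 1 * indicator (ball 0 1) h \<partial>lborel) = ennreal (measure lborel (ball (0::real^'n) 1))"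
    using emeasure_lborel_ball_finite[of "0::real^'n" 1] by (simp add: emeasure_eq_ennreal_measure)
  finally show ?thesis using s by (simp add: ennreal_mult'[symmetric])
qed

text \<open>
  Away from the origin the increments are bounded and the kernel is dominated by the one for
  \<open>\<sigma> = 1/2\<close>, which is integrable there. The bound is uniform in \<open>\<sigma>\<close>, so the factor \<open>1 - \<sigma>\<close> removes this
  part in the limit.
\<close>

lemma increment_tail_bounded:
  "\<exists>C::real. \<forall>\<sigma>\<ge>1/2. (\<integral>\<^sup>+h. increment h * frac_kernel \<sigma> h * indicator (- ball 0 1) h \<partial>lborel) \<le> ennreal C"
proof -
  obtain C where C: "\<And>h. increment h \<le> ennreal C" using increment_bounded by blast
  let ?q = "CARD('n) + p * (1/2)"
  let ?T = "\<integral>\<^sup>+(h::real^'n). ennreal (norm h powr - ?q) * indicator (- ball 0 1) h \<partial>lborel"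
  have T: "?T < \<infinity>"
    using p by (intro nn_integral_powr_tail_finite) simp
  have "(\<integral>\<^sup>+h. increment h * frac_kernel \<sigma> h * indicator (- ball 0 1) h \<partial>lborel) \<le> ennreal C * ?T" if \<sigma>: "\<sigma> \<ge> 1/2" for \<sigma>
  proof -
    have "(\<integral>\<^sup>+h. increment h * frac_kernel \<sigma> h * indicator (- ball 0 1) h \<partial>lborel)
      \<le> (\<integral>\<^sup>+(h::real^'n). ennreal C * (ennreal (norm h powr - ?q) * indicator (- ball 0 1) h) \<partial>lborel)"
    proof (rule nn_integral_mono)
      fix h :: "real^'n"
      show "increment h * frac_kernel \<sigma> h * indicator (- ball 0 1) h \<le> ennreal C * (ennreal (norm h powr - ?q) * indicator (- ball 0 1) h)"
      proof (cases "norm h < 1")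
        case False
        have "p * (1/2) \<le> p * \<sigma>" using p \<sigma> by (intro mult_left_mono) auto
        then have "norm h powr - (CARD('n) + p * \<sigma>) \<le> norm h powr - ?q"
          using False by (intro powr_mono) auto
        then have "increment h * frac_kernel \<sigma> h \<le> ennreal C * ennreal (norm h powr - ?q)"
          unfolding frac_kernel_def by (intro mult_mono C ennreal_leI) auto
        then show ?thesis using False by simp
      qed simp
    qed
    also have "\<dots> = ennreal C * ?T" by (rule nn_integral_cmult) simp
    finally show ?thesis .
  qed
  moreover obtain D where "ennreal C * ?T = ennreal D"
    using T by (cases "ennreal C * ?T") (auto simp: ennreal_mult_eq_top_iff)
  ultimately show ?thesis by metis
qed

text \<open>
  The Gagliardo double integral after the substitution \<open>y = x + h\<close>.
\<close>

definition energy :: "real \<Rightarrow> ennreal"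
  where "energy \<sigma> = (\<integral>\<^sup>+h. increment h * frac_kernel \<sigma> h \<partial>lborel)"

lemma energy_upper_bound:
  fixes \<nu> :: "real^'n"
  assumes \<nu>: "norm \<nu> = 1"
  shows "\<exists>C::real. C \<ge> 0 \<and> (\<forall>\<sigma>. 1/2 \<le> \<sigma> \<and> 0 < p * (1 - \<sigma>) \<and> p * (1 - \<sigma>) < 1 \<longrightarrow>
    energy \<sigma> \<le> ennreal (1 / (p * (1 - \<sigma>))) * (ennreal (K_const p \<nu>) * gradient_energy) + ennreal C)"
proof -
  obtain C where C: "\<And>\<sigma>. \<sigma> \<ge> 1/2 \<Longrightarrow> (\<integral>\<^sup>+h. increment h * frac_kernel \<sigma> h * indicator (- ball 0 1) h \<partial>lborel) \<le> ennreal C"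
    using increment_tail_bounded by blast
  have "energy \<sigma> \<le> ennreal (1 / (p * (1 - \<sigma>))) * (ennreal (K_const p \<nu>) * gradient_energy) + ennreal (max 0 C)"
    if \<sigma>: "1/2 \<le> \<sigma>" "0 < p * (1 - \<sigma>)" "p * (1 - \<sigma>) < 1" for \<sigma>
  proof -
    have "energy \<sigma> = (\<integral>\<^sup>+h. increment h * frac_kernel \<sigma> h * indicator (ball 0 1) h + increment h * frac_kernel \<sigma> h * indicator (- ball 0 1) h \<partial>lborel)"
      unfolding energy_def by (intro nn_integral_cong) (auto simp: indicator_def)
    also have "\<dots> = (\<integral>\<^sup>+h. increment h * frac_kernel \<sigma> h * indicator (ball 0 1) h \<partial>lborel)
        + (\<integral>\<^sup>+h. increment h * frac_kernel \<sigma> h * indicator (- ball 0 1) h \<partial>lborel)"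
      by (rule nn_integral_add) auto
    also have "\<dots> \<le> (\<integral>\<^sup>+h. slope h * frac_kernel \<sigma> h * indicator (ball 0 1) h \<partial>lborel) + ennreal (max 0 C)"
    proof (rule add_mono)
      show "(\<integral>\<^sup>+h. increment h * frac_kernel \<sigma> h * indicator (ball 0 1) h \<partial>lborel) \<le> (\<integral>\<^sup>+h. slope h * frac_kernel \<sigma> h * indicator (ball 0 1) h \<partial>lborel)"
        by (intro nn_integral_mono mult_right_mono increment_le_slope) auto
      show "(\<integral>\<^sup>+h. increment h * frac_kernel \<sigma> h * indicator (- ball 0 1) h \<partial>lborel) \<le> ennreal (max 0 C)"
        by (rule order_trans[OF C[OF \<sigma>(1)]]) (simp add: ennreal_leI)
    qed
    finally show ?thesis
      by (simp only: slope_ball_integral[OF \<nu> zero_less_one \<sigma>(2,3)] powr_one_eq_one)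
  qed
  then show ?thesis by (intro exI[of _ "max 0 C"]) auto
qed

lemma energy_lower_bound:
  fixes \<nu> :: "real^'n"
  assumes \<nu>: "norm \<nu> = 1" and t: "0 < t" "t < 1" and e: "e > 0"
  obtains d where "0 < d"
    "\<And>\<sigma>. 0 < p * (1 - \<sigma>) \<Longrightarrow> p * (1 - \<sigma>) < 1 \<Longrightarrow>
      ennreal (d powr (p * (1 - \<sigma>)) / (p * (1 - \<sigma>))) * (ennreal (K_const p \<nu>) * gradient_energy)
        \<le> ennreal (t powr (1 - p)) * energy \<sigma> +
          ennreal (e * (CARD('n) * d powr (p * (1 - \<sigma>)) / (p * (1 - \<sigma>)) * measure lborel (ball (0::real^'n) 1)))"
proof -
  obtain d where d: "d > 0"
    "\<And>h. norm h < d \<Longrightarrow> slope h \<le> ennreal (t powr (1 - p)) * increment h + ennreal e * ennreal (norm h powr p)"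
    by (rule slope_le_increment[OF t e]) (rule that)
  show ?thesis
  proof
    fix \<sigma> assume \<sigma>: "0 < p * (1 - \<sigma>)" "p * (1 - \<sigma>) < 1"
    have "(\<integral>\<^sup>+h. slope h * frac_kernel \<sigma> h * indicator (ball 0 d) h \<partial>lborel)
      \<le> (\<integral>\<^sup>+h. ennreal (t powr (1 - p)) * (increment h * frac_kernel \<sigma> h)
           + ennreal e * (ennreal (norm h powr p) * frac_kernel \<sigma> h * indicator (ball 0 d) h) \<partial>lborel)"
    proof (rule nn_integral_mono)
      fix h :: "real^'n"
      show "slope h * frac_kernel \<sigma> h * indicator (ball 0 d) h \<le> ennreal (t powr (1 - p)) * (increment h * frac_kernel \<sigma> h)
           + ennreal e * (ennreal (norm h powr p) * frac_kernel \<sigma> h * indicator (ball 0 d) h)"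
      proof (cases "norm h < d")
        case True
        have "slope h * frac_kernel \<sigma> h \<le> (ennreal (t powr (1 - p)) * increment h + ennreal e * ennreal (norm h powr p)) * frac_kernel \<sigma> h"
          by (intro mult_right_mono d(2) True) simp
        then show ?thesis using True by (simp add: distrib_right mult.assoc)
      qed simp
    qed
    also have "\<dots> = ennreal (t powr (1 - p)) * energy \<sigma>
        + ennreal e * (\<integral>\<^sup>+h. ennreal (norm h powr p) * frac_kernel \<sigma> h * indicator (ball 0 d) h \<partial>lborel)"
      unfolding energy_def by (subst nn_integral_add) (auto simp: nn_integral_cmult)
    finally show "ennreal (d powr (p * (1 - \<sigma>)) / (p * (1 - \<sigma>))) * (ennreal (K_const p \<nu>) * gradient_energy)
        \<le> ennreal (t powr (1 - p)) * energy \<sigma> +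
          ennreal (e * (CARD('n) * d powr (p * (1 - \<sigma>)) / (p * (1 - \<sigma>)) * measure lborel (ball (0::real^'n) 1)))"
      using e by (simp only: slope_ball_integral[OF \<nu> d(1) \<sigma>] powr_ball_integral[OF d(1) \<sigma>] ennreal_mult'[symmetric] less_imp_le)
  qed (use d in simp)
qed

text \<open>
  Multiplied by \<open>1 - \<sigma>\<close>, the radial factor \<open>1 / (p (1 - \<sigma>))\<close> becomes \<open>1 / p\<close>, and the remaining terms
  of the upper bound vanish in the limit. In the lower bound both the factor \<open>t\<close>, taken to be \<open>1 - e\<close>, and
  the error \<open>e\<close> are fixed before \<open>\<sigma>\<close> tends to \<open>1\<close>; they can be chosen so that the limit of the bound is
  as close to the upper bound as desired.
\<close>

theorem energy_limit:
  fixes \<nu> :: "real^'n"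
  assumes \<nu>: "norm \<nu> = 1"
  shows "((\<lambda>\<sigma>. ennreal (1 - \<sigma>) * energy \<sigma>) \<longlongrightarrow> ennreal (1 / p) * (ennreal (K_const p \<nu>) * gradient_energy)) (at_left 1)"
proof -
  obtain G where G: "gradient_energy = ennreal G" "G \<ge> 0"
    using g_Lp unfolding gradient_energy_def[symmetric] by (cases gradient_energy) auto
  define K where "K = K_const p \<nu>"
  have K: "K \<ge> 0" unfolding K_def K_const_def by (intro integral_nonneg_AE) auto
  define A where "A = K * G / p"
  have A: "A \<ge> 0" using K G p by (simp add: A_def)
  have KG: "ennreal (K_const p \<nu>) * gradient_energy = ennreal (K * G)"
    using K G by (simp add: K_def ennreal_mult)
  \<comment> \<open>\<open>V\<close> is the rescaled limit of the integral of \<open>\<bar>h\<bar>\<^sup>p\<close> against the kernel over a ball\<close>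
  define V where "V = CARD('n) * measure lborel (ball (0::real^'n) 1) / p"
  define scaled where "scaled \<sigma> = enn2real (ennreal (1 - \<sigma>) * energy \<sigma>)" for \<sigma>
  obtain C where C: "C \<ge> 0" "\<And>\<sigma>. 1/2 \<le> \<sigma> \<Longrightarrow> 0 < p * (1 - \<sigma>) \<Longrightarrow> p * (1 - \<sigma>) < 1 \<Longrightarrow>
      energy \<sigma> \<le> ennreal (1 / (p * (1 - \<sigma>))) * ennreal (K * G) + ennreal C"
    using energy_upper_bound[OF \<nu>] unfolding KG by blast
  \<comment> \<open>on this left neighbourhood of \<open>1\<close> the radial formula holds, since \<open>p (1 - \<sigma>) < 1 \<le> n\<close>, and the tail bound is uniform\<close>
  define good where "good \<sigma> \<longleftrightarrow> 1/2 \<le> \<sigma> \<and> \<sigma> < 1 \<and> p * (1 - \<sigma>) < 1" for \<sigma>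
  have ev_good: "eventually good (at_left 1)"
  proof -
    have "eventually (\<lambda>\<sigma>. \<sigma> \<in> {max (1/2) (1 - 1 / p)<..<1}) (at_left (1::real))"
      by (intro eventually_at_leftI[of "max (1/2) (1 - 1 / p)" 1]) (use p in auto)
    then show ?thesis
    proof eventually_elim
      case (elim \<sigma>)
      then have "1 - \<sigma> < 1 / p" by auto
      then have "p * (1 - \<sigma>) < 1" using p by (simp add: field_simps)
      with elim show ?case by (auto simp: good_def)
    qed
  qed
  have good_pos: "0 < p * (1 - \<sigma>)" if "good \<sigma>" for \<sigma> using that p by (simp add: good_def)
  have le: "ennreal (1 - \<sigma>) * energy \<sigma> \<le> ennreal (A + (1 - \<sigma>) * C)" if \<sigma>: "good \<sigma>" for \<sigma>
  proof -
    have "ennreal (1 - \<sigma>) * energy \<sigma> \<le> ennreal (1 - \<sigma>) * (ennreal (1 / (p * (1 - \<sigma>))) * ennreal (K * G) + ennreal C)"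
      using \<sigma> good_pos[OF \<sigma>] by (intro mult_left_mono C(2)) (auto simp: good_def)
    also have "ennreal (1 / (p * (1 - \<sigma>))) * ennreal (K * G) + ennreal C = ennreal (1 / (p * (1 - \<sigma>)) * (K * G) + C)"
      using K G C(1) good_pos[OF \<sigma>] by (simp add: ennreal_mult'[symmetric])
    also have "ennreal (1 - \<sigma>) * \<dots> = ennreal ((1 - \<sigma>) * (1 / (p * (1 - \<sigma>)) * (K * G) + C))"
      using \<sigma> by (simp add: ennreal_mult' good_def)
    also have "(1 - \<sigma>) * (1 / (p * (1 - \<sigma>)) * (K * G) + C) = A + (1 - \<sigma>) * C"
      using \<sigma> p by (simp add: A_def good_def field_simps)
    finally show ?thesis .
  qed
  have scaled: "ennreal (1 - \<sigma>) * energy \<sigma> = ennreal (scaled \<sigma>)" if "good \<sigma>" for \<sigma>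
    using le[OF that] unfolding scaled_def by (intro ennreal_enn2real[symmetric]) (auto simp: less_top[symmetric] top_unique)
  have scaled0: "scaled \<sigma> \<ge> 0" for \<sigma> by (simp add: scaled_def)
  have upper: "scaled \<sigma> \<le> A + (1 - \<sigma>) * C" if \<sigma>: "good \<sigma>" for \<sigma>
  proof -
    have "A + (1 - \<sigma>) * C \<ge> 0" using \<sigma> A C(1) by (simp add: good_def)
    then show ?thesis using le[OF \<sigma>] unfolding scaled[OF \<sigma>] by simp
  qed
  have lower: "\<exists>d>0. \<forall>\<sigma>. good \<sigma> \<longrightarrow> (1 - e) powr (p - 1) * (d powr (p * (1 - \<sigma>)) * (A - e * V)) \<le> scaled \<sigma>"
    if e: "0 < e" "e < 1" for e
  proof -
    from e have t: "0 < 1 - e" "1 - e < 1" by auto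
    obtain d where d: "0 < d"
      "\<And>\<sigma>. 0 < p * (1 - \<sigma>) \<Longrightarrow> p * (1 - \<sigma>) < 1 \<Longrightarrow>
      ennreal (d powr (p * (1 - \<sigma>)) / (p * (1 - \<sigma>))) * ennreal (K * G)
        \<le> ennreal ((1 - e) powr (1 - p)) * energy \<sigma> +
          ennreal (e * (CARD('n) * d powr (p * (1 - \<sigma>)) / (p * (1 - \<sigma>)) * measure lborel (ball (0::real^'n) 1)))"
      using energy_lower_bound[OF \<nu> t e(1)] unfolding KG by metis
    have "(1 - e) powr (p - 1) * (d powr (p * (1 - \<sigma>)) * (A - e * V)) \<le> scaled \<sigma>" if \<sigma>: "good \<sigma>" for \<sigma>
    proof -
      let ?D = "d powr (p * (1 - \<sigma>))" and ?s = "p * (1 - \<sigma>)" and ?m = "measure lborel (ball (0::real^'n) 1)"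
      have s: "?s > 0" "1 - \<sigma> > 0" using \<sigma> good_pos[OF \<sigma>] by (auto simp: good_def)
      have "r > 0 \<Longrightarrow> ?D * (K * G / p) = r * (?D / (p * r) * (K * G))" for r
        by simp
      then have "?D * A = (1 - \<sigma>) * (?D / ?s * (K * G))"
        unfolding A_def using s(2) by blast
      then have "ennreal (?D * A) = ennreal (1 - \<sigma>) * (ennreal (?D / ?s) * ennreal (K * G))"
        using s K G p by (simp add: ennreal_mult'[symmetric])
      also have "\<dots> \<le> ennreal (1 - \<sigma>) * (ennreal ((1 - e) powr (1 - p)) * energy \<sigma> + ennreal (e * (CARD('n) * ?D / ?s * ?m)))"
        using \<sigma> s by (intro mult_left_mono d(2)) (auto simp: good_def)
      also have "\<dots> = ennreal ((1 - e) powr (1 - p)) * (ennreal (1 - \<sigma>) * energy \<sigma>) + ennreal (1 - \<sigma>) * ennreal (e * (CARD('n) * ?D / ?s * ?m))"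
        by (simp add: distrib_left mult_ac)
      also have "ennreal (1 - \<sigma>) * ennreal (e * (CARD('n) * ?D / ?s * ?m)) = ennreal (?D * (e * V))"
      proof -
        have "r > 0 \<Longrightarrow> r * (e * (CARD('n) * ?D / (p * r) * ?m)) = ?D * (e * (CARD('n) * ?m / p))" for r
          by simp
        then have "(1 - \<sigma>) * (e * (CARD('n) * ?D / ?s * ?m)) = ?D * (e * V)"
          unfolding V_def using s(2) by blast
        then show ?thesis using s by (simp only: ennreal_mult'[symmetric] less_imp_le)
      qed
      also have "ennreal ((1 - e) powr (1 - p)) * (ennreal (1 - \<sigma>) * energy \<sigma>) + ennreal (?D * (e * V))
         = ennreal ((1 - e) powr (1 - p) * scaled \<sigma> + ?D * (e * V))"
        unfolding scaled[OF \<sigma>] using scaled0 e p by (simp add: ennreal_mult'[symmetric] ennreal_plus[symmetric] V_def del: ennreal_plus)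
      finally have "?D * A \<le> (1 - e) powr (1 - p) * scaled \<sigma> + ?D * (e * V)"
        using scaled0 e p by (subst (asm) ennreal_le_iff) (auto simp: V_def intro!: add_nonneg_nonneg)
      then have "?D * (A - e * V) \<le> (1 - e) powr (1 - p) * scaled \<sigma>" by (simp add: algebra_simps)
      then have "(1 - e) powr (p - 1) * (?D * (A - e * V)) \<le> (1 - e) powr (p - 1) * ((1 - e) powr (1 - p) * scaled \<sigma>)"
        by (intro mult_left_mono) auto
      also have "\<dots> = scaled \<sigma>" using e by (simp add: mult.assoc[symmetric] powr_add[symmetric])
      finally show ?thesis .
    qed
    then show ?thesis using d(1) by blast
  qed
  have "(scaled \<longlongrightarrow> A) (at_left 1)"
  proof (rule order_tendstoI)
    fix a assume a: "a < A"
    have "((\<lambda>e. (1 - e) powr (p - 1) * (A - e * V)) \<longlongrightarrow> (1 - 0) powr (p - 1) * (A - 0 * V)) (at_right 0)"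
      by (intro tendsto_intros) auto
    then have "eventually (\<lambda>e. a < (1 - e) powr (p - 1) * (A - e * V)) (at_right 0)"
      using a by (intro order_tendstoD(1)) auto
    moreover have "eventually (\<lambda>e. e \<in> {0<..<1}) (at_right (0::real))"
      by (intro eventually_at_rightI[of 0 1]) auto
    ultimately have "eventually (\<lambda>e. a < (1 - e) powr (p - 1) * (A - e * V) \<and> e \<in> {0<..<1}) (at_right 0)"
      by (rule eventually_conj)
    then obtain e where e: "a < (1 - e) powr (p - 1) * (A - e * V)" "0 < e" "e < 1"
      using eventually_happens'[OF trivial_limit_at_right_real] by force
    obtain d where d: "d > 0" "\<And>\<sigma>. good \<sigma> \<Longrightarrow> (1 - e) powr (p - 1) * (d powr (p * (1 - \<sigma>)) * (A - e * V)) \<le> scaled \<sigma>"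
      using lower[OF e(2,3)] by blast
    have "((\<lambda>\<sigma>. (1 - e) powr (p - 1) * (d powr (p * (1 - \<sigma>)) * (A - e * V))) \<longlongrightarrow>
        (1 - e) powr (p - 1) * (d powr (p * (1 - 1)) * (A - e * V))) (at_left 1)"
      using d(1) by (intro tendsto_intros) auto
    then have "eventually (\<lambda>\<sigma>. a < (1 - e) powr (p - 1) * (d powr (p * (1 - \<sigma>)) * (A - e * V))) (at_left 1)"
      using e(1) d(1) by (intro order_tendstoD(1)) auto
    then show "eventually (\<lambda>\<sigma>. a < scaled \<sigma>) (at_left 1)"
      using ev_good
    proof eventually_elim
      case (elim \<sigma>)
      then show ?case using d(2)[of \<sigma>] by linarith
    qed
  next
    fix a assume a: "A < a"
    have "((\<lambda>\<sigma>. A + (1 - \<sigma>) * C) \<longlongrightarrow> A + (1 - 1) * C) (at_left 1)"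
      by (intro tendsto_intros)
    then have "eventually (\<lambda>\<sigma>. A + (1 - \<sigma>) * C < a) (at_left 1)"
      using a by (intro order_tendstoD(2)) auto
    then show "eventually (\<lambda>\<sigma>. scaled \<sigma> < a) (at_left 1)"
      using ev_good
    proof eventually_elim
      case (elim \<sigma>)
      then show ?case using upper[of \<sigma>] by linarith
    qed
  qed
  then have "((\<lambda>\<sigma>. ennreal (scaled \<sigma>)) \<longlongrightarrow> ennreal A) (at_left 1)"
    by (rule tendsto_ennrealI)
  moreover have "eventually (\<lambda>\<sigma>. ennreal (scaled \<sigma>) = ennreal (1 - \<sigma>) * energy \<sigma>) (at_left 1)"
    using ev_good by eventually_elim (simp add: scaled)
  ultimately have "((\<lambda>\<sigma>. ennreal (1 - \<sigma>) * energy \<sigma>) \<longlongrightarrow> ennreal A) (at_left 1)"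
    by (rule Lim_transform_eventually)
  moreover have "ennreal A = ennreal (1 / p) * (ennreal (K_const p \<nu>) * gradient_energy)"
    unfolding KG using p K G by (simp add: A_def ennreal_mult'[symmetric])
  ultimately show ?thesis by simp
qed

end

section \<open>Uniqueness and composition of weak derivatives\<close>

lemma borel_representative:
  fixes w :: "real^'n::finite \<Rightarrow> real"
  assumes "w \<in> borel_measurable lebesgue"
  obtains w' where "w' \<in> borel_measurable borel" "AE x in lebesgue. w x = w' x"
proof -
  obtain w' where "w' \<in> borel_measurable lborel" "AE x in lborel. w x = w' x"
    using completion_ex_borel_measurable_real[OF assms] by blast
  then show ?thesis
    using that[of w'] by (simp add: AE_completion)
qed

lemma integral_representative:
  fixes w w' :: "real^'n::finite \<Rightarrow> real"
  assumes "w \<in> borel_measurable lebesgue" "w' \<in> borel_measurable borel" "AE x in lebesgue. w x = w' x"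
    and "\<phi> \<in> borel_measurable borel"
  shows "(LINT x|lebesgue. w x * \<phi> x) = (LINT x|lborel. w' x * \<phi> x)"
proof -
  have [measurable]: "\<phi> \<in> borel_measurable lebesgue" "w' \<in> borel_measurable lebesgue"
    using assms by (auto intro: measurable_completion)
  note [measurable] = assms(1)
  have "(LINT x|lebesgue. w x * \<phi> x) = (LINT x|lebesgue. w' x * \<phi> x)"
    by (rule integral_cong_AE, measurable, use assms(3) in eventually_elim) simp
  also have "\<dots> = (LINT x|lborel. w' x * \<phi> x)"
    using assms by (intro integral_completion) simp
  finally show ?thesis .
qed

text \<open>
  The function is the pointwise limit of its restrictions to balls.
\<close>

lemma locally_integrable_measurable:
  fixes w :: "real^'n::finite \<Rightarrow> real"
  assumes "locally_integrable w"
  shows "w \<in> borel_measurable lebesgue"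
proof (rule borel_measurable_LIMSEQ_real)
  have "set_integrable lebesgue (cball 0 (real n)) w" for n
    using assms by (simp add: locally_integrable_def)
  then show "(\<lambda>x. indicator (cball 0 (real n)) x *\<^sub>R w x) \<in> borel_measurable lebesgue" for n
    by (auto simp: set_integrable_def)
  fix x :: "real^'n"
  obtain n where n: "norm x \<le> real n" using real_arch_simple by blast
  then have "\<forall>\<^sub>F m in sequentially. indicator (cball 0 (real m)) x *\<^sub>R w x = w x"
    unfolding eventually_sequentially by (intro exI[of _ n]) auto
  then show "(\<lambda>m. indicator (cball 0 (real m)) x *\<^sub>R w x) \<longlonglongrightarrow> w x"
    by (rule tendsto_eventually)
qed

lemma locally_integrable_diff:
  "locally_integrable w1 \<Longrightarrow> locally_integrable w2 \<Longrightarrow> locally_integrable (\<lambda>x. w1 x - w2 x)"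
  unfolding locally_integrable_def by (auto intro: set_integral_diff)

lemma locally_integrable_times_test:
  assumes w: "locally_integrable w" and \<phi>: "test_function \<phi>"
  shows "integrable lebesgue (\<lambda>x. w x * \<phi> x)"
proof -
  have [measurable]: "w \<in> borel_measurable lebesgue" using w by (rule locally_integrable_measurable)
  have [measurable]: "\<phi> \<in> borel_measurable lebesgue"
    using test_function_measurable[OF \<phi>] by (auto intro: measurable_completion)
  obtain C R where CR: "C \<ge> 0" "\<And>x. \<bar>\<phi> x\<bar> \<le> C" "\<And>x. norm x > R \<Longrightarrow> \<phi> x = 0"
    using test_function_bounds[OF \<phi>] by metis
  have "set_integrable lebesgue (cball 0 R) w"
    using w by (simp add: locally_integrable_def)
  then have "integrable lebesgue (\<lambda>x. C * \<bar>indicator (cball 0 R) x *\<^sub>R w x\<bar>)"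
    unfolding set_integrable_def by (intro integrable_mult_right integrable_abs)
  then show ?thesis
  proof (rule Bochner_Integration.integrable_bound)
    show "AE x in lebesgue. norm (w x * \<phi> x) \<le> norm (C * \<bar>indicator (cball 0 R) x *\<^sub>R w x\<bar>)"
    proof (rule AE_I2)
      fix x
      show "norm (w x * \<phi> x) \<le> norm (C * \<bar>indicator (cball 0 R) x *\<^sub>R w x\<bar>)"
      proof (cases "norm x > R")
        case False
        then show ?thesis using CR(1) mult_left_mono[OF CR(2)[of x], of "\<bar>w x\<bar>"] by (simp add: abs_mult mult.commute)
      qed (simp add: CR)
    qed
  qed simp
qed

text \<open>
  Apply the fundamental lemma to a Borel representative of the difference.
\<close>

lemma has_weak_deriv_unique:
  assumes 1: "has_weak_deriv \<alpha> v w1" and 2: "has_weak_deriv \<alpha> v w2"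
  shows "AE x in lebesgue. w1 x = w2 x"
proof -
  define w where "w x = w1 x - w2 x" for x
  have l: "locally_integrable w1" "locally_integrable w2"
    using 1 2 by (auto simp: has_weak_deriv_def)
  have w: "locally_integrable w"
    unfolding w_def using l by (rule locally_integrable_diff)
  obtain w' where w': "w' \<in> borel_measurable borel" "AE x in lebesgue. w x = w' x"
    by (rule borel_representative[OF locally_integrable_measurable[OF w]]) (rule that)
  note [measurable] = w'(1)
  have "AE x in lborel. w' x = 0"
  proof (rule fundamental_lemma[OF w'(1)])
    fix a b :: "real^'a"
    have "set_integrable lebesgue (cbox a b) w"
      using w by (simp add: locally_integrable_def)
    then have "integrable lebesgue (\<lambda>x. indicator (cbox a b) x *\<^sub>R w x)"
      unfolding set_integrable_def .
    then have "integrable lebesgue (\<lambda>x. indicator (cbox a b) x * w' x)"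
    proof (rule integrable_cong_AE_imp)
      show "(\<lambda>x. indicator (cbox a b) x * w' x) \<in> borel_measurable lebesgue"
        by (intro measurable_completion) simp
      show "AE x in lebesgue. indicator (cbox a b) x *\<^sub>R w x = indicator (cbox a b) x * w' x"
        using w'(2) by eventually_elim simp
    qed
    then show "integrable lborel (\<lambda>x. indicator (cbox a b) x * w' x)"
      by (subst (asm) integrable_completion) auto
  next
    fix \<phi> :: "real^'a \<Rightarrow> real" assume \<phi>: "test_function \<phi>"
    have "(LINT x|lborel. w' x * \<phi> x) = (LINT x|lebesgue. w x * \<phi> x)"
      by (intro integral_representative[symmetric] locally_integrable_measurable w w' test_function_measurable \<phi>)
    also have "\<dots> = (LINT x|lebesgue. w1 x * \<phi> x) - (LINT x|lebesgue. w2 x * \<phi> x)"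
      unfolding w_def left_diff_distrib
      by (intro Bochner_Integration.integral_diff locally_integrable_times_test l \<phi>)
    also have "\<dots> = 0"
    proof -
      have "(- 1) ^ mi_order \<alpha> * (LINT x|lebesgue. w1 x * \<phi> x) = (- 1) ^ mi_order \<alpha> * (LINT x|lebesgue. w2 x * \<phi> x)"
        using 1 2 \<phi> unfolding has_weak_deriv_def by metis
      then show ?thesis by simp
    qed
    finally show "(LINT x|lborel. w' x * \<phi> x) = 0" .
  qed
  then have "AE x in lebesgue. w' x = 0" by (rule AE_completion)
  with w'(2) show ?thesis
    by eventually_elim (simp add: w_def)
qed

text \<open>
  Partial derivatives of test functions are test functions, and the order of differentiation is
  immaterial, so the definition for \<open>\<alpha>\<close> can be tested with \<open>partial_deriv i \<phi>\<close> and compared with the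
  definition for \<open>\<alpha> + e\<^sub>i\<close>.
\<close>

lemma has_weak_deriv_compose:
  assumes \<alpha>: "has_weak_deriv \<alpha> v u" and \<beta>: "has_weak_deriv (\<lambda>k. \<alpha> k + mi_unit i k) v w"
  shows "has_weak_deriv (mi_unit i) u w"
  unfolding has_weak_deriv_def
proof (intro conjI allI impI)
  show "locally_integrable u" "locally_integrable w"
    using \<alpha> \<beta> by (auto simp: has_weak_deriv_def)
  fix \<phi> :: "real^'a \<Rightarrow> real" assume \<phi>: "test_function \<phi>"
  then have sm: "smooth \<phi>" by (simp add: test_function_def)
  have "(- 1) ^ mi_order \<alpha> * (LINT x|lebesgue. u x * partial_deriv i \<phi> x)
      = (LINT x|lebesgue. v x * classical_deriv \<alpha> (partial_deriv i \<phi>) x)"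
    using \<alpha> test_function_partial_deriv[OF \<phi>] by (simp add: has_weak_deriv_def)
  also have "\<dots> = (- 1) ^ (mi_order \<alpha> + 1) * (LINT x|lebesgue. w x * \<phi> x)"
    using \<beta> \<phi> by (simp add: classical_deriv_partial_deriv[OF sm] has_weak_deriv_def mi_order_add_unit)
  also have "\<dots> = (- 1) ^ mi_order \<alpha> * - (LINT x|lebesgue. w x * \<phi> x)"
    by simp
  finally have "(LINT x|lebesgue. u x * partial_deriv i \<phi> x) = - (LINT x|lebesgue. w x * \<phi> x)"
    by (subst (asm) mult_cancel_left) simp
  then show "(LINT x|lebesgue. u x * classical_deriv (mi_unit i) \<phi> x) = (- 1) ^ mi_order (mi_unit i) * (LINT x|lebesgue. w x * \<phi> x)"
    by (simp add: classical_deriv_mi_unit[OF sm] mi_order_unit)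
qed

text \<open>
  The chosen representative agrees almost everywhere with any other weak derivative, so it
  inherits integrability from \<open>w\<close>.
\<close>

lemma weak_deriv_in_Lp:
  assumes w: "w \<in> Lp p" "has_weak_deriv \<alpha> v w"
  shows "has_weak_deriv \<alpha> v (weak_deriv \<alpha> v)" "weak_deriv \<alpha> v \<in> Lp p"
proof -
  show D: "has_weak_deriv \<alpha> v (weak_deriv \<alpha> v)"
    unfolding weak_deriv_def using w(2) by (rule someI[of "has_weak_deriv \<alpha> v"])
  have AE: "AE x in lebesgue. w x = weak_deriv \<alpha> v x"
    using w(2) D by (rule has_weak_deriv_unique)
  have meas: "weak_deriv \<alpha> v \<in> borel_measurable lebesgue"
    using D by (intro locally_integrable_measurable) (simp add: has_weak_deriv_def)
  moreover have "integrable lebesgue (\<lambda>x. \<bar>weak_deriv \<alpha> v x\<bar> powr p)"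
  proof (rule integrable_cong_AE_imp)
    show "integrable lebesgue (\<lambda>x. \<bar>w x\<bar> powr p)" using w(1) by (simp add: Lp_def)
    show "(\<lambda>x. \<bar>weak_deriv \<alpha> v x\<bar> powr p) \<in> borel_measurable lebesgue" using meas by measurable
    show "AE x in lebesgue. \<bar>w x\<bar> powr p = \<bar>weak_deriv \<alpha> v x\<bar> powr p"
      using AE by eventually_elim simp
  qed
  ultimately show "weak_deriv \<alpha> v \<in> Lp p" by (simp add: Lp_def)
qed

lemma weak_deriv_of_sobolev:
  assumes v: "v \<in> sobolev (l + 1) p" and \<alpha>: "mi_order \<alpha> = l"
  shows "weak_deriv \<alpha> v \<in> Lp p"
    and "has_weak_deriv (mi_unit i) (weak_deriv \<alpha> v) (weak_deriv (mi_unit i) (weak_deriv \<alpha> v))"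
    and "weak_deriv (mi_unit i) (weak_deriv \<alpha> v) \<in> Lp p"
proof -
  have ex: "\<exists>w\<in>Lp p. has_weak_deriv \<beta> v w" if "mi_order \<beta> \<le> l + 1" for \<beta>
    using v that by (simp add: sobolev_def)
  obtain w where "w \<in> Lp p" "has_weak_deriv \<alpha> v w"
    using ex[of \<alpha>] \<alpha> by auto
  note \<alpha>v = weak_deriv_in_Lp[OF this]
  then show "weak_deriv \<alpha> v \<in> Lp p" by simp
  obtain w' where w': "w' \<in> Lp p" "has_weak_deriv (\<lambda>k. \<alpha> k + mi_unit i k) v w'"
    using ex[of "\<lambda>k. \<alpha> k + mi_unit i k"] \<alpha> by (auto simp: mi_order_add_unit)
  note weak_deriv_in_Lp[OF w'(1) has_weak_deriv_compose[OF \<alpha>v(1) w'(2)]]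
  then show "has_weak_deriv (mi_unit i) (weak_deriv \<alpha> v) (weak_deriv (mi_unit i) (weak_deriv \<alpha> v))"
    and "weak_deriv (mi_unit i) (weak_deriv \<alpha> v) \<in> Lp p" by auto
qed

section \<open>The Gagliardo semi-norm of a Sobolev function\<close>

lemma norm_powr_le_sum:
  fixes x :: "real^'n::finite"
  assumes "p \<ge> 0"
  shows "norm x powr p \<le> real CARD('n) powr p * (\<Sum>i\<in>UNIV. \<bar>x $ i\<bar> powr p)"
proof -
  let ?f = "\<lambda>i. \<bar>x $ i\<bar>"
  have "Max (range ?f) \<in> range ?f" by (intro Max_in) auto
  then obtain k where k_max: "Max (range ?f) = ?f k" by blast
  have k: "?f i \<le> ?f k" for i
    unfolding k_max[symmetric] by (intro Max_ge) auto
  have "norm x \<le> (\<Sum>i\<in>UNIV. \<bar>x $ i\<bar>)" by (rule norm_le_l1_cart)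
  also have "\<dots> \<le> (\<Sum>i\<in>(UNIV::'n set). \<bar>x $ k\<bar>)" by (intro sum_mono k)
  also have "\<dots> = CARD('n) * \<bar>x $ k\<bar>" by simp
  finally have "norm x powr p \<le> (CARD('n) * \<bar>x $ k\<bar>) powr p"
    using assms by (intro powr_mono2) auto
  also have "\<dots> = CARD('n) powr p * \<bar>x $ k\<bar> powr p" by (rule powr_mult)
  also have "\<bar>x $ k\<bar> powr p \<le> (\<Sum>i\<in>UNIV. \<bar>x $ i\<bar> powr p)"
    by (rule member_le_sum) auto
  finally show ?thesis by (simp add: mult_left_mono)
qed

lemma borel_measurable_vec_lambda:
  fixes f :: "'n::finite \<Rightarrow> 'a \<Rightarrow> real"
  assumes "\<And>i. f i \<in> borel_measurable M"
  shows "(\<lambda>x. \<chi> i. f i x) \<in> borel_measurable M"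
  using assms by (subst borel_measurable_euclidean_space) (auto simp: Basis_vec_def inner_axis)

text \<open>
  A null set times the whole space is a null set of the product.
\<close>

lemma AE_lebesgue_pair:
  fixes u u' :: "'a::euclidean_space \<Rightarrow> real"
  assumes "AE x in lebesgue. u x = u' x"
  shows "AE z in (lebesgue :: ('a \<times> 'a) measure). u (fst z) = u' (fst z) \<and> u (snd z) = u' (snd z)"
proof -
  have "AE x in lborel. u x = u' x" using assms by (simp add: AE_completion_iff)
  then obtain N where N: "{x. u x \<noteq> u' x} \<subseteq> N" "N \<in> sets lborel" "emeasure lborel N = 0"
    by (auto elim!: AE_E)
  have "emeasure (lborel \<Otimes>\<^sub>M lborel) (N \<times> (UNIV :: 'a set)) = 0" "emeasure (lborel \<Otimes>\<^sub>M lborel) ((UNIV :: 'a set) \<times> N) = 0"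
    using N by (simp_all add: lborel.emeasure_pair_measure_Times)
  then have "(N \<times> UNIV) \<union> (UNIV \<times> N) \<in> null_sets (lborel :: ('a \<times> 'a) measure)"
    using N by (intro null_sets.Un null_setsI) (auto simp: lborel_prod[symmetric])
  then have "AE z in (lborel :: ('a \<times> 'a) measure). u (fst z) = u' (fst z) \<and> u (snd z) = u' (snd z)"
    by (rule AE_I') (use N in auto)
  then show ?thesis by (rule AE_completion)
qed

lemma (in borel_W1p) double_integral_eq_energy:
  "(\<integral>\<^sup>+(x, y). ennreal (\<bar>u x - u y\<bar> powr p / norm (x - y) powr (real CARD('n) + p * \<sigma>)) \<partial>lebesgue) = energy \<sigma>"
proof -
  let ?q = "real CARD('n) + p * \<sigma>"
  let ?f = "\<lambda>x y. ennreal (\<bar>u x - u y\<bar> powr p / norm (x - y) powr ?q)"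
  have [measurable]: "(\<lambda>(x, y). ?f x y) \<in> borel_measurable (lborel \<Otimes>\<^sub>M lborel)" by measurable
  have "(\<integral>\<^sup>+(x, y). ?f x y \<partial>lebesgue) = (\<integral>\<^sup>+(x, y). ?f x y \<partial>(lborel \<Otimes>\<^sub>M lborel))"
    by (simp only: nn_integral_completion lborel_prod)
  also have "\<dots> = (\<integral>\<^sup>+x. \<integral>\<^sup>+y. ?f x y \<partial>lborel \<partial>lborel)"
    by (subst lborel.nn_integral_fst[symmetric]) auto
  also have "\<dots> = (\<integral>\<^sup>+x. \<integral>\<^sup>+h. ?f x (h + x) \<partial>lborel \<partial>lborel)"
    by (intro nn_integral_cong nn_integral_lborel_shift[symmetric]) simp
  also have "\<dots> = (\<integral>\<^sup>+h. \<integral>\<^sup>+x. ?f x (h + x) \<partial>lborel \<partial>lborel)"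
    by (rule lborel_pair.Fubini'[symmetric]) measurable
  also have "\<dots> = energy \<sigma>"
    unfolding energy_def
  proof (rule nn_integral_cong)
    fix h :: "real^'n"
    have "(\<integral>\<^sup>+x. ?f x (h + x) \<partial>lborel) = (\<integral>\<^sup>+x. ennreal (\<bar>u (x + h) - u x\<bar> powr p) * frac_kernel \<sigma> h \<partial>lborel)"
    proof (rule nn_integral_cong)
      fix x
      have "\<bar>u x - u (h + x)\<bar> powr p / norm (x - (h + x)) powr ?q = \<bar>u (x + h) - u x\<bar> powr p * norm h powr - ?q"
        by (simp add: powr_minus_divide abs_minus_commute add.commute del: minus_add_distrib)
      then show "?f x (h + x) = ennreal (\<bar>u (x + h) - u x\<bar> powr p) * frac_kernel \<sigma> h"
        by (simp only: frac_kernel_def ennreal_mult'[symmetric] powr_ge_zero)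
    qed
    also have "\<dots> = increment h * frac_kernel \<sigma> h"
      unfolding increment_def by (rule nn_integral_multc) simp
    finally show "(\<integral>\<^sup>+x. ?f x (h + x) \<partial>lborel) = increment h * frac_kernel \<sigma> h" .
  qed
  finally show ?thesis .
qed

text \<open>
  Passing to Borel representatives of \<open>u\<close> and of its weak gradient changes none of the integrals.
\<close>

lemma gagliardo_integral_limit:
  fixes u :: "real^'n::finite \<Rightarrow> real" and \<nu> :: "real^'n"
  assumes p: "1 \<le> p" and \<nu>: "norm \<nu> = 1"
    and u: "u \<in> Lp p" and Du: "\<And>i. has_weak_deriv (mi_unit i) u (weak_deriv (mi_unit i) u)"
    and DuL: "\<And>i. weak_deriv (mi_unit i) u \<in> Lp p"
  shows "((\<lambda>\<sigma>. ennreal (1 - \<sigma>) * (\<integral>\<^sup>+(x, y). ennreal (\<bar>u x - u y\<bar> powr p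
            / norm (x - y) powr (real CARD('n) + p * \<sigma>)) \<partial>lebesgue))
     \<longlongrightarrow> ennreal (1 / p * K_const p \<nu> * grad_norm p u powr p)) (at_left 1)"
proof -
  let ?d = "\<lambda>i. weak_deriv (mi_unit i) u"
  have um: "u \<in> borel_measurable lebesgue" and dm: "?d i \<in> borel_measurable lebesgue" for i
    using u DuL[of i] by (auto simp: Lp_def)
  obtain u' where u': "u' \<in> borel_measurable borel" "AE x in lebesgue. u x = u' x"
    by (rule borel_representative[OF um]) (rule that)
  have "\<exists>d'. d' \<in> borel_measurable borel \<and> (AE x in lebesgue. ?d i x = d' x)" for i
    by (rule borel_representative[OF dm]) blast
  then obtain d' where d': "\<And>i. d' i \<in> borel_measurable borel" "\<And>i. AE x in lebesgue. ?d i x = d' i x"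
    by metis
  define g where "g x = (\<chi> i. d' i x)" for x
  note [measurable] = um dm
  have [measurable]: "u' \<in> borel_measurable lebesgue" "d' i \<in> borel_measurable lebesgue" for i
    using u' d' by (auto intro: measurable_completion)
  have g_borel: "g \<in> borel_measurable borel"
    unfolding g_def using d'(1) by (intro borel_measurable_vec_lambda) simp
  then have [measurable]: "g \<in> borel_measurable lebesgue" by (simp add: measurable_completion)
  have "AE x in lebesgue. \<forall>i. ?d i x = d' i x"
    using d'(2) by (subst AE_all_countable) auto
  then have g: "AE x in lebesgue. weak_gradient u x = g x"
    by eventually_elim (simp add: weak_gradient_def g_def)
  have [measurable]: "weak_gradient u \<in> borel_measurable lebesgue"
    unfolding weak_gradient_def[abs_def] using dm by (intro borel_measurable_vec_lambda)
  have int: "integrable lebesgue (\<lambda>x. norm (weak_gradient u x) powr p)"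
  proof (rule Bochner_Integration.integrable_bound)
    show "integrable lebesgue (\<lambda>x. real CARD('n) powr p * (\<Sum>i\<in>UNIV. \<bar>?d i x\<bar> powr p))"
      using DuL by (intro integrable_mult_right Bochner_Integration.integrable_sum) (simp add: Lp_def)
    show "AE x in lebesgue. norm (norm (weak_gradient u x) powr p) \<le> norm (real CARD('n) powr p * (\<Sum>i\<in>UNIV. \<bar>?d i x\<bar> powr p))"
    proof (rule AE_I2)
      fix x
      show "norm (norm (weak_gradient u x) powr p) \<le> norm (real CARD('n) powr p * (\<Sum>i\<in>UNIV. \<bar>?d i x\<bar> powr p))"
        using norm_powr_le_sum[of p "weak_gradient u x"] p by (simp add: weak_gradient_def sum_nonneg)
    qed
  qed simp
  define I where "I = (LINT x|lebesgue. norm (weak_gradient u x) powr p)"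
  have "(\<integral>\<^sup>+x. ennreal (norm (g x) powr p) \<partial>lborel) = (\<integral>\<^sup>+x. ennreal (norm (g x) powr p) \<partial>lebesgue)"
    by (rule nn_integral_completion[symmetric])
  also have "\<dots> = (\<integral>\<^sup>+x. ennreal (norm (weak_gradient u x) powr p) \<partial>lebesgue)"
    by (rule nn_integral_cong_AE, use g in eventually_elim) simp
  also have "\<dots> = ennreal I"
    unfolding I_def using int by (intro nn_integral_eq_integral) auto
  finally have gI: "(\<integral>\<^sup>+x. ennreal (norm (g x) powr p) \<partial>lborel) = ennreal I" .
  have uI: "(\<integral>\<^sup>+x. ennreal (\<bar>u' x\<bar> powr p) \<partial>lborel) < \<infinity>"
  proof -
    have "(\<integral>\<^sup>+x. ennreal (\<bar>u' x\<bar> powr p) \<partial>lborel) = (\<integral>\<^sup>+x. ennreal (\<bar>u' x\<bar> powr p) \<partial>lebesgue)"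
      by (rule nn_integral_completion[symmetric])
    also have "\<dots> = (\<integral>\<^sup>+x. ennreal (\<bar>u x\<bar> powr p) \<partial>lebesgue)"
      by (rule nn_integral_cong_AE, use u'(2) in eventually_elim) simp
    also have "\<dots> < \<infinity>"
      using u by (simp add: Lp_def integrable_iff_bounded)
    finally show ?thesis .
  qed
  interpret borel_W1p p u' g
  proof
    fix \<phi> :: "real^'n \<Rightarrow> real" and i assume \<phi>: "test_function \<phi>"
    then have sm: "smooth \<phi>" by (simp add: test_function_def)
    have "(LINT x|lborel. u' x * partial_deriv i \<phi> x) = (LINT x|lebesgue. u x * partial_deriv i \<phi> x)"
      by (intro integral_representative[symmetric] um u' test_function_measurable test_function_partial_deriv \<phi>)
    also have "\<dots> = (- 1) ^ mi_order (mi_unit i) * (LINT x|lebesgue. ?d i x * \<phi> x)"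
      using Du[of i] \<phi> unfolding has_weak_deriv_def classical_deriv_mi_unit[OF sm, symmetric] by blast
    also have "\<dots> = - (LINT x|lebesgue. ?d i x * \<phi> x)"
      by (simp add: mi_order_unit)
    also have "(LINT x|lebesgue. ?d i x * \<phi> x) = (LINT x|lborel. d' i x * \<phi> x)"
      by (intro integral_representative dm d' test_function_measurable \<phi>)
    finally show "(LINT x|lborel. u' x * partial_deriv i \<phi> x) = - (LINT x|lborel. g x $ i * \<phi> x)"
      by (simp add: g_def)
  qed (use p u' g_borel uI gI in auto)
  have eq: "(\<integral>\<^sup>+(x, y). ennreal (\<bar>u x - u y\<bar> powr p / norm (x - y) powr (real CARD('n) + p * \<sigma>)) \<partial>lebesgue) = energy \<sigma>" for \<sigma>
  proof -
    have "(\<integral>\<^sup>+(x, y). ennreal (\<bar>u x - u y\<bar> powr p / norm (x - y) powr (real CARD('n) + p * \<sigma>)) \<partial>lebesgue)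
      = (\<integral>\<^sup>+(x, y). ennreal (\<bar>u' x - u' y\<bar> powr p / norm (x - y) powr (real CARD('n) + p * \<sigma>)) \<partial>lebesgue)"
      by (rule nn_integral_cong_AE, use AE_lebesgue_pair[OF u'(2)] in eventually_elim) auto
    then show ?thesis by (simp only: double_integral_eq_energy)
  qed
  have "I \<ge> 0" unfolding I_def by (rule integral_nonneg_AE) simp
  then have gn: "grad_norm p u powr p = I"
    using p by (simp add: grad_norm_def I_def[symmetric] powr_powr)
  have "K_const p \<nu> \<ge> 0" unfolding K_const_def by (rule integral_nonneg_AE) simp
  then have "ennreal (1 / p) * (ennreal (K_const p \<nu>) * gradient_energy) = ennreal (1 / p * K_const p \<nu> * grad_norm p u powr p)"
    using p by (simp add: gradient_energy_def gI gn ennreal_mult'[symmetric])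
  then show ?thesis
    unfolding eq using energy_limit[OF \<nu>] by simp
qed

theorem theorem3p3:
  fixes v :: "real^'n::finite \<Rightarrow> real" and \<nu> :: "real^'n"
    and p :: real and l :: nat
  assumes "1 \<le> p"
    and "v \<in> sobolev (l + 1) p"
    and "norm \<nu> = 1"
  shows "((\<lambda>\<sigma>. ennreal (1 - \<sigma>) * gagliardo_pow l \<sigma> p v) \<longlongrightarrow>
           ennreal (1 / p * K_const p \<nu> * grad_seminorm l p v powr p)) (at_left 1)"
proof -
  let ?A = "{\<alpha> :: 'n multi_index. mi_order \<alpha> = l}"
  let ?E = "\<lambda>\<alpha> \<sigma>. \<integral>\<^sup>+(x, y). ennreal (\<bar>weak_deriv \<alpha> v x - weak_deriv \<alpha> v y\<bar> powr p
            / norm (x - y) powr (real CARD('n) + p * \<sigma>)) \<partial>lebesgue"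
  let ?L = "\<lambda>\<alpha>. 1 / p * K_const p \<nu> * grad_norm p (weak_deriv \<alpha> v) powr p"
  have "((\<lambda>\<sigma>. \<Sum>\<alpha>\<in>?A. ennreal (1 - \<sigma>) * ?E \<alpha> \<sigma>) \<longlongrightarrow> (\<Sum>\<alpha>\<in>?A. ennreal (?L \<alpha>))) (at_left 1)"
    using assms weak_deriv_of_sobolev[OF assms(2)] by (intro tendsto_sum gagliardo_integral_limit) auto
  moreover have "(\<lambda>\<sigma>. \<Sum>\<alpha>\<in>?A. ennreal (1 - \<sigma>) * ?E \<alpha> \<sigma>) = (\<lambda>\<sigma>. ennreal (1 - \<sigma>) * gagliardo_pow l \<sigma> p v)"
    by (simp add: gagliardo_pow_def sum_distrib_left)
  moreover have "(\<Sum>\<alpha>\<in>?A. ennreal (?L \<alpha>)) = ennreal (1 / p * K_const p \<nu> * grad_seminorm l p v powr p)"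
  proof -
    have K: "K_const p \<nu> \<ge> 0" unfolding K_const_def by (rule integral_nonneg_AE) simp
    have "grad_seminorm l p v powr p = (\<Sum>\<alpha>\<in>?A. grad_norm p (weak_deriv \<alpha> v) powr p)"
      using assms(1) by (simp add: grad_seminorm_def powr_powr sum_nonneg)
    moreover have "(\<Sum>\<alpha>\<in>?A. ennreal (?L \<alpha>)) = ennreal (\<Sum>\<alpha>\<in>?A. ?L \<alpha>)"
      using K assms(1) by (intro sum_ennreal) auto
    ultimately show ?thesis by (simp add: sum_distrib_left)
  qed
  ultimately show ?thesis by simp
qed

end
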